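(* Let $Z=\{Z_t,\ t\ge0\}$ be a real strictly stable process with index $\alpha\in(0,2]$. For every $p>\max(1,\alpha)$, the positive random variable $\|Z\|_p^p$ is not strictly stable.
   Context: A real strictly stable process with index $\alpha\in(0,2]$ is a real Lévy process $Z$ (with $Z_0=0$) such that for every $k>0$, $\{Z_{kt},\,t\ge0\}$ and $\{k^{1/\alpha}Z_t,\,t\ge0\}$ have the same law; the trivial case where $Z$ is a pure drift (including $Z\equiv 0$) is excluded. So for $\alpha=2$, $Z=aW$ with $a\ne0$ and $W$ a standard linear Brownian motion; for $\alpha<2$, $Z$ has a nonzero Lévy measure of the form $c_+z^{-\alpha-1}\mathbf 1_{\{z>0\}}dz+c_-|z|^{-\alpha-1}\mathbf 1_{\{z<0\}}dz$. A càdlàg (continuous if $\alpha=2$) version is used. The strong $p$-variation on $[0,1]$ of a function $f$ is $$\|f\|_p=\left(\sup_{t_0<\dots<t_k\in[0,1]}\sum_{j=1}^k|f(t_j)-f(t_{j-1})|^p\right)^{1/p},$$ the supremum being over all $k$ and all such finite sequences; it is known that $\|Z\|_p<\infty$ a.s. if and only if $p>\alpha$. A real random variable $X$ is strictly stable if there is an index $\beta\in(0,2]$ such that for every $n\ge1$, $X_1+\dots+X_n$ has the same law as $n^{1/\beta}X$, where $X_1,\dots,X_n$ are independent copies of $X$. *)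

theory Defs
  imports "HOL-Probability.Probability"
begin

locale levy_process = prob_space M for M :: "'a measure" +
  fixes Z :: "real \<Rightarrow> 'a \<Rightarrow> real"
  assumes random_variable_Z: "\<And>t. 0 \<le> t \<Longrightarrow> random_variable borel (Z t)"
    and Z_zero: "AE \<omega> in M. Z 0 \<omega> = 0"
    and indep_increments:
      "\<And>(n::nat) (t::nat \<Rightarrow> real). 0 \<le> t 0 \<Longrightarrow> strict_mono_on {..n} t \<Longrightarrow>
         indep_vars (\<lambda>_. borel) (\<lambda>j \<omega>. Z (t (Suc j)) \<omega> - Z (t j) \<omega>) {..<n}"
    and stationary_increments:
      "\<And>s t. 0 \<le> s \<Longrightarrow> s < t \<Longrightarrow>
         distr M borel (\<lambda>\<omega>. Z t \<omega> - Z s \<omega>) = distr M borel (Z (t - s))"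
    and right_continuous_paths:
      "\<And>\<omega> t. \<omega> \<in> space M \<Longrightarrow> 0 \<le> t \<Longrightarrow> continuous (at_right t) (\<lambda>s. Z s \<omega>)"
    and left_limits:
      "\<And>\<omega> t. \<omega> \<in> space M \<Longrightarrow> 0 < t \<Longrightarrow> \<exists>l. ((\<lambda>s. Z s \<omega>) \<longlongrightarrow> l) (at_left t)"

text \<open>
  The law of a process is its law on the product space over the time set \<open>{0..}\<close>.
  For \<open>\<alpha> = 2\<close> the continuous version of the process is chosen.
\<close>

locale strictly_stable_process = levy_process M Z
  for M :: "'a measure" and Z :: "real \<Rightarrow> 'a \<Rightarrow> real" +
  fixes \<alpha> :: real
  assumes index_pos: "0 < \<alpha>"
    and index_le_2: "\<alpha> \<le> 2"
    and self_similar: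
      "\<And>k. 0 < k \<Longrightarrow>
         distr M (Pi\<^sub>M {0..} (\<lambda>_. borel)) (\<lambda>\<omega>. \<lambda>t\<in>{0..}. Z (k * t) \<omega>) =
         distr M (Pi\<^sub>M {0..} (\<lambda>_. borel)) (\<lambda>\<omega>. \<lambda>t\<in>{0..}. k powr (1 / \<alpha>) * Z t \<omega>)"
    and not_pure_drift: "\<not> (\<exists>b. AE \<omega> in M. \<forall>t\<ge>0. Z t \<omega> = b * t)"
    and continuous_paths:
      "\<And>\<omega>. \<alpha> = 2 \<Longrightarrow> \<omega> \<in> space M \<Longrightarrow> continuous_on {0..} (\<lambda>t. Z t \<omega>)"

definition variation_sup :: "real \<Rightarrow> (real \<Rightarrow> real) \<Rightarrow> ennreal" where
  "variation_sup p f =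
     (SUP (k, t) \<in> {(k::nat, t::nat \<Rightarrow> real). strict_mono_on {..k} t \<and> t ` {..k} \<subseteq> {0..1}}.
        ennreal (\<Sum>j=1..k. \<bar>f (t j) - f (t (j - 1))\<bar> powr p))"

definition strong_variation :: "real \<Rightarrow> (real \<Rightarrow> real) \<Rightarrow> ennreal" where
  "strong_variation p f =
     (if variation_sup p f = \<infinity> then \<infinity>
      else ennreal (enn2real (variation_sup p f) powr (1 / p)))"

text \<open>
  The independent copies \<open>X\<^sub>1, \<dots>, X\<^sub>n\<close> of \<open>X\<close> are realised as the coordinates on the
  \<open>n\<close>-fold product of the law of \<open>X\<close>, so that their existence imposes nothing on \<open>M\<close>.
\<close>

definition strictly_stable_rv :: "'a measure \<Rightarrow> ('a \<Rightarrow> real) \<Rightarrow> bool" where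
  "strictly_stable_rv M X \<longleftrightarrow>
     X \<in> borel_measurable M \<and>
     (\<exists>\<beta>. 0 < \<beta> \<and> \<beta> \<le> 2 \<and>
        (\<forall>n::nat. n \<ge> 1 \<longrightarrow>
           distr (Pi\<^sub>M {..<n} (\<lambda>_. distr M borel X)) borel (\<lambda>x. \<Sum>i<n. x i) =
           distr M borel (\<lambda>\<omega>. real n powr (1 / \<beta>) * X \<omega>)))"

text \<open>
  \<open>\<parallel>Z\<parallel>\<^sub>p\<^sup>p\<close> as a real random variable. Where the variation is infinite \<open>enn2real\<close>
  gives \<open>0\<close>; for a strictly stable process of index \<open>\<alpha>\<close> and \<open>p > \<alpha>\<close> this is a null set.
\<close>

definition variation_power :: "real \<Rightarrow> (real \<Rightarrow> 'a \<Rightarrow> real) \<Rightarrow> 'a \<Rightarrow> real" where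
  "variation_power p Z \<omega> = enn2real (strong_variation p (\<lambda>t. Z t \<omega>)) powr p"

end

theory Submission
  imports Defs
begin

text \<open>
  Let \<open>V\<close> be the \<open>p\<close>-th power of the \<open>p\<close>-variation on \<open>[0, 1]\<close>. It is almost surely finite: for the
  random walk on a dyadic grid, restarting at the first oscillation larger than \<open>r\<close> shows that the
  expected number of increments larger than \<open>r\<close> is at most of order \<open>r\<close> to the power \<open>- \<alpha>\<close>, uniformly
  in the mesh, and \<open>p > \<alpha>\<close> makes the sum over geometric levels \<open>r\<close> converge.

  Suppose \<open>V\<close> is strictly stable with index \<open>\<beta>\<close>. If \<open>\<beta> \<le> \<alpha> / p\<close>, cut \<open>[0, 1]\<close> into \<open>N\<close> blocks:
  \<open>V\<close> dominates the sum of the block variations, which are independent copies of \<open>V\<close> scaled by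
  \<open>N powr (- p / \<alpha>)\<close>, and comparing Laplace transforms forces equality. But with positive probability
  all blocks have increments of the same sign and of size at least \<open>\<epsilon> N powr (- 1 / \<alpha>)\<close> while their
  variations stay below \<open>K N powr (- p / \<alpha>)\<close>; then \<open>V\<close> is at least of order \<open>N powr (p - p / \<alpha>)\<close> and
  the sum at most of order \<open>N powr (1 - p / \<alpha>)\<close>, which is impossible for large \<open>N\<close> since \<open>p > 1\<close>.
  If \<open>\<beta> > \<alpha> / p\<close> and \<open>\<alpha> < 2\<close>, the tails of the stable variable \<open>V\<close>, which dominates the \<open>p\<close>-th power
  of the absolute value of \<open>Z\<^sub>1\<close>, give \<open>Z\<^sub>1\<close> a moment of some order \<open>\<gamma> > \<alpha>\<close>, contradicting the
  behaviour of its characteristic function at \<open>0\<close>. If \<open>\<alpha> = 2\<close>, then \<open>Z\<^sub>1\<close> has Gaussian tails and \<open>V\<close>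
  has a finite mean; hence \<open>\<beta> = 1\<close> and \<open>exp (- V)\<close> has variance zero, although \<open>V\<close> is unbounded.
\<close>

section \<open>Chain sums and the strong variation\<close>

text \<open>Self-similarity and stationarity make the increments of \<open>Z\<close> over the dyadic
  grid of level \<open>n\<close>, multiplied by \<open>2 powr (n / \<alpha>)\<close>, a walk whose
  step law \<open>\<mu>\<close> does not depend on \<open>n\<close>. Every estimate is therefore
  made for one such walk, with constants free of \<open>n\<close>, and right continuity carries it
  to the full variation as a supremum over grids. The obstacle to a direct moment argument is that
  for \<alpha> < 2 a single increment has infinite moments of every order above \<alpha>: counting
  separates large increments from small ones, so that finiteness needs only the probability of the
  large ones and the expectation of the small ones. For the same reason block sums are compared
  through Laplace transforms, which are bounded and pass to the limit without moments. The case
  \<alpha> = 2 stands apart because the contradiction from a moment of order \<gamma> rests on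
  bounding \<open>1 - cos u\<close> by a multiple of |u| to the power \<gamma>, which stops at
  \<gamma> = 2. There the Gaussian law is derived from stability, through the characteristic
  function of the symmetrised step.\<close>

text \<open>
  The weight is either the \<open>p\<close>-th power of the absolute value (variation) or the indicator of large
  increments (counting).
\<close>

fun chain_sum :: "(real \<Rightarrow> ennreal) \<Rightarrow> ('b \<Rightarrow> real) \<Rightarrow> 'b list \<Rightarrow> ennreal" where
  "chain_sum w f (x # y # zs) = w (f y - f x) + chain_sum w f (y # zs)"
| "chain_sum w f [x] = 0"
| "chain_sum w f [] = 0"

text \<open>Strictly increasing lists instead of indexed sequences make induction available; an
  arbitrary linear order serves both for real times and for indices of a walk.\<close>

definition chain_lists :: "'b::linorder set \<Rightarrow> 'b list set" where
  "chain_lists T = {xs. sorted_wrt (<) xs \<and> set xs \<subseteq> T}"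

definition chain_sup :: "(real \<Rightarrow> ennreal) \<Rightarrow> ('b::linorder \<Rightarrow> real) \<Rightarrow> 'b set \<Rightarrow> ennreal" where
  "chain_sup w f T = (SUP xs\<in>chain_lists T. chain_sum w f xs)"

lemma Nil_chain_lists [simp]: "[] \<in> chain_lists T"
  by (simp add: chain_lists_def)

lemma chain_sup_upper: "xs \<in> chain_lists T \<Longrightarrow> chain_sum w f xs \<le> chain_sup w f T"
  unfolding chain_sup_def by (rule SUP_upper)

lemma chain_sup_least: "(\<And>xs. xs \<in> chain_lists T \<Longrightarrow> chain_sum w f xs \<le> c) \<Longrightarrow> chain_sup w f T \<le> c"
  unfolding chain_sup_def by (rule SUP_least)

lemma chain_sup_mono: "S \<subseteq> T \<Longrightarrow> chain_sup w f S \<le> chain_sup w f T"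
  by (intro chain_sup_least chain_sup_upper) (auto simp: chain_lists_def)

lemma chain_sup_pair: "s \<in> T \<Longrightarrow> t \<in> T \<Longrightarrow> s < t \<Longrightarrow> w (f t - f s) \<le> chain_sup w f T"
  using chain_sup_upper[of "[s, t]" T w f] by (simp add: chain_lists_def)

lemma chain_sum_map: "chain_sum w f (map g xs) = chain_sum w (\<lambda>t. f (g t)) xs"
  by (induction xs rule: induct_list012) auto

lemma chain_sum_cong_diff:
  "(\<And>s t. s \<in> set xs \<Longrightarrow> t \<in> set xs \<Longrightarrow> f t - f s = g t - g s) \<Longrightarrow> chain_sum w f xs = chain_sum w g xs"
  by (induction w f xs rule: chain_sum.induct) auto

text \<open>Only increments enter, so a path may be replaced by one that differs from it by a
  constant. This is how a walk is restarted at a later time and how \<open>Z 0\<close>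
  disappears.\<close>

lemma chain_sup_cong_diff:
  assumes "\<And>s t. s \<in> T \<Longrightarrow> t \<in> T \<Longrightarrow> f t - f s = g t - g s"
  shows "chain_sup w f T = chain_sup w g T"
  unfolding chain_sup_def using assms
  by (intro SUP_cong refl chain_sum_cong_diff) (auto simp: chain_lists_def subset_iff)

lemma sorted_wrt_map_strict_mono_on:
  fixes g :: "'b::linorder \<Rightarrow> 'c::linorder"
  assumes g: "strict_mono_on T g" and xs: "set xs \<subseteq> T"
  shows "sorted_wrt (<) (map g xs) \<longleftrightarrow> sorted_wrt (<) xs"
proof -
  have "s < t \<longleftrightarrow> g s < g t" if "s \<in> T" "t \<in> T" for s t
    using that strict_mono_on_less[OF g] by blast
  then show ?thesis using xs
    unfolding sorted_wrt_map by (induction xs) auto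
qed

text \<open>A strictly increasing time change puts the chains in \<open>T\<close> and in its image
  in bijection. It moves between dyadic times, walk indices and shifted indices.\<close>

lemma chain_sup_image:
  assumes g: "strict_mono_on T g"
  shows "chain_sup w f (g ` T) = chain_sup w (\<lambda>t. f (g t)) T"
proof -
  have "chain_lists (g ` T) = map g ` chain_lists T"
  proof (intro equalityI subsetI)
    fix xs assume xs: "xs \<in> chain_lists (g ` T)"
    then have "xs \<in> lists (g ` T)" by (auto simp: chain_lists_def)
    then have "xs \<in> map g ` lists T" by (simp only: lists_image)
    then obtain ys where ys: "set ys \<subseteq> T" "xs = map g ys"
      by (auto simp: lists_eq_set)
    then show "xs \<in> map g ` chain_lists T" using xs sorted_wrt_map_strict_mono_on[OF g, of ys]
      by (auto simp: chain_lists_def)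
  next
    fix xs assume "xs \<in> map g ` chain_lists T"
    then show "xs \<in> chain_lists (g ` T)"
      using sorted_wrt_map_strict_mono_on[OF g] by (force simp: chain_lists_def)
  qed
  then show ?thesis by (simp add: chain_sup_def image_image chain_sum_map)
qed

lemma chain_sum_append_shared:
  "xs \<noteq> [] \<Longrightarrow> chain_sum w f (xs @ ys) = chain_sum w f xs + chain_sum w f (last xs # ys)"
proof (induction w f xs rule: chain_sum.induct)
  case (1 w f x y zs) then show ?case by (simp add: add.assoc)
qed (auto)

lemma chain_sum_append_ge: "chain_sum w f xs + chain_sum w f ys \<le> chain_sum w f (xs @ ys)"
proof (cases "xs = []")
  case False
  have "chain_sum w f ys \<le> chain_sum w f (last xs # ys)" by (cases ys) auto
  then show ?thesis using False by (simp add: chain_sum_append_shared add_left_mono)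
qed auto

text \<open>The only increment seen by neither part leads from the end of \<open>xs\<close> to the
  start of \<open>ys\<close>, and it weighs at most 1.\<close>

lemma chain_sum_append_le:
  assumes "\<And>x. w x \<le> 1"
  shows "chain_sum w f (xs @ ys) \<le> chain_sum w f xs + 1 + chain_sum w f ys"
proof (cases "xs = []")
  case False
  have "chain_sum w f (last xs # ys) \<le> 1 + chain_sum w f ys"
    using assms by (cases ys) (auto intro: add_right_mono)
  then show ?thesis using False by (simp add: chain_sum_append_shared add_left_mono add.assoc)
next
  case True then show ?thesis by (simp add: le_iff_add add_ac)
qed

lemma chain_sum_le_length:
  assumes "\<And>x. w x \<le> 1"
  shows "chain_sum w f xs \<le> of_nat (length xs)"
  using assms
proof (induction w f xs rule: chain_sum.induct)
  case (1 w f x y zs)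
  have "w (f y - f x) + chain_sum w f (y # zs) \<le> 1 + of_nat (length (y # zs))"
    by (intro add_mono 1)
  then show ?case by simp
qed auto

lemma chain_sup_le_card:
  assumes "\<And>x. w x \<le> 1" "finite T"
  shows "chain_sup w f T \<le> of_nat (card T)"
proof (rule chain_sup_least)
  fix xs assume "xs \<in> chain_lists T"
  then have xs: "sorted_wrt (<) xs" "set xs \<subseteq> T" by (auto simp: chain_lists_def)
  then have "length xs = card (set xs)"
    by (simp add: distinct_card strict_sorted_iff)
  then have "length xs \<le> card T" using xs assms by (simp add: card_mono)
  with chain_sum_le_length[of w f xs] assms show "chain_sum w f xs \<le> of_nat (card T)"
    by (meson of_nat_mono order_trans)
qed

lemma chain_sup_superadd:
  assumes AB: "\<And>a b. a \<in> A \<Longrightarrow> b \<in> B \<Longrightarrow> a \<le> b"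
  shows "chain_sup w f A + chain_sup w f B \<le> chain_sup w f (A \<union> B)"
proof -
  have *: "chain_sum w f xs + chain_sum w f ys \<le> chain_sup w f (A \<union> B)"
    if xs: "xs \<in> chain_lists A" and ys: "ys \<in> chain_lists B" for xs ys
  proof (cases "xs = [] \<or> ys = []")
    case True
    then show ?thesis
      using chain_sup_upper[of "xs @ ys" "A \<union> B" w f] xs ys by (auto simp: chain_lists_def subset_iff)
  next
    case False
    then obtain y zs where y: "ys = y # zs" by (cases ys) auto
    obtain us u where u: "xs = us @ [u]" using False by (cases xs rule: rev_cases) auto
    then have le: "a \<le> last xs" if "a \<in> set xs" for a
      using that xs by (auto simp: chain_lists_def sorted_wrt_append)
    have lA: "last xs \<in> A" using xs False by (auto simp: chain_lists_def)
    have yB: "y \<in> B" using y ys by (auto simp: chain_lists_def)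
    have zsy: "\<And>b. b \<in> set zs \<Longrightarrow> y < b" using y ys by (auto simp: chain_lists_def)
    \<comment> \<open>\<open>A\<close> and \<open>B\<close> may share one point, as consecutive
      blocks do. A chain ending there and one starting there are joined without repeating the point,
      so no increment is lost or added. Otherwise the extra increment at the junction only
      helps.\<close>
    show ?thesis
    proof (cases "last xs = y")
      case True
      have "xs @ zs \<in> chain_lists (A \<union> B)"
        using xs ys y le_less_trans[OF le] zsy True by (auto simp: chain_lists_def sorted_wrt_append)
      then show ?thesis using chain_sum_append_shared[of xs w f zs] False True y
          chain_sup_upper[of "xs @ zs" "A \<union> B" w f] by auto
    next
      case False
      then have "last xs < y" using AB[OF lA yB] by simp
      then have "xs @ ys \<in> chain_lists (A \<union> B)"
        using xs ys y le_less_trans[OF le] less_trans[OF _ zsy] by (auto simp: chain_lists_def sorted_wrt_append)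
      then show ?thesis
        using chain_sup_upper[of "xs @ ys" "A \<union> B" w f] chain_sum_append_ge[of w f xs ys] by (meson order_trans)
    qed
  qed
  \<comment> \<open>The supremum commutes with addition of a constant over nonempty index
    sets.\<close>
  have ne: "chain_lists A \<noteq> {}" "chain_lists B \<noteq> {}" using Nil_chain_lists by blast+
  have "chain_sup w f A + chain_sup w f B
      = (SUP xs\<in>chain_lists A. SUP ys\<in>chain_lists B. chain_sum w f xs + chain_sum w f ys)"
    unfolding chain_sup_def
    by (simp only: ennreal_SUP_add_left[OF ne(1), symmetric] ennreal_SUP_add_right[OF ne(2), symmetric])
  also have "\<dots> \<le> chain_sup w f (A \<union> B)" using * by (auto intro!: SUP_least)
  finally show ?thesis .
qed

lemma chain_sup_superadd_blocks:
  fixes f :: "nat \<Rightarrow> real"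
  shows "(\<Sum>j<N. chain_sup w f {j * m..Suc j * m}) \<le> chain_sup w f {..N * m}"
proof (induction N)
  case (Suc N)
  have "(\<Sum>j<Suc N. chain_sup w f {j * m..Suc j * m})
      \<le> chain_sup w f {..N * m} + chain_sup w f {N * m..Suc N * m}"
    using Suc by (simp add: add_right_mono)
  also have "\<dots> \<le> chain_sup w f ({..N * m} \<union> {N * m..Suc N * m})"
    by (rule chain_sup_superadd) auto
  also have "\<dots> \<le> chain_sup w f {..Suc N * m}"
    by (rule chain_sup_mono) auto
  finally show ?case .
qed simp

lemma chain_lists_split:
  assumes "xs \<in> chain_lists T"
  shows "filter (\<lambda>x. x < c) xs \<in> chain_lists (T \<inter> {..<c})"
    and "filter (\<lambda>x. c \<le> x) xs \<in> chain_lists (T \<inter> {c..})"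
    and "xs = filter (\<lambda>x. x < c) xs @ filter (\<lambda>x. c \<le> x) xs"
proof -
  show "xs = filter (\<lambda>x. x < c) xs @ filter (\<lambda>x. c \<le> x) xs"
    using assms
  proof (induction xs)
    case (Cons x xs)
    have "c \<le> x \<Longrightarrow> filter (\<lambda>x. x < c) xs = []"
      using Cons.prems by (auto simp: chain_lists_def filter_empty_conv)
    then show ?case using Cons by (auto simp: chain_lists_def)
  qed simp
qed (use assms in \<open>auto simp: chain_lists_def sorted_wrt_filter\<close>)

text \<open>Cutting at \<open>c\<close> loses at most the single increment that jumps over
  \<open>c\<close>. A bounded weight thus makes the supremum additive up to 1 per cut, which is the
  advantage of counting over the power weight.\<close>

lemma chain_sup_subadd:
  assumes w: "\<And>x. w x \<le> 1"
  shows "chain_sup w f T \<le> chain_sup w f (T \<inter> {..<c}) + 1 + chain_sup w f (T \<inter> {c..})"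
proof (rule chain_sup_least)
  fix xs assume xs: "xs \<in> chain_lists T"
  note s = chain_lists_split[OF xs, of c]
  have "chain_sum w f xs \<le> chain_sum w f (filter (\<lambda>x. x < c) xs) + 1 + chain_sum w f (filter (\<lambda>x. c \<le> x) xs)"
    by (subst s(3)) (rule chain_sum_append_le[OF w])
  also have "\<dots> \<le> chain_sup w f (T \<inter> {..<c}) + 1 + chain_sup w f (T \<inter> {c..})"
    by (intro add_mono chain_sup_upper s order_refl)
  finally show "chain_sum w f xs \<le> \<dots>" .
qed

lemma chain_sup_subadd_blocks:
  fixes f :: "nat \<Rightarrow> real"
  assumes w: "\<And>x. w x \<le> 1"
  shows "chain_sup w f {..N * m} \<le> (\<Sum>j<N. chain_sup w f {j * m..Suc j * m}) + of_nat N"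
proof (induction N)
  case 0
  have "chain_sum w f xs \<le> 0" if "xs \<in> chain_lists {..0::nat}" for xs
    using that by (cases "(w, f, xs)" rule: chain_sum.cases) (auto simp: chain_lists_def)
  then have "chain_sup w f {..0} \<le> 0" by (rule chain_sup_least)
  then show ?case by simp
next
  case (Suc N)
  have "chain_sup w f {..Suc N * m} \<le> chain_sup w f ({..Suc N * m} \<inter> {..<N * m}) + 1 + chain_sup w f ({..Suc N * m} \<inter> {N * m..})"
    by (rule chain_sup_subadd[OF w])
  also have "\<dots> \<le> chain_sup w f {..N * m} + 1 + chain_sup w f {N * m..Suc N * m}"
    by (intro add_mono chain_sup_mono order_refl) auto
  also have "\<dots> \<le> ((\<Sum>j<N. chain_sup w f {j * m..Suc j * m}) + of_nat N) + 1 + chain_sup w f {N * m..Suc N * m}"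
    by (intro add_mono Suc order_refl)
  also have "\<dots> = (\<Sum>j<Suc N. chain_sup w f {j * m..Suc j * m}) + of_nat (Suc N)"
    by (simp add: add_ac)
  finally show ?case .
qed

text \<open>If \<open>c\<close> is the first time at which the oscillation is large, a chain
  collects nothing before \<open>c\<close>, possibly one increment crossing \<open>c\<close>, and
  then what lies after \<open>c\<close>.\<close>

lemma chain_sup_first_exit:
  assumes w: "\<And>x. w x \<le> 1" and zero: "\<And>s t. s \<in> T \<Longrightarrow> t \<in> T \<Longrightarrow> s < t \<Longrightarrow> t < c \<Longrightarrow> w (f t - f s) = 0"
  shows "chain_sup w f T \<le> 1 + chain_sup w f (T \<inter> {c..})"
proof -
  have "chain_sum w f xs \<le> 0" if "xs \<in> chain_lists (T \<inter> {..<c})" for xs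
    using that
  proof (induction xs rule: induct_list012)
    case (3 x y zs)
    then show ?case using zero[of x y] by (auto simp: chain_lists_def)
  qed auto
  then have "chain_sup w f (T \<inter> {..<c}) \<le> 0" by (rule chain_sup_least)
  then show ?thesis using chain_sup_subadd[where w=w and f=f and T=T and c=c, OF w] by simp
qed

lemma chain_sup_scale:
  assumes "\<And>x. w (a * x) = b * w x"
  shows "chain_sup w (\<lambda>t. a * f t) T = b * chain_sup w f T"
proof -
  have "chain_sum w (\<lambda>t. a * f t) xs = b * chain_sum w f xs" for xs
    by (induction xs rule: induct_list012) (auto simp: assms distrib_left right_diff_distrib[symmetric])
  then show ?thesis
    by (simp add: chain_sup_def SUP_mult_left_ennreal)
qed

lemma chain_sum_mono_weight: "(\<And>x. w x \<le> v x) \<Longrightarrow> chain_sum w f xs \<le> chain_sum v f xs"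
  by (induction xs rule: induct_list012) (auto intro: add_mono)

lemma chain_sup_mono_weight: "(\<And>x. w x \<le> v x) \<Longrightarrow> chain_sup w f T \<le> chain_sup v f T"
  unfolding chain_sup_def by (intro SUP_mono) (auto intro: chain_sum_mono_weight)

lemma chain_sum_add_weight: "chain_sum (\<lambda>x. v x + w x) f xs = chain_sum v f xs + chain_sum w f xs"
  by (induction xs rule: induct_list012) (auto simp: add_ac)

lemma chain_sum_suminf_weight:
  "chain_sum (\<lambda>x. \<Sum>k. a k * w k x) f xs = (\<Sum>k. a k * chain_sum (w k) f xs)"
  by (induction xs rule: induct_list012) (auto simp: distrib_left suminf_add[symmetric])

lemma chain_sup_add_weight: "chain_sup (\<lambda>x. v x + w x) f T \<le> chain_sup v f T + chain_sup w f T"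
  by (rule chain_sup_least) (auto simp: chain_sum_add_weight intro!: add_mono chain_sup_upper)

lemma chain_sup_suminf_weight:
  "chain_sup (\<lambda>x. \<Sum>k. a k * w k x) f T \<le> (\<Sum>k. a k * chain_sup (w k) f T)"
  by (rule chain_sup_least)
    (auto simp: chain_sum_suminf_weight intro!: suminf_le mult_left_mono chain_sup_upper)

lemma borel_measurable_chain_sum:
  assumes [measurable]: "w \<in> borel_measurable borel" and "\<And>t. t \<in> set xs \<Longrightarrow> f t \<in> borel_measurable M"
  shows "(\<lambda>\<omega>. chain_sum w (\<lambda>t. f t \<omega>) xs) \<in> borel_measurable M"
  using assms(2)
proof (induction xs rule: induct_list012)
  case (3 x y zs)
  then have [measurable]: "f x \<in> borel_measurable M" "f y \<in> borel_measurable M"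
    "(\<lambda>\<omega>. chain_sum w (\<lambda>t. f t \<omega>) (y # zs)) \<in> borel_measurable M" by auto
  show ?case by simp
qed auto

text \<open>A countable \<open>T\<close> has only countably many finite chains; hence the passage to
  grids.\<close>

lemma borel_measurable_chain_sup:
  assumes "w \<in> borel_measurable borel" "countable T" "\<And>t. t \<in> T \<Longrightarrow> f t \<in> borel_measurable M"
  shows "(\<lambda>\<omega>. chain_sup w (\<lambda>t. f t \<omega>) T) \<in> borel_measurable M"
proof -
  have "chain_lists T \<subseteq> lists T" by (auto simp: chain_lists_def)
  then have "countable (chain_lists T)" using assms(2) countable_lists countable_subset by blast
  then show ?thesis unfolding chain_sup_def
    using assms by (intro borel_measurable_SUP borel_measurable_chain_sum) (auto simp: chain_lists_def)
qed

lemma chain_sup_incseq_Union: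
  assumes G: "incseq G"
  shows "chain_sup w f (\<Union>n. G n) = (SUP n. chain_sup w f (G n))"
proof (rule antisym)
  show "chain_sup w f (\<Union>n. G n) \<le> (SUP n. chain_sup w f (G n))"
  proof (rule chain_sup_least)
    fix xs assume xs: "xs \<in> chain_lists (\<Union>n. G n)"
    have "\<exists>n. set ys \<subseteq> G n" if "set ys \<subseteq> (\<Union>n. G n)" for ys
      using that
    proof (induction ys)
      case (Cons y ys)
      then obtain m n where "y \<in> G m" "set ys \<subseteq> G n" by auto
      then have "set (y # ys) \<subseteq> G (max m n)"
        using incseqD[OF G, of m "max m n"] incseqD[OF G, of n "max m n"] by auto
      then show ?case by blast
    qed simp
    then obtain n where "xs \<in> chain_lists (G n)" using xs unfolding chain_lists_def by blast
    then show "chain_sum w f xs \<le> (SUP n. chain_sup w f (G n))"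
      by (meson SUP_upper UNIV_I chain_sup_upper order_trans)
  qed
  show "(SUP n. chain_sup w f (G n)) \<le> chain_sup w f (\<Union>n. G n)"
    by (intro SUP_least chain_sup_mono) auto
qed

lemma chain_sum_eq_sum:
  "chain_sum w f xs = (\<Sum>j\<in>{1..<length xs}. w (f (xs ! j) - f (xs ! (j - 1))))"
proof (induction xs rule: induct_list012)
  case (3 x y zs)
  have "(\<Sum>j\<in>{1..<length (x # y # zs)}. w (f ((x # y # zs) ! j) - f ((x # y # zs) ! (j - 1))))
    = (\<Sum>j\<in>{0..<length (y # zs)}. w (f ((x # y # zs) ! Suc j) - f ((x # y # zs) ! j)))"
    using sum.shift_bounds_Suc_ivl[of "\<lambda>j. w (f ((x # y # zs) ! j) - f ((x # y # zs) ! (j - 1)))" 0 "length (y # zs)"]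
    by simp
  also have "\<dots> = w (f y - f x) + (\<Sum>j\<in>{1..<length (y # zs)}. w (f ((x # y # zs) ! Suc j) - f ((x # y # zs) ! j)))"
    by (subst sum.atLeast_Suc_lessThan) auto
  also have "(\<Sum>j\<in>{1..<length (y # zs)}. w (f ((x # y # zs) ! Suc j) - f ((x # y # zs) ! j)))
     = (\<Sum>j\<in>{1..<length (y # zs)}. w (f ((y # zs) ! j) - f ((y # zs) ! (j - 1))))"
    by (intro sum.cong refl) (auto simp: nth_Cons split: nat.split)
  finally show ?case using 3 by simp
qed auto

section \<open>Power weight, strong variation and dyadic grids\<close>

definition pow_weight :: "real \<Rightarrow> real \<Rightarrow> ennreal" where
  "pow_weight p x = ennreal (\<bar>x\<bar> powr p)"

lemma borel_measurable_pow_weight [measurable]: "pow_weight p \<in> borel_measurable borel"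
  unfolding pow_weight_def by measurable

lemma pow_weight_mult: "pow_weight p (a * x) = ennreal (\<bar>a\<bar> powr p) * pow_weight p x"
  by (simp add: pow_weight_def abs_mult powr_mult ennreal_mult)

lemma variation_sup_eq_chain_sup: "variation_sup p f = chain_sup (pow_weight p) f {0..1}"
proof (rule antisym)
  show "variation_sup p f \<le> chain_sup (pow_weight p) f {0..1}"
    unfolding variation_sup_def
  proof (rule SUP_least, clarify)
    fix k :: nat and t :: "nat \<Rightarrow> real"
    assume t: "strict_mono_on {..k} t" "t ` {..k} \<subseteq> {0..1}"
    let ?xs = "map t [0..<Suc k]"
    have "sorted_wrt (<) ?xs"
      unfolding sorted_wrt_iff_nth_less
      using strict_mono_onD[OF t(1)] by (auto simp del: upt_Suc)
    then have "?xs \<in> chain_lists {0..1}" using t(2) by (auto simp: chain_lists_def simp del: upt_Suc)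
    then have "chain_sum (pow_weight p) f ?xs \<le> chain_sup (pow_weight p) f {0..1}"
      by (rule chain_sup_upper)
    also have "chain_sum (pow_weight p) f ?xs = (\<Sum>j=1..k. pow_weight p (f (t j) - f (t (j - 1))))"
      unfolding chain_sum_eq_sum by (intro sum.cong) (auto simp del: upt_Suc)
    finally show "ennreal (\<Sum>j=1..k. \<bar>f (t j) - f (t (j - 1))\<bar> powr p) \<le> chain_sup (pow_weight p) f {0..1}"
      by (simp add: pow_weight_def[abs_def] sum_nonneg)
  qed
  show "chain_sup (pow_weight p) f {0..1} \<le> variation_sup p f"
  proof (rule chain_sup_least)
    fix xs :: "real list" assume xs: "xs \<in> chain_lists {0..1}"
    show "chain_sum (pow_weight p) f xs \<le> variation_sup p f"
    proof (cases "xs = []")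
      case False
      \<comment> \<open>\<open>Suc k\<close> points correspond to \<open>k\<close> increments; the
        empty list, which has no counterpart in \<open>variation_sup\<close>, contributes 0.\<close>
      define k where "k = length xs - 1"
      have k: "length xs = Suc k" using False by (simp add: k_def)
      have "strict_mono_on {..k} ((!) xs)" "(!) xs ` {..k} \<subseteq> {0..1}"
        using xs k by (auto simp: chain_lists_def strict_mono_on_def sorted_wrt_iff_nth_less subset_iff)
      then have "(k, (!) xs) \<in> {(k::nat, t::nat \<Rightarrow> real). strict_mono_on {..k} t \<and> t ` {..k} \<subseteq> {0..1}}" by simp
      from SUP_upper[OF this, of "\<lambda>(k, t). ennreal (\<Sum>j=1..k. \<bar>f (t j) - f (t (j - 1))\<bar> powr p)"]
      have "ennreal (\<Sum>j=1..k. \<bar>f (xs ! j) - f (xs ! (j - 1))\<bar> powr p) \<le> variation_sup p f"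
        by (simp add: variation_sup_def)
      moreover have "chain_sum (pow_weight p) f xs = ennreal (\<Sum>j=1..k. \<bar>f (xs ! j) - f (xs ! (j - 1))\<bar> powr p)"
        unfolding chain_sum_eq_sum k by (simp add: pow_weight_def sum_nonneg atLeastLessThanSuc_atLeastAtMost)
      ultimately show ?thesis by simp
    qed simp
  qed
qed

definition dyadic_grid :: "nat \<Rightarrow> real set" where
  "dyadic_grid n = (\<lambda>i. real i / 2 ^ n) ` {..2 ^ n}"

lemma incseq_dyadic_grid: "incseq dyadic_grid"
proof (rule incseq_SucI, safe)
  fix n x assume "x \<in> dyadic_grid n"
  then obtain i where "i \<le> 2 ^ n" "x = real i / 2 ^ n" by (auto simp: dyadic_grid_def)
  then show "x \<in> dyadic_grid (Suc n)"
    unfolding dyadic_grid_def by (intro image_eqI[of _ _ "2 * i"]) auto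
qed

text \<open>Rounding is upwards so that right continuity of a path suffices for convergence of its
  values at the rounded times.\<close>

definition dyadic_ceiling :: "nat \<Rightarrow> real \<Rightarrow> real" where
  "dyadic_ceiling n t = real (nat \<lceil>t * 2 ^ n\<rceil>) / 2 ^ n"

lemma dyadic_ceiling_in_grid: "0 \<le> t \<Longrightarrow> t \<le> 1 \<Longrightarrow> dyadic_ceiling n t \<in> dyadic_grid n"
  unfolding dyadic_ceiling_def dyadic_grid_def
  by (intro image_eqI[of _ _ "nat \<lceil>t * 2 ^ n\<rceil>"] refl) (simp add: nat_le_iff ceiling_le_iff)

lemma dyadic_ceiling_ge: "t \<le> dyadic_ceiling n t"
  unfolding dyadic_ceiling_def by (simp add: field_simps real_nat_ceiling_ge)

lemma dyadic_ceiling_le: "0 \<le> t \<Longrightarrow> dyadic_ceiling n t \<le> t + 1 / 2 ^ n"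
proof -
  assume "0 \<le> t"
  then have "real (nat \<lceil>t * 2 ^ n\<rceil>) \<le> t * 2 ^ n + 1" by (simp add: of_nat_nat ceiling_mono)
  then show ?thesis unfolding dyadic_ceiling_def by (simp add: field_simps)
qed

lemma tendsto_dyadic_ceiling: "0 \<le> t \<Longrightarrow> (\<lambda>n. dyadic_ceiling n t) \<longlonglongrightarrow> t"
proof (rule tendsto_sandwich[OF _ _ tendsto_const])
  assume "0 \<le> t"
  show "(\<lambda>n. t + 1 / 2 ^ n) \<longlonglongrightarrow> t"
    using tendsto_add[OF tendsto_const LIMSEQ_realpow_zero[of "1/2"], of t] by (simp add: power_one_over)
qed (auto simp: dyadic_ceiling_ge dyadic_ceiling_le)

text \<open>Each chain in the unit interval, rounded up to the grid of level \<open>n\<close>, has a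
  chain sum converging to its own.\<close>

lemma variation_sup_eq_dyadic:
  assumes rc: "\<And>t. 0 \<le> t \<Longrightarrow> continuous (at_right t) f" and p: "p > 0"
  shows "variation_sup p f = (SUP n. chain_sup (pow_weight p) f (dyadic_grid n))"
proof -
  let ?w = "pow_weight p"
  have "chain_sup ?w f {0..1} \<le> chain_sup ?w f (\<Union>n. dyadic_grid n)"
  proof (rule chain_sup_least)
    fix xs :: "real list" assume xs: "xs \<in> chain_lists {0..1}"
    have f_lim: "(\<lambda>n. f (dyadic_ceiling n t)) \<longlonglongrightarrow> f t" if "0 \<le> t" for t
    proof -
      have "continuous (at t within {t..}) f" using rc[OF that] by (simp add: continuous_within at_within_Ici_at_right)
      then show ?thesis
        using tendsto_dyadic_ceiling[OF that] dyadic_ceiling_ge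
        unfolding continuous_within_sequentially by (auto simp: o_def)
    qed
    have lim: "(\<lambda>n. chain_sum ?w f (map (dyadic_ceiling n) ys)) \<longlonglongrightarrow> chain_sum ?w f ys"
      if "set ys \<subseteq> {0..}" for ys
      using that
    proof (induction ys rule: induct_list012)
      case (3 x y zs)
      have "(\<lambda>n. \<bar>f (dyadic_ceiling n y) - f (dyadic_ceiling n x)\<bar> powr p) \<longlonglongrightarrow> \<bar>f y - f x\<bar> powr p"
        using 3 p by (intro tendsto_powr' tendsto_rabs tendsto_diff f_lim) (auto intro!: always_eventually)
      then have "(\<lambda>n. ?w (f (dyadic_ceiling n y) - f (dyadic_ceiling n x))) \<longlonglongrightarrow> ?w (f y - f x)"
        unfolding pow_weight_def by (intro tendsto_ennrealI)
      then show ?case using 3 by (auto intro!: tendsto_add)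
    qed auto
    \<comment> \<open>Two points may round to the same grid point while the grid is coarse.
      Strictness holds once \<open>dyadic_ceiling n y\<close> has dropped below \<open>z\<close>,
      which is at most \<open>dyadic_ceiling n z\<close>.\<close>
    have sorted: "eventually (\<lambda>n. sorted_wrt (<) (map (dyadic_ceiling n) ys)) sequentially"
      if "sorted_wrt (<) ys" "set ys \<subseteq> {0..}" for ys
      using that
    proof (induction ys)
      case (Cons y ys)
      have "eventually (\<lambda>n. dyadic_ceiling n y < dyadic_ceiling n z) sequentially" if "z \<in> set ys" for z
        using order_tendstoD(2)[OF tendsto_dyadic_ceiling[of y], of z] Cons.prems that
        by (auto elim!: eventually_mono intro: less_le_trans[OF _ dyadic_ceiling_ge])
      then have "eventually (\<lambda>n. \<forall>z\<in>set ys. dyadic_ceiling n y < dyadic_ceiling n z) sequentially"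
        by (simp add: eventually_ball_finite)
      then show ?case using Cons by (auto elim: eventually_elim2)
    qed simp
    have "eventually (\<lambda>n. chain_sum ?w f (map (dyadic_ceiling n) xs) \<le> chain_sup ?w f (\<Union>n. dyadic_grid n)) sequentially"
    proof (rule eventually_mono[OF sorted])
      fix n assume "sorted_wrt (<) (map (dyadic_ceiling n) xs)"
      then have "map (dyadic_ceiling n) xs \<in> chain_lists (\<Union>n. dyadic_grid n)"
        using xs by (auto simp: chain_lists_def subset_iff intro!: exI[of _ n] dyadic_ceiling_in_grid)
      then show "chain_sum ?w f (map (dyadic_ceiling n) xs) \<le> chain_sup ?w f (\<Union>n. dyadic_grid n)"
        by (rule chain_sup_upper)
    qed (use xs in \<open>auto simp: chain_lists_def\<close>)
    then show "chain_sum ?w f xs \<le> chain_sup ?w f (\<Union>n. dyadic_grid n)"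
      using xs by (intro tendsto_upperbound[OF lim]) (auto simp: chain_lists_def)
  qed
  moreover have "chain_sup ?w f (\<Union>n. dyadic_grid n) \<le> chain_sup ?w f {0..1}"
    by (intro chain_sup_mono) (auto simp: dyadic_grid_def divide_simps)
  ultimately show ?thesis
    using chain_sup_incseq_Union[OF incseq_dyadic_grid, of ?w f] by (simp add: variation_sup_eq_chain_sup)
qed

lemma chain_sup_dyadic_grid:
  "chain_sup w f (dyadic_grid n) = chain_sup w (\<lambda>i. f (real i / 2 ^ n)) {..2 ^ n}"
  unfolding dyadic_grid_def by (rule chain_sup_image) (auto simp: strict_mono_on_def divide_strict_right_mono)

section \<open>Random walks with independent identically distributed steps\<close>

abbreviation seq_borel :: "(nat \<Rightarrow> real) measure" where
  "seq_borel \<equiv> PiM UNIV (\<lambda>_. borel)"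

definition psum :: "(nat \<Rightarrow> real) \<Rightarrow> nat \<Rightarrow> real" where
  "psum x k = (\<Sum>i<k. x i)"

text \<open>The past is padded with zeros instead of restricted, so that past, future and whole path
  are points of the same sequence space and one functional applies to all of them.\<close>

definition trunc :: "nat \<Rightarrow> (nat \<Rightarrow> real) \<Rightarrow> nat \<Rightarrow> real" where
  "trunc m x = (\<lambda>i. if i < m then x i else 0)"

definition shift :: "nat \<Rightarrow> (nat \<Rightarrow> real) \<Rightarrow> nat \<Rightarrow> real" where
  "shift j x = (\<lambda>i. x (j + i))"

lemma psum_0 [simp]: "psum x 0 = 0"
  by (simp add: psum_def)

lemma psum_trunc: "k \<le> m \<Longrightarrow> psum (trunc m x) k = psum x k"
  unfolding psum_def trunc_def by (intro sum.cong) auto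

lemma psum_shift: "psum (shift j x) k = psum x (j + k) - psum x j"
  by (induction k) (auto simp: psum_def shift_def)

lemma trunc_trunc: "i \<le> k \<Longrightarrow> trunc i (trunc k x) = trunc i x"
  by (auto simp: trunc_def)

lemma measurable_psum [measurable]: "(\<lambda>x. psum x k) \<in> borel_measurable seq_borel"
  unfolding psum_def by measurable

lemma measurable_trunc [measurable]: "trunc m \<in> measurable seq_borel seq_borel"
  unfolding trunc_def by (intro measurable_abs_UNIV) measurable

lemma measurable_shift [measurable]: "shift m \<in> measurable seq_borel seq_borel"
  unfolding shift_def by (intro measurable_abs_UNIV) measurable

text \<open>The increments inside a block are functions of its own \<open>m\<close> steps alone. In
  this form the independence of disjoint blocks applies directly.\<close>

lemma chain_sup_psum_block:
  "chain_sup w (psum x) {j..j + m} = chain_sup w (psum (trunc m (shift j x))) {..m}"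
proof -
  have "(\<lambda>i. j + i) ` {..m} = {j..j + m}"
    using image_add_atLeastAtMost[of j 0 m] by (simp add: atLeast0AtMost add.commute)
  then have "chain_sup w (psum x) {j..j + m} = chain_sup w (\<lambda>i. psum x (j + i)) {..m}"
    using chain_sup_image[of "{..m}" "\<lambda>i. j + i" w "psum x"] by (simp add: strict_mono_on_def)
  also have "\<dots> = chain_sup w (psum (trunc m (shift j x))) {..m}"
    by (rule chain_sup_cong_diff) (simp add: psum_trunc psum_shift)
  finally show ?thesis .
qed

lemma chain_sup_psum_trunc: "chain_sup w (psum (trunc m x)) {..m} = chain_sup w (psum x) {..m}"
  by (rule chain_sup_cong_diff) (simp add: psum_trunc)

lemma measurable_chain_sup_psum [measurable]:
  "w \<in> borel_measurable borel \<Longrightarrow> (\<lambda>x. chain_sup w (psum x) {..m}) \<in> borel_measurable seq_borel"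
  by (rule borel_measurable_chain_sup) auto

text \<open>The event that the first time with property \<open>A\<close> equals \<open>k\<close>.
  Working with these disjoint events, not with a stopping time, spares a value for the case that the
  time never comes.\<close>

definition first_at :: "(nat \<Rightarrow> (nat \<Rightarrow> real) \<Rightarrow> bool) \<Rightarrow> nat \<Rightarrow> (nat \<Rightarrow> real) \<Rightarrow> bool" where
  "first_at A k x \<longleftrightarrow> A k x \<and> (\<forall>i<k. \<not> A i x)"

lemma first_at_unique: "first_at A k x \<Longrightarrow> first_at A l x \<Longrightarrow> k = l"
  unfolding first_at_def by (metis linorder_neqE_nat)

lemma ex_first_at: "(\<exists>k\<le>m. A k x) \<longleftrightarrow> (\<exists>k\<le>m. first_at A k x)"
proof
  assume "\<exists>k\<le>m. A k x"
  then obtain k where k: "k \<le> m" "A k x" by auto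
  have "first_at A (LEAST k. A k x) x" unfolding first_at_def
    using LeastI[of "\<lambda>k. A k x", OF k(2)] not_less_Least[of _ "\<lambda>k. A k x"] by blast
  moreover have "(LEAST k. A k x) \<le> k" using Least_le[of "\<lambda>k. A k x", OF k(2)] .
  ultimately show "\<exists>k\<le>m. first_at A k x" using k(1) order_trans by blast
qed (auto simp: first_at_def)

lemma sum_first_at:
  fixes h :: "nat \<Rightarrow> ennreal"
  assumes "k \<le> m" "first_at A k x"
  shows "(\<Sum>i\<le>m. indicator {x. first_at A i x} x * h i) = h k"
proof -
  have "(\<Sum>i\<le>m. indicator {x. first_at A i x} x * h i) = (\<Sum>i\<le>m. if i = k then h k else 0)"
  proof (intro sum.cong refl)
    fix i show "indicator {x. first_at A i x} x * h i = (if i = k then h k else 0)"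
      using first_at_unique[OF assms(2), of i] assms(2) by (cases "i = k") (auto simp: indicator_def)
  qed
  then show ?thesis using assms by simp
qed

lemma sum_not_first_at:
  fixes h :: "nat \<Rightarrow> ennreal"
  assumes "\<not> (\<exists>k\<le>m. A k x)"
  shows "(\<Sum>i\<le>m. indicator {x. first_at A i x} x * h i) = 0"
  using assms by (intro sum.neutral) (auto simp: first_at_def indicator_def)

section \<open>Independence of past, future and blocks\<close>

locale iid_seq = prob_space M for M :: "'a measure" +
  fixes X :: "nat \<Rightarrow> 'a \<Rightarrow> real" and \<mu> :: "real measure"
  assumes indep_X: "indep_vars (\<lambda>_. borel) X UNIV"
    and law_X: "\<And>i. distr M borel (X i) = \<mu>"
begin

lemma X_measurable [measurable]: "X i \<in> borel_measurable M"
  using indep_X by (auto simp: indep_vars_def)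

definition path :: "'a \<Rightarrow> nat \<Rightarrow> real" where
  "path \<omega> = (\<lambda>i. X i \<omega>)"

lemma path_measurable [measurable]: "path \<in> measurable M seq_borel"
  unfolding path_def by (intro measurable_abs_UNIV) measurable

lemma distr_path: "distr M seq_borel path = PiM UNIV (\<lambda>_. \<mu>)"
proof -
  have "distr M seq_borel (\<lambda>\<omega>. \<lambda>i\<in>UNIV. X i \<omega>) = PiM UNIV (\<lambda>i. distr M borel (X i))"
    using indep_vars_iff_distr_eq_PiM'[where I=UNIV and M'="\<lambda>_. borel" and X=X] indep_X by simp
  then show ?thesis by (simp add: law_X path_def[abs_def] restrict_UNIV)
qed

lemma iid_seq_shift: "iid_seq M (\<lambda>i. X (j + i)) \<mu>"
proof
  show "indep_vars (\<lambda>_. borel) (\<lambda>i. X (j + i)) UNIV"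
  proof -
    have "indep_vars (\<lambda>i. PiM {j + i} (\<lambda>_. borel)) (\<lambda>i \<omega>. restrict (\<lambda>i. X i \<omega>) {j + i}) UNIV"
      by (rule indep_vars_restrict[OF indep_X]) (auto simp: disjoint_family_on_def)
    then have "indep_vars (\<lambda>_. borel) (\<lambda>i \<omega>. restrict (\<lambda>i. X i \<omega>) {j + i} (j + i)) UNIV"
      by (rule indep_vars_compose2) (auto intro: measurable_component_singleton)
    then show ?thesis by simp
  qed
qed (rule law_X)

lemma nn_integral_shift:
  assumes [measurable]: "g \<in> borel_measurable seq_borel"
  shows "(\<integral>\<^sup>+\<omega>. g (shift j (path \<omega>)) \<partial>M) = (\<integral>\<^sup>+\<omega>. g (path \<omega>) \<partial>M)"
proof -
  interpret s: iid_seq M "\<lambda>i. X (j + i)" \<mu> by (rule iid_seq_shift)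
  have "s.path = (\<lambda>\<omega>. shift j (path \<omega>))" by (auto simp: s.path_def path_def shift_def)
  then have "distr M seq_borel (\<lambda>\<omega>. shift j (path \<omega>)) = distr M seq_borel path"
    using s.distr_path distr_path by simp
  then have "integral\<^sup>N (distr M seq_borel (\<lambda>\<omega>. shift j (path \<omega>))) g = integral\<^sup>N (distr M seq_borel path) g"
    by simp
  then show ?thesis by (simp add: nn_integral_distr)
qed

text \<open>\<open>trunc j\<close> reads the steps below \<open>j\<close> and \<open>shift j\<close>
  those from \<open>j\<close> on, two disjoint sets of independent steps; the future moreover has
  the law of the whole path.\<close>

lemma nn_integral_past_future:
  assumes [measurable]: "f \<in> borel_measurable seq_borel" "g \<in> borel_measurable seq_borel"
  shows "(\<integral>\<^sup>+\<omega>. f (trunc j (path \<omega>)) * g (shift j (path \<omega>)) \<partial>M)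
    = (\<integral>\<^sup>+\<omega>. f (trunc j (path \<omega>)) \<partial>M) * (\<integral>\<^sup>+\<omega>. g (path \<omega>) \<partial>M)"
proof -
  let ?I = "\<lambda>A. \<lambda>\<omega>. restrict (\<lambda>i. X i \<omega>) A"
  let ?F = "\<lambda>y. f (trunc j y)" and ?G = "\<lambda>y. g (shift j y)"
  have 1: "indep_var (PiM {..<j} (\<lambda>_. borel)) (?I {..<j}) (PiM {j..} (\<lambda>_. borel)) (?I {j..})"
    by (rule indep_var_restrict[OF indep_X]) auto
  have m1: "trunc j \<in> measurable (PiM {..<j} (\<lambda>_. borel)) seq_borel"
    unfolding trunc_def
  proof (intro measurable_abs_UNIV)
    fix i show "(\<lambda>x. if i < j then x i else 0) \<in> borel_measurable (PiM {..<j} (\<lambda>_. borel))"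
      by (cases "i < j") (auto intro!: measurable_component_singleton)
  qed
  have m2: "shift j \<in> measurable (PiM {j..} (\<lambda>_. borel)) seq_borel"
    unfolding shift_def by (intro measurable_abs_UNIV measurable_component_singleton) auto
  have "indep_var borel (?F \<circ> ?I {..<j}) borel (?G \<circ> ?I {j..})"
    by (intro indep_var_compose[OF 1] measurable_compose[OF m1] measurable_compose[OF m2] assms)
  then have 2: "indep_vars (case_bool borel borel) (case_bool (?F \<circ> ?I {..<j}) (?G \<circ> ?I {j..})) UNIV"
    by (simp add: indep_var_def)
  \<comment> \<open>The pair is indexed by \<open>bool\<close>; the product formula for integrals
    expects a constant family of target spaces.\<close>
  have "(case_bool borel borel :: bool \<Rightarrow> ennreal measure) = (\<lambda>_. borel)"
    by (auto split: bool.split)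
  with 2 have 3: "indep_vars (\<lambda>_. borel) (case_bool (?F \<circ> ?I {..<j}) (?G \<circ> ?I {j..})) UNIV"
    by simp
  have eF: "?F \<circ> ?I {..<j} = (\<lambda>\<omega>. f (trunc j (path \<omega>)))"
    by (rule ext) (auto simp: trunc_def path_def intro!: arg_cong[where f=f])
  have eG: "?G \<circ> ?I {j..} = (\<lambda>\<omega>. g (shift j (path \<omega>)))"
    by (rule ext) (auto simp: shift_def path_def intro!: arg_cong[where f=g])
  have "(\<integral>\<^sup>+\<omega>. f (trunc j (path \<omega>)) * g (shift j (path \<omega>)) \<partial>M)
    = (\<integral>\<^sup>+\<omega>. f (trunc j (path \<omega>)) \<partial>M) * (\<integral>\<^sup>+\<omega>. g (shift j (path \<omega>)) \<partial>M)"
    using indep_vars_nn_integral[OF _ 3] unfolding UNIV_bool by (simp add: eF eG mult.commute)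
  then show ?thesis by (simp add: nn_integral_shift)
qed

lemma nn_integral_prod_blocks:
  assumes [measurable]: "g \<in> borel_measurable seq_borel"
  shows "(\<integral>\<^sup>+\<omega>. (\<Prod>j<N. g (trunc m (shift (j * m) (path \<omega>)))) \<partial>M)
    = (\<integral>\<^sup>+\<omega>. g (trunc m (path \<omega>)) \<partial>M) ^ N"
proof -
  let ?K = "\<lambda>j. {j * m..<Suc j * m}"
  let ?I = "\<lambda>j \<omega>. restrict (\<lambda>i. X i \<omega>) (?K j)"
  let ?G = "\<lambda>j y. g (trunc m (shift (j * m) y))"
  have "disjoint_family_on ?K {..<N}"
    unfolding disjoint_family_on_def
  proof (intro ballI impI)
    fix i j :: nat assume "i \<noteq> j"
    then consider "Suc i \<le> j" | "Suc j \<le> i" by linarith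
    then show "?K i \<inter> ?K j = {}"
      using mult_le_mono1[of "Suc i" j m] mult_le_mono1[of "Suc j" i m] by cases auto
  qed
  then have 1: "indep_vars (\<lambda>j. PiM (?K j) (\<lambda>_. borel)) ?I {..<N}"
    by (intro indep_vars_restrict[OF indep_X]) auto
  have "(\<lambda>y. trunc m (shift (j * m) y)) \<in> measurable (PiM (?K j) (\<lambda>_. borel)) seq_borel" for j
    unfolding trunc_def shift_def
  proof (intro measurable_abs_UNIV)
    fix i show "(\<lambda>y. if i < m then y (j * m + i) else 0) \<in> borel_measurable (PiM (?K j) (\<lambda>_. borel))"
      by (cases "i < m") (auto intro!: measurable_component_singleton)
  qed
  then have "indep_vars (\<lambda>_. borel) (\<lambda>j \<omega>. ?G j (?I j \<omega>)) {..<N}"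
    by (intro indep_vars_compose2[OF 1] measurable_compose[OF _ assms]) auto
  moreover have "?G j (?I j \<omega>) = ?G j (path \<omega>)" for j \<omega>
    by (auto simp: shift_def path_def trunc_def intro!: arg_cong[where f=g])
  ultimately have "indep_vars (\<lambda>_. borel) (\<lambda>j \<omega>. ?G j (path \<omega>)) {..<N}" by simp
  then have "(\<integral>\<^sup>+\<omega>. (\<Prod>j<N. ?G j (path \<omega>)) \<partial>M) = (\<Prod>j<N. \<integral>\<^sup>+\<omega>. ?G j (path \<omega>) \<partial>M)"
    by (intro indep_vars_nn_integral) auto
  also have "\<dots> = (\<Prod>j<N. \<integral>\<^sup>+\<omega>. g (trunc m (path \<omega>)) \<partial>M)"
    using nn_integral_shift[of "\<lambda>y. g (trunc m y)"] by (intro prod.cong) auto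
  finally show ?thesis by simp
qed

context
  fixes A :: "nat \<Rightarrow> (nat \<Rightarrow> real) \<Rightarrow> bool"
  assumes A_measurable [measurable]: "\<And>k. Measurable.pred seq_borel (A k)"
    and A_adapted: "\<And>k x. A k (trunc k x) \<longleftrightarrow> A k x"
begin

lemma first_at_measurable [measurable]: "Measurable.pred seq_borel (first_at A k)"
  unfolding first_at_def by measurable

text \<open>The strong Markov property in discrete form. \<open>A_adapted\<close> says that
  \<open>A k\<close> looks only at the first \<open>k\<close> steps, so \<open>first_at A k\<close>
  does too, and the steps from \<open>k\<close> on are independent of it and form a walk of the same
  law.\<close>

lemma nn_integral_first_at:
  assumes [measurable]: "\<And>k. g k \<in> borel_measurable seq_borel"
  shows "(\<integral>\<^sup>+\<omega>. (\<Sum>k\<le>m. indicator {x. first_at A k x} (path \<omega>) * g k (shift k (path \<omega>))) \<partial>M)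
    = (\<Sum>k\<le>m. emeasure M {\<omega>\<in>space M. first_at A k (path \<omega>)} * (\<integral>\<^sup>+\<omega>. g k (path \<omega>) \<partial>M))"
proof -
  have adapted: "first_at A k (trunc k x) \<longleftrightarrow> first_at A k x" for k x
  proof -
    have "A i (trunc k x) \<longleftrightarrow> A i x" if "i \<le> k" for i
      using A_adapted[of i "trunc k x"] A_adapted[of i x] trunc_trunc[OF that] by simp
    then show ?thesis by (auto simp: first_at_def)
  qed
  have [measurable]: "(indicator {x. first_at A k x} :: _ \<Rightarrow> ennreal) \<in> borel_measurable seq_borel" for k
    by (rule borel_measurable_indicator') measurable
  have "(\<integral>\<^sup>+\<omega>. indicator {x. first_at A k x} (path \<omega>) * g k (shift k (path \<omega>)) \<partial>M)
    = emeasure M {\<omega>\<in>space M. first_at A k (path \<omega>)} * (\<integral>\<^sup>+\<omega>. g k (path \<omega>) \<partial>M)" for k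
  proof -
    have "(\<integral>\<^sup>+\<omega>. indicator {x. first_at A k x} (path \<omega>) * g k (shift k (path \<omega>)) \<partial>M)
      = (\<integral>\<^sup>+\<omega>. indicator {x. first_at A k x} (trunc k (path \<omega>)) * g k (shift k (path \<omega>)) \<partial>M)"
      by (simp add: indicator_def adapted)
    also have "\<dots> = (\<integral>\<^sup>+\<omega>. indicator {x. first_at A k x} (trunc k (path \<omega>)) \<partial>M) * (\<integral>\<^sup>+\<omega>. g k (path \<omega>) \<partial>M)"
      by (rule nn_integral_past_future) measurable
    also have "(\<integral>\<^sup>+\<omega>. indicator {x. first_at A k x} (trunc k (path \<omega>)) \<partial>M)
      = (\<integral>\<^sup>+\<omega>. indicator {\<omega>\<in>space M. first_at A k (path \<omega>)} \<omega> \<partial>M)"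
      by (intro nn_integral_cong) (auto simp: indicator_def adapted)
    finally show ?thesis by simp
  qed
  then show ?thesis by (subst nn_integral_sum) auto
qed

lemma emeasure_first_at:
  "(\<Sum>k\<le>m. emeasure M {\<omega>\<in>space M. first_at A k (path \<omega>)}) = emeasure M {\<omega>\<in>space M. \<exists>k\<le>m. A k (path \<omega>)}"
proof -
  have "(\<Sum>k\<le>m. emeasure M {\<omega>\<in>space M. first_at A k (path \<omega>)})
    = emeasure M (\<Union>k\<in>{..m}. {\<omega>\<in>space M. first_at A k (path \<omega>)})"
    by (rule sum_emeasure) (auto simp: disjoint_family_on_def dest: first_at_unique)
  also have "(\<Union>k\<in>{..m}. {\<omega>\<in>space M. first_at A k (path \<omega>)}) = {\<omega>\<in>space M. \<exists>k\<le>m. A k (path \<omega>)}"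
    using ex_first_at[of m A] by auto
  finally show ?thesis .
qed

end

text \<open>After the first time \<open>k\<close> at which the walk is beyond \<open>2 * r\<close>,
  the remaining \<open>m - k\<close> steps move it by at most \<open>r\<close> with probability at
  least \<open>1 - c\<close>, whatever happened before; it then ends beyond
  \<open>r\<close>.\<close>

lemma ottaviani_inequality:
  assumes c: "\<And>j. j \<le> m \<Longrightarrow> prob {\<omega>\<in>space M. \<bar>psum (path \<omega>) j\<bar> > r} \<le> c"
  shows "(1 - c) * prob {\<omega>\<in>space M. \<exists>k\<le>m. \<bar>psum (path \<omega>) k\<bar> > 2 * r} \<le> prob {\<omega>\<in>space M. \<bar>psum (path \<omega>) m\<bar> > r}"
proof (cases "c \<le> 1")
  case True
  define A where "A k x \<longleftrightarrow> \<bar>psum x k\<bar> > 2 * r" for k x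
  have [measurable]: "Measurable.pred seq_borel (A k)" for k unfolding A_def by measurable
  have adapted: "A k (trunc k x) \<longleftrightarrow> A k x" for k x by (simp add: A_def psum_trunc)
  define g :: "nat \<Rightarrow> (nat \<Rightarrow> real) \<Rightarrow> ennreal" where "g k = indicator {x. \<bar>psum x (m - k)\<bar> \<le> r}" for k
  have [measurable]: "g k \<in> borel_measurable seq_borel" for k
    unfolding g_def by (rule borel_measurable_indicator') measurable
  have g: "ennreal (1 - c) \<le> (\<integral>\<^sup>+\<omega>. g k (path \<omega>) \<partial>M)" for k
  proof -
    have "1 - c \<le> 1 - prob {\<omega>\<in>space M. \<bar>psum (path \<omega>) (m - k)\<bar> > r}" using c[of "m - k"] by simp
    also have "\<dots> = prob {\<omega>\<in>space M. \<not> \<bar>psum (path \<omega>) (m - k)\<bar> > r}"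
      by (rule prob_neg[symmetric]) measurable
    finally have "ennreal (1 - c) \<le> emeasure M {\<omega>\<in>space M. \<bar>psum (path \<omega>) (m - k)\<bar> \<le> r}"
      by (simp add: emeasure_eq_measure not_less)
    also have "\<dots> = (\<integral>\<^sup>+\<omega>. indicator {\<omega>\<in>space M. \<bar>psum (path \<omega>) (m - k)\<bar> \<le> r} \<omega> \<partial>M)"
      by simp
    also have "\<dots> = (\<integral>\<^sup>+\<omega>. g k (path \<omega>) \<partial>M)"
      by (intro nn_integral_cong) (auto simp: g_def indicator_def)
    finally show ?thesis .
  qed
  have "ennreal (1 - c) * emeasure M {\<omega>\<in>space M. \<exists>k\<le>m. A k (path \<omega>)}
     = (\<Sum>k\<le>m. emeasure M {\<omega>\<in>space M. first_at A k (path \<omega>)} * ennreal (1 - c))"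
    by (simp add: emeasure_first_at[of A, OF _ adapted, symmetric] sum_distrib_left mult.commute)
  also have "\<dots> \<le> (\<Sum>k\<le>m. emeasure M {\<omega>\<in>space M. first_at A k (path \<omega>)} * (\<integral>\<^sup>+\<omega>. g k (path \<omega>) \<partial>M))"
    by (intro sum_mono mult_left_mono g) auto
  also have "\<dots> = (\<integral>\<^sup>+\<omega>. (\<Sum>k\<le>m. indicator {x. first_at A k x} (path \<omega>) * g k (shift k (path \<omega>))) \<partial>M)"
    by (rule nn_integral_first_at[of A, OF _ adapted, symmetric]) measurable
  also have "\<dots> \<le> (\<integral>\<^sup>+\<omega>. indicator {\<omega>\<in>space M. \<bar>psum (path \<omega>) m\<bar> > r} \<omega> \<partial>M)"
  proof (intro nn_integral_mono)
    fix \<omega> assume w: "\<omega> \<in> space M"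
    let ?x = "path \<omega>"
    show "(\<Sum>k\<le>m. indicator {x. first_at A k x} ?x * g k (shift k ?x))
      \<le> indicator {\<omega>\<in>space M. \<bar>psum (path \<omega>) m\<bar> > r} \<omega>"
    proof (cases "\<exists>k\<le>m. A k ?x")
      case True
      then obtain k where k: "k \<le> m" "first_at A k ?x" using ex_first_at by blast
      then have "\<bar>psum ?x k\<bar> > 2 * r" by (simp add: first_at_def A_def)
      then have "g k (shift k ?x) \<le> indicator {\<omega>\<in>space M. \<bar>psum (path \<omega>) m\<bar> > r} \<omega>"
        using k(1) w by (auto simp: g_def indicator_def psum_shift)
      then show ?thesis by (simp add: sum_first_at[OF k])
    next
      case False
      show ?thesis unfolding sum_not_first_at[where A=A, OF False] by simp
    qed
  qed
  also have "\<dots> = emeasure M {\<omega>\<in>space M. \<bar>psum (path \<omega>) m\<bar> > r}"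
    by (rule nn_integral_indicator) measurable
  finally show ?thesis using True
    by (simp add: A_def emeasure_eq_measure ennreal_mult'[symmetric])
next
  \<comment> \<open>A negative \<open>1 - c\<close> cannot be carried into \<open>ennreal\<close>;
    the left side is then at most 0.\<close>
  case False
  then have "(1 - c) * prob {\<omega>\<in>space M. \<exists>k\<le>m. \<bar>psum (path \<omega>) k\<bar> > 2 * r} \<le> 0"
    by (intro mult_nonpos_nonneg) auto
  then show ?thesis by (rule order_trans) simp
qed

end

section \<open>Counting large increments\<close>

definition exceed :: "real \<Rightarrow> real \<Rightarrow> ennreal" where
  "exceed r = indicator {x. \<bar>x\<bar> > r}"

lemma exceed_le_1: "exceed r x \<le> 1"
  by (simp add: exceed_def indicator_def)

lemma measurable_exceed [measurable]: "exceed r \<in> borel_measurable borel"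
  unfolding exceed_def by (rule borel_measurable_indicator') measurable

context iid_seq
begin

text \<open>Restarting the walk at the first time its oscillation exceeds \<open>r\<close> costs at most one
  increment, so the number \<open>\<nu>\<close> of increments satisfies \<open>E \<nu> \<le> q (1 + E \<nu>)\<close>.\<close>

lemma nn_integral_exceed_le:
  assumes q: "prob {\<omega>\<in>space M. \<exists>k\<le>m. \<bar>psum (path \<omega>) k\<bar> > r} \<le> q" and "q \<le> 1 / 2"
  shows "(\<integral>\<^sup>+\<omega>. chain_sup (exceed (2 * r)) (psum (path \<omega>)) {..m} \<partial>M) \<le> ennreal (2 * q)"
proof -
  let ?c = "\<lambda>x. chain_sup (exceed (2 * r)) (psum x) {..m}"
  define A where "A k x \<longleftrightarrow> (\<exists>i<k. \<bar>psum x k - psum x i\<bar> > 2 * r)" for k x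
  have [measurable]: "Measurable.pred seq_borel (A k)" for k unfolding A_def by measurable
  have adapted: "A k (trunc k x) \<longleftrightarrow> A k x" for k x by (auto simp: A_def psum_trunc)
  define I where "I = (\<integral>\<^sup>+\<omega>. ?c (path \<omega>) \<partial>M)"
  \<comment> \<open>Finiteness comes first: the inequality \<open>I \<le> q * (1 + I)\<close> yields
    no bound when \<open>I\<close> is infinite.\<close>
  have "I \<le> (\<integral>\<^sup>+\<omega>. of_nat (card {..m}) \<partial>M)"
    unfolding I_def by (intro nn_integral_mono chain_sup_le_card exceed_le_1) auto
  also have "\<dots> < top" by (simp add: emeasure_space_1 ennreal_mult_less_top of_nat_less_top)
  finally have fin: "I < top" .
  have "I \<le> (\<integral>\<^sup>+\<omega>. (\<Sum>k\<le>m. indicator {x. first_at A k x} (path \<omega>) * (1 + ?c (shift k (path \<omega>)))) \<partial>M)"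
    unfolding I_def
  proof (intro nn_integral_mono)
    fix \<omega> assume "\<omega> \<in> space M"
    let ?x = "path \<omega>"
    show "?c ?x \<le> (\<Sum>k\<le>m. indicator {x. first_at A k x} ?x * (1 + ?c (shift k ?x)))"
    proof (cases "\<exists>k\<le>m. A k ?x")
      case True
      then obtain k where k: "k \<le> m" "first_at A k ?x" using ex_first_at by blast
      have "?c ?x \<le> 1 + chain_sup (exceed (2 * r)) (psum ?x) ({..m} \<inter> {k..})"
        using k by (intro chain_sup_first_exit exceed_le_1) (auto simp: first_at_def A_def exceed_def indicator_def)
      also have "{..m} \<inter> {k..} = {k..k + (m - k)}" using k by auto
      \<comment> \<open>Only \<open>m - k\<close> steps remain after \<open>k\<close>; allowing
        \<open>m\<close> of them makes the expectation of the rest independent of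
        \<open>k\<close>.\<close>
      also have "chain_sup (exceed (2 * r)) (psum ?x) {k..k + (m - k)} \<le> ?c (shift k ?x)"
        unfolding chain_sup_psum_block chain_sup_psum_trunc by (rule chain_sup_mono) auto
      finally show ?thesis by (simp add: sum_first_at[OF k])
    next
      case False
      have "chain_sum (exceed (2 * r)) (psum ?x) xs \<le> 0" if "xs \<in> chain_lists {..m}" for xs
        using that
      proof (induction xs rule: induct_list012)
        case (3 x y zs)
        then show ?case using False by (auto simp: chain_lists_def A_def exceed_def indicator_def)
      qed auto
      then have "?c ?x \<le> 0" by (rule chain_sup_least)
      then show ?thesis by simp
    qed
  qed
  also have "\<dots> = (\<Sum>k\<le>m. emeasure M {\<omega>\<in>space M. first_at A k (path \<omega>)} * (\<integral>\<^sup>+\<omega>. 1 + ?c (path \<omega>) \<partial>M))"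
    by (rule nn_integral_first_at[of A, OF _ adapted]) measurable
  also have "\<dots> = emeasure M {\<omega>\<in>space M. \<exists>k\<le>m. A k (path \<omega>)} * (1 + I)"
    by (simp add: emeasure_first_at[of A, OF _ adapted, symmetric] sum_distrib_right nn_integral_add I_def emeasure_space_1)
  also have "emeasure M {\<omega>\<in>space M. \<exists>k\<le>m. A k (path \<omega>)} \<le> emeasure M {\<omega>\<in>space M. \<exists>k\<le>m. \<bar>psum (path \<omega>) k\<bar> > r}"
  proof (rule emeasure_mono)
    show "{\<omega> \<in> space M. \<exists>k\<le>m. A k (path \<omega>)} \<subseteq> {\<omega> \<in> space M. \<exists>k\<le>m. r < \<bar>psum (path \<omega>) k\<bar>}"
    proof safe
      fix \<omega> k assume "k \<le> m" "A k (path \<omega>)"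
      then obtain i where "i < k" "\<bar>psum (path \<omega>) k - psum (path \<omega>) i\<bar> > 2 * r" by (auto simp: A_def)
      \<comment> \<open>An increment larger than \<open>2 * r\<close> has an end point farther than
        \<open>r\<close> from 0. This links the oscillation to the maximum of the walk.\<close>
      then have "\<bar>psum (path \<omega>) k\<bar> > r \<or> \<bar>psum (path \<omega>) i\<bar> > r" by linarith
      then show "\<exists>k\<le>m. r < \<bar>psum (path \<omega>) k\<bar>" using \<open>k \<le> m\<close> \<open>i < k\<close> by (auto intro: exI[of _ i])
    qed
  qed measurable
  also have "\<dots> \<le> ennreal q" using q by (simp add: emeasure_eq_measure ennreal_leI)
  finally have "I \<le> ennreal q * (1 + I)" by (simp add: mult_right_mono)
  moreover obtain i where i: "I = ennreal i" "0 \<le> i" using fin by (cases I) auto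
  moreover have "0 \<le> q" using q measure_nonneg order_trans by blast
  ultimately have "i \<le> q * (1 + i)"
    by (simp add: ennreal_mult[symmetric] ennreal_plus[symmetric] ennreal_1[symmetric] del: ennreal_plus ennreal_1)
  moreover have "q * i \<le> 1 / 2 * i" using assms(2) i by (intro mult_right_mono) auto
  ultimately have "i \<le> 2 * q" by (simp add: algebra_simps)
  then show ?thesis using i by (simp add: I_def[symmetric] ennreal_leI)
qed

end

text \<open>Moving the factor into the weight leaves the plain walk, for which measurability and the
  block formulas are stated.\<close>

lemma chain_sup_rescale: "chain_sup w (\<lambda>t. a * f t) T = chain_sup (\<lambda>x. w (a * x)) f T"
proof -
  have "chain_sum w (\<lambda>t. a * f t) xs = chain_sum (\<lambda>x. w (a * x)) f xs" for xs
    by (induction xs rule: induct_list012) (auto simp: right_diff_distrib)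
  then show ?thesis by (simp add: chain_sup_def)
qed

lemma exceed_mult: "c > 0 \<Longrightarrow> exceed r (c * x) = exceed (r / c) x"
  by (simp add: exceed_def indicator_def abs_mult divide_less_eq mult.commute)

section \<open>Stable random walks\<close>

definition tail :: "real measure \<Rightarrow> real \<Rightarrow> real" where
  "tail \<mu> r = measure \<mu> {x. \<bar>x\<bar> > r}"

text \<open>Self-similarity of the process enters the walk as strict stability of the step law;
  \<open>X 0\<close> stands for any step.\<close>

locale stable_walk = iid_seq M X \<mu>
  for M :: "'a measure" and X :: "nat \<Rightarrow> 'a \<Rightarrow> real" and \<mu> +
  fixes \<alpha> :: real
  assumes \<alpha>_pos: "0 < \<alpha>"
    and law_psum: "\<And>k. 1 \<le> k \<Longrightarrow>
      distr M borel (\<lambda>\<omega>. psum (path \<omega>) k) = distr M borel (\<lambda>\<omega>. real k powr (1 / \<alpha>) * X 0 \<omega>)"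
begin

lemma tail_eq_prob: "tail \<mu> r = prob {\<omega>\<in>space M. \<bar>X 0 \<omega>\<bar> > r}"
proof -
  have "tail \<mu> r = measure (distr M borel (X 0)) {x. \<bar>x\<bar> > r}" by (simp add: tail_def law_X)
  also have "\<dots> = prob {\<omega>\<in>space M. \<bar>X 0 \<omega>\<bar> > r}"
    by (subst measure_distr) (auto intro!: arg_cong[where f=prob])
  finally show ?thesis .
qed

lemma tail_nonneg: "0 \<le> tail \<mu> r"
  by (simp add: tail_def)

lemma prob_psum:
  assumes [measurable]: "Measurable.pred borel P" and "1 \<le> k"
  shows "prob {\<omega>\<in>space M. P (psum (path \<omega>) k)} = prob {\<omega>\<in>space M. P (real k powr (1 / \<alpha>) * X 0 \<omega>)}"
proof -
  have "prob {\<omega>\<in>space M. P (psum (path \<omega>) k)} = measure (distr M borel (\<lambda>\<omega>. psum (path \<omega>) k)) {x\<in>space borel. P x}"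
    by (subst measure_distr) (auto intro!: arg_cong[where f=prob])
  also have "\<dots> = prob {\<omega>\<in>space M. P (real k powr (1 / \<alpha>) * X 0 \<omega>)}"
    unfolding law_psum[OF \<open>1 \<le> k\<close>]
    by (subst measure_distr) (auto intro!: arg_cong[where f=prob])
  finally show ?thesis .
qed

lemma prob_psum_le_tail:
  assumes "k \<le> m" "0 \<le> \<rho>"
  shows "prob {\<omega>\<in>space M. \<bar>psum (path \<omega>) k\<bar> > \<rho> * real m powr (1 / \<alpha>)} \<le> tail \<mu> \<rho>"
proof (cases "k = 0")
  case True
  have "\<not> \<rho> * real m powr (1 / \<alpha>) < 0" using assms by (simp add: not_less)
  then show ?thesis using True by (simp add: tail_nonneg)
next
  case False
  have "prob {\<omega>\<in>space M. \<bar>psum (path \<omega>) k\<bar> > \<rho> * real m powr (1 / \<alpha>)}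
    = prob {\<omega>\<in>space M. \<bar>real k powr (1 / \<alpha>) * X 0 \<omega>\<bar> > \<rho> * real m powr (1 / \<alpha>)}"
    using False by (intro prob_psum) auto
  also have "\<dots> \<le> prob {\<omega>\<in>space M. \<bar>X 0 \<omega>\<bar> > \<rho>}"
  proof (rule finite_measure_mono)
    show "{\<omega>\<in>space M. \<bar>real k powr (1 / \<alpha>) * X 0 \<omega>\<bar> > \<rho> * real m powr (1 / \<alpha>)} \<subseteq> {\<omega>\<in>space M. \<bar>X 0 \<omega>\<bar> > \<rho>}"
    proof safe
      fix \<omega> assume *: "\<bar>real k powr (1 / \<alpha>) * X 0 \<omega>\<bar> > \<rho> * real m powr (1 / \<alpha>)"
      have "\<rho> * real k powr (1 / \<alpha>) \<le> \<rho> * real m powr (1 / \<alpha>)"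
        using assms \<alpha>_pos by (intro mult_left_mono powr_mono2) auto
      also note *
      finally have "\<rho> * real k powr (1 / \<alpha>) < \<bar>X 0 \<omega>\<bar> * real k powr (1 / \<alpha>)"
        by (simp add: abs_mult mult.commute)
      then show "\<rho> < \<bar>X 0 \<omega>\<bar>" using False by simp
    qed
  qed measurable
  finally show ?thesis by (simp add: tail_eq_prob)
qed

text \<open>The bound 1/3 gives Ottaviani's inequality a factor of at least 2/3, whence 3/2 on the
  right, and it makes the resulting probability at most 1/2, as the counting bound requires.\<close>

lemma prob_max_psum_le_tail:
  assumes "tail \<mu> \<rho> \<le> 1 / 3" "0 \<le> \<rho>"
  shows "prob {\<omega>\<in>space M. \<exists>k\<le>m. \<bar>psum (path \<omega>) k\<bar> > 2 * (\<rho> * real m powr (1 / \<alpha>))} \<le> 3 / 2 * tail \<mu> \<rho>"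
    (is "?P \<le> _")
proof -
  have "(1 - tail \<mu> \<rho>) * ?P \<le> tail \<mu> \<rho>"
    using ottaviani_inequality[of m "\<rho> * real m powr (1 / \<alpha>)" "tail \<mu> \<rho>"] prob_psum_le_tail[OF _ assms(2), of _ m]
      prob_psum_le_tail[OF order_refl assms(2), of m] by fastforce
  moreover have "(2 / 3) * ?P \<le> (1 - tail \<mu> \<rho>) * ?P"
    using assms by (intro mult_right_mono) auto
  ultimately show ?thesis by simp
qed

text \<open>The level 4 \<rho> is twice the 2 \<rho> of the maximal inequality, as in
  \<open>nn_integral_exceed_le\<close>, and 3 is twice 3/2.\<close>

lemma nn_integral_exceed_le_tail:
  assumes "tail \<mu> \<rho> \<le> 1 / 3" "0 \<le> \<rho>"
  shows "(\<integral>\<^sup>+\<omega>. chain_sup (exceed (4 * \<rho> * real m powr (1 / \<alpha>))) (psum (path \<omega>)) {..m} \<partial>M) \<le> ennreal (3 * tail \<mu> \<rho>)"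
  using nn_integral_exceed_le[OF prob_max_psum_le_tail[OF assms], of m] assms(1) by (simp add: mult.assoc)

text \<open>On average at most one large increment is found inside each of the \<open>L\<close>
  blocks, and at most \<open>L\<close> more cross block boundaries. Relative to the scale of all
  \<open>L * m\<close> steps the threshold is of order \<open>L powr (- 1 / \<alpha>)\<close>, so
  the count is of order threshold to the power - \<alpha>.\<close>

lemma nn_integral_exceed_blocks_le:
  assumes "tail \<mu> \<rho> \<le> 1 / 3" "0 \<le> \<rho>"
  shows "(\<integral>\<^sup>+\<omega>. chain_sup (exceed (4 * \<rho> * real m powr (1 / \<alpha>))) (psum (path \<omega>)) {..L * m} \<partial>M) \<le> 2 * of_nat L"
proof -
  let ?e = "exceed (4 * \<rho> * real m powr (1 / \<alpha>))"
  have block: "(\<integral>\<^sup>+\<omega>. chain_sup ?e (psum (path \<omega>)) {j * m..Suc j * m} \<partial>M) \<le> 1" for j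
  proof -
    have "(\<integral>\<^sup>+\<omega>. chain_sup ?e (psum (path \<omega>)) {j * m..Suc j * m} \<partial>M)
      = (\<integral>\<^sup>+\<omega>. chain_sup ?e (psum (shift (j * m) (path \<omega>))) {..m} \<partial>M)"
      using chain_sup_psum_block[of ?e _ "j * m" m] chain_sup_psum_trunc by (simp add: add.commute)
    also have "\<dots> = (\<integral>\<^sup>+\<omega>. chain_sup ?e (psum (path \<omega>)) {..m} \<partial>M)"
      by (rule nn_integral_shift) measurable
    also have "\<dots> \<le> ennreal (3 * tail \<mu> \<rho>)"
      by (rule nn_integral_exceed_le_tail[OF assms])
    also have "\<dots> \<le> 1" using assms by (simp add: ennreal_le_1)
    finally show ?thesis .
  qed
  have [measurable]: "(\<lambda>\<omega>. chain_sup ?e (psum (path \<omega>)) {j * m..Suc j * m}) \<in> borel_measurable M" for j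
    by (rule borel_measurable_chain_sup) measurable
  have "(\<integral>\<^sup>+\<omega>. chain_sup ?e (psum (path \<omega>)) {..L * m} \<partial>M)
    \<le> (\<integral>\<^sup>+\<omega>. (\<Sum>j<L. chain_sup ?e (psum (path \<omega>)) {j * m..Suc j * m}) + of_nat L \<partial>M)"
    by (intro nn_integral_mono chain_sup_subadd_blocks exceed_le_1)
  also have "\<dots> = (\<Sum>j<L. \<integral>\<^sup>+\<omega>. chain_sup ?e (psum (path \<omega>)) {j * m..Suc j * m} \<partial>M) + of_nat L"
    by (simp add: nn_integral_add nn_integral_sum emeasure_space_1 del: mult_Suc)
  also have "\<dots> \<le> (\<Sum>j<L. 1) + of_nat L"
    by (intro add_mono sum_mono block order_refl)
  also have "\<dots> = 2 * of_nat L" by (simp add: mult_2)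
  finally show ?thesis .
qed

text \<open>The walk of \<open>2 ^ n\<close> steps is cut into \<open>2 ^ l\<close> blocks of
  \<open>2 ^ (n - l)\<close> steps.\<close>

lemma nn_integral_exceed_level_le:
  assumes "tail \<mu> \<rho> \<le> 1 / 3" "0 \<le> \<rho>"
  shows "(\<integral>\<^sup>+\<omega>. chain_sup (exceed (4 * \<rho> * 2 powr ((real n - real l) / \<alpha>))) (psum (path \<omega>)) {..2 ^ n} \<partial>M) \<le> 2 * 2 ^ l"
proof (cases "l \<le> n")
  case True
  then have "real (2 ^ (n - l)) powr (1 / \<alpha>) = 2 powr ((real n - real l) / \<alpha>)"
    by (simp add: powr_realpow[symmetric] powr_powr of_nat_diff)
  moreover have "2 ^ l * 2 ^ (n - l) = (2 ^ n :: nat)"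
    using True by (simp add: power_add[symmetric])
  ultimately show ?thesis
    using nn_integral_exceed_blocks_le[OF assms, of "2 ^ (n - l)" "2 ^ l"] by simp
next
  \<comment> \<open>Blocks would be shorter than one step here, but even the number of all grid
    points, \<open>2 ^ n + 1\<close>, is within the bound.\<close>
  case False
  have "(\<integral>\<^sup>+\<omega>. chain_sup (exceed (4 * \<rho> * 2 powr ((real n - real l) / \<alpha>))) (psum (path \<omega>)) {..2 ^ n} \<partial>M)
    \<le> (\<integral>\<^sup>+\<omega>. of_nat (card {..2 ^ n :: nat}) \<partial>M)"
    by (intro nn_integral_mono chain_sup_le_card exceed_le_1) auto
  also have "\<dots> = of_nat (2 ^ n + 1)" by (simp add: emeasure_space_1)
  also have "\<dots> \<le> of_nat (2 * 2 ^ l)"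
  proof (rule of_nat_mono)
    have "(2::nat) ^ n \<le> 2 ^ l" using False by (intro power_increasing) auto
    moreover have "(1::nat) \<le> 2 ^ l" by simp
    ultimately show "2 ^ n + 1 \<le> (2::nat) * 2 ^ l" by linarith
  qed
  finally show ?thesis by simp
qed

end

section \<open>Layers of increment sizes\<close>

definition low_coeff :: "real \<Rightarrow> real \<Rightarrow> real \<Rightarrow> nat \<Rightarrow> ennreal" where
  "low_coeff \<alpha> p R l = ennreal ((R * 2 powr (- real l / \<alpha>)) powr p)"

definition high_coeff :: "real \<Rightarrow> real \<Rightarrow> real \<Rightarrow> nat \<Rightarrow> ennreal" where
  "high_coeff \<alpha> p R l = ennreal ((R * 2 powr (real (Suc l) / \<alpha>)) powr p)"

text \<open>\<open>R\<close> times the integer powers of \<open>2 powr (1 / \<alpha>)\<close> cut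
  the positive sizes into layers. The size of a nonzero \<open>x\<close> exceeds the lower end of
  its layer and is at most the upper end, whose p-th power is the coefficient. With this ratio, one
  layer down doubles the bound on the expected number of increments.\<close>

lemma pow_weight_le_layers:
  assumes "0 < p" "0 < \<alpha>" "0 < R"
  shows "pow_weight p x
    \<le> (\<Sum>l. low_coeff \<alpha> p R l * exceed (R * 2 powr (- real (Suc l) / \<alpha>)) x)
      + (\<Sum>l. high_coeff \<alpha> p R l * exceed (R * 2 powr (real l / \<alpha>)) x)"
proof -
  have ge: "f l \<le> (\<Sum>l. f l)" for f :: "nat \<Rightarrow> ennreal" and l
    using sum_le_suminf[of f "{l}"] by simp
  define q :: real where "q = 2 powr (1 / \<alpha>)"
  have q: "q > 1" using assms by (simp add: q_def)
  have qp: "2 powr (real l / \<alpha>) = q ^ l" "2 powr (- real l / \<alpha>) = 1 / q ^ l" for l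
    using q by (simp_all add: q_def powr_realpow[symmetric] powr_powr powr_minus_divide)
  consider "x = 0" | "\<bar>x\<bar> > R" | "x \<noteq> 0" "\<bar>x\<bar> \<le> R" by linarith
  then show ?thesis
  proof cases
    case 1 then show ?thesis using assms by (simp add: pow_weight_def)
  next
    case 2
    obtain n where n: "\<bar>x\<bar> / R < q ^ n" using real_arch_pow[OF q] by blast
    \<comment> \<open>The least power reaching |x| is not the zeroth, so its predecessor is the
      index of the layer; below \<open>R\<close> the argument is the same.\<close>
    define l where "l = (LEAST l. \<bar>x\<bar> \<le> R * q ^ l)"
    have "\<bar>x\<bar> \<le> R * q ^ n" using n assms by (simp add: field_simps)
    then have l: "\<bar>x\<bar> \<le> R * q ^ l" unfolding l_def by (rule LeastI)
    have "l \<noteq> 0" using l 2 by (cases l) auto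
    then obtain k where k: "l = Suc k" using not0_implies_Suc by blast
    have "\<not> \<bar>x\<bar> \<le> R * q ^ k" using not_less_Least[of k "\<lambda>l. \<bar>x\<bar> \<le> R * q ^ l"] k by (simp add: l_def)
    then have "pow_weight p x \<le> high_coeff \<alpha> p R k * exceed (R * 2 powr (real k / \<alpha>)) x"
      using l k assms unfolding pow_weight_def high_coeff_def qp exceed_def
      by (auto intro!: ennreal_leI powr_mono2)
    also have "\<dots> \<le> (\<Sum>l. high_coeff \<alpha> p R l * exceed (R * 2 powr (real l / \<alpha>)) x)"
      by (rule ge)
    finally show ?thesis by (simp add: add_increasing)
  next
    case 3
    obtain n where n: "R / \<bar>x\<bar> < q ^ n" using real_arch_pow[OF q] by blast
    define l where "l = (LEAST l. \<bar>x\<bar> > R * (1 / q ^ l))"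
    have "\<bar>x\<bar> > R * (1 / q ^ n)" using n 3 q by (simp add: field_simps)
    then have l: "\<bar>x\<bar> > R * (1 / q ^ l)" unfolding l_def by (rule LeastI)
    have "l \<noteq> 0" using l 3 by (cases l) auto
    then obtain k where k: "l = Suc k" using not0_implies_Suc by blast
    have "\<not> \<bar>x\<bar> > R * (1 / q ^ k)" using not_less_Least[of k "\<lambda>l. \<bar>x\<bar> > R * (1 / q ^ l)"] k by (simp add: l_def)
    then have "pow_weight p x \<le> low_coeff \<alpha> p R k * exceed (R * 2 powr (- real (Suc k) / \<alpha>)) x"
      using l k assms unfolding pow_weight_def low_coeff_def qp exceed_def
      by (auto intro!: ennreal_leI powr_mono2)
    also have "\<dots> \<le> (\<Sum>l. low_coeff \<alpha> p R l * exceed (R * 2 powr (- real (Suc l) / \<alpha>)) x)"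
      by (rule ge)
    finally show ?thesis by (simp add: add_increasing2)
  qed
qed

text \<open>With this factor the functional is the variation of \<open>Z\<close> along the grid of
  level \<open>n\<close> when \<open>x\<close> is the path of rescaled increments (see
  \<open>dvar_eq\<close>), while the law of \<open>x\<close> is the same for all levels.\<close>

definition grid_var :: "real \<Rightarrow> real \<Rightarrow> nat \<Rightarrow> (nat \<Rightarrow> real) \<Rightarrow> ennreal" where
  "grid_var \<alpha> p n x = chain_sup (pow_weight p) (\<lambda>i. 2 powr (- real n / \<alpha>) * psum x i) {..2 ^ n}"

lemma measurable_grid_var [measurable]: "grid_var \<alpha> p n \<in> borel_measurable seq_borel"
  unfolding grid_var_def chain_sup_rescale by measurable

text \<open>The lower end of layer \<open>l\<close> sits at level \<open>Suc l\<close>, where the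
  expected count is at most \<open>2 * 2 ^ Suc l\<close>. The mesh does not enter.\<close>

definition low_bound :: "real \<Rightarrow> real \<Rightarrow> real \<Rightarrow> ennreal" where
  "low_bound \<alpha> p R = (\<Sum>l. low_coeff \<alpha> p R l * (2 * 2 ^ Suc l))"

text \<open>Coefficients decay like \<open>2 powr (- l * p / \<alpha>)\<close> against counts
  growing like \<open>2 ^ l\<close>: a geometric series with ratio
  \<open>2 powr (1 - p / \<alpha>)\<close>, less than 1 since \<alpha> < p.\<close>

lemma low_bound_finite:
  assumes "0 < \<alpha>" "\<alpha> < p" "0 < R"
  shows "low_bound \<alpha> p R < top"
proof -
  have "2 powr (1 - p / \<alpha>) < 2 powr 0" using assms by (intro powr_less_mono) (auto simp: field_simps)
  then have s: "summable (\<lambda>l. 4 * R powr p * (2 powr (1 - p / \<alpha>)) ^ l)"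
    by (intro summable_mult summable_geometric) simp
  have "low_coeff \<alpha> p R l * (2 * 2 ^ Suc l) = ennreal (4 * R powr p * (2 powr (1 - p / \<alpha>)) ^ l)" for l
  proof -
    have "low_coeff \<alpha> p R l * (2 * 2 ^ Suc l) = ennreal ((R * 2 powr (- real l / \<alpha>)) powr p * (4 * 2 ^ l))"
      by (simp add: low_coeff_def ennreal_mult ennreal_power[symmetric] mult_ac)
    also have "(R * 2 powr (- real l / \<alpha>)) powr p * (4 * 2 ^ l) = 4 * R powr p * (2 powr (- real l / \<alpha> * p) * 2 powr real l)"
      using assms by (simp add: powr_mult powr_powr powr_realpow)
    also have "2 powr (- real l / \<alpha> * p) * 2 powr real l = (2 powr (1 - p / \<alpha>)) ^ l"
      by (simp add: powr_add[symmetric] powr_realpow[symmetric] powr_powr field_simps)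
    finally show ?thesis .
  qed
  then have "low_bound \<alpha> p R = (\<Sum>l. ennreal (4 * R powr p * (2 powr (1 - p / \<alpha>)) ^ l))"
    by (simp add: low_bound_def)
  also have "\<dots> \<noteq> top" using s by (rule ennreal_suminf_neq_top) auto
  finally show ?thesis by (simp add: top.not_eq_extremum)
qed

context stable_walk
begin

context
  fixes p \<rho> :: real and n :: nat
  assumes p: "0 < p" and \<rho>: "0 < \<rho>" "tail \<mu> \<rho> \<le> 1 / 3"
begin

text \<open>The thresholds are those of the layers multiplied by
  \<open>2 powr (n / \<alpha>)\<close>, as increments of the unnormalised walk are counted. The
  layers are split at 4 \<rho>, the level of the counting bounds.\<close>

definition low_part :: "'a \<Rightarrow> ennreal" where
  "low_part \<omega> = (\<Sum>l. low_coeff \<alpha> p (4 * \<rho>) l *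
     chain_sup (exceed (4 * \<rho> * 2 powr ((real n - real (Suc l)) / \<alpha>))) (psum (path \<omega>)) {..2 ^ n})"

definition high_part :: "'a \<Rightarrow> ennreal" where
  "high_part \<omega> = (\<Sum>l. high_coeff \<alpha> p (4 * \<rho>) l *
     chain_sup (exceed (4 * \<rho> * 2 powr ((real n + real l) / \<alpha>))) (psum (path \<omega>)) {..2 ^ n})"

lemma measurable_parts [measurable]: "low_part \<in> borel_measurable M" "high_part \<in> borel_measurable M"
  unfolding low_part_def high_part_def by measurable

lemma grid_var_le_parts: "grid_var \<alpha> p n (path \<omega>) \<le> low_part \<omega> + high_part \<omega>"
proof -
  let ?c = "2 powr (- real n / \<alpha>)" and ?R = "4 * \<rho>"
  have e: "exceed (?R * 2 powr (s / \<alpha>)) (?c * x) = exceed (?R * 2 powr ((real n + s) / \<alpha>)) x" for s x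
  proof -
    have "?R * 2 powr (s / \<alpha>) / ?c = ?R * 2 powr ((real n + s) / \<alpha>)"
      by (simp add: powr_minus_divide add_divide_distrib powr_add mult_ac)
    then show ?thesis by (simp add: exceed_mult del: minus_divide_left times_divide_eq_right times_divide_eq_left)
  qed
  have "grid_var \<alpha> p n (path \<omega>) = chain_sup (\<lambda>x. pow_weight p (?c * x)) (psum (path \<omega>)) {..2 ^ n}"
    by (simp add: grid_var_def chain_sup_rescale)
  also have "\<dots> \<le> chain_sup (\<lambda>x. (\<Sum>l. low_coeff \<alpha> p ?R l * exceed (?R * 2 powr ((real n - real (Suc l)) / \<alpha>)) x)
      + (\<Sum>l. high_coeff \<alpha> p ?R l * exceed (?R * 2 powr ((real n + real l) / \<alpha>)) x)) (psum (path \<omega>)) {..2 ^ n}"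
  proof (rule chain_sup_mono_weight)
    fix x show "pow_weight p (?c * x) \<le> (\<Sum>l. low_coeff \<alpha> p ?R l * exceed (?R * 2 powr ((real n - real (Suc l)) / \<alpha>)) x)
      + (\<Sum>l. high_coeff \<alpha> p ?R l * exceed (?R * 2 powr ((real n + real l) / \<alpha>)) x)"
      using pow_weight_le_layers[OF p \<alpha>_pos, of ?R "?c * x"] \<rho>(1)
      unfolding e by (simp only: diff_conv_add_uminus)
  qed
  also have "\<dots> \<le> low_part \<omega> + high_part \<omega>"
    unfolding low_part_def high_part_def
    by (intro order_trans[OF chain_sup_add_weight] add_mono chain_sup_suminf_weight)
  finally show ?thesis .
qed

lemma nn_integral_low_part: "(\<integral>\<^sup>+\<omega>. low_part \<omega> \<partial>M) \<le> low_bound \<alpha> p (4 * \<rho>)"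
proof -
  have "(\<integral>\<^sup>+\<omega>. low_part \<omega> \<partial>M) = (\<Sum>l. low_coeff \<alpha> p (4 * \<rho>) l *
     (\<integral>\<^sup>+\<omega>. chain_sup (exceed (4 * \<rho> * 2 powr ((real n - real (Suc l)) / \<alpha>))) (psum (path \<omega>)) {..2 ^ n} \<partial>M))"
    unfolding low_part_def by (subst nn_integral_suminf, measurable) (subst nn_integral_cmult, measurable)
  also have "\<dots> \<le> low_bound \<alpha> p (4 * \<rho>)"
    unfolding low_bound_def using \<rho>
    by (intro suminf_le mult_left_mono nn_integral_exceed_level_le) auto
  finally show ?thesis .
qed

lemma nn_integral_high_part:
  assumes le: "\<And>l. tail \<mu> (\<rho> * 2 powr (real l / \<alpha>)) \<le> 1 / 3"
  shows "(\<integral>\<^sup>+\<omega>. high_part \<omega> \<partial>M) \<le> (\<Sum>l. high_coeff \<alpha> p (4 * \<rho>) l * ennreal (3 * tail \<mu> (\<rho> * 2 powr (real l / \<alpha>))))"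
proof -
  have *: "(\<integral>\<^sup>+\<omega>. chain_sup (exceed (4 * \<rho> * 2 powr ((real n + real l) / \<alpha>))) (psum (path \<omega>)) {..2 ^ n} \<partial>M)
     \<le> ennreal (3 * tail \<mu> (\<rho> * 2 powr (real l / \<alpha>)))" for l
  proof -
    have "real (2 ^ n) powr (1 / \<alpha>) = 2 powr (real n / \<alpha>)"
      by (simp add: powr_realpow[symmetric] powr_powr)
    then show ?thesis
      using nn_integral_exceed_le_tail[OF le, of l "2 ^ n"] \<rho>
      by (simp add: add_divide_distrib powr_add mult_ac)
  qed
  have "(\<integral>\<^sup>+\<omega>. high_part \<omega> \<partial>M) = (\<Sum>l. high_coeff \<alpha> p (4 * \<rho>) l *
     (\<integral>\<^sup>+\<omega>. chain_sup (exceed (4 * \<rho> * 2 powr ((real n + real l) / \<alpha>))) (psum (path \<omega>)) {..2 ^ n} \<partial>M))"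
    unfolding high_part_def by (subst nn_integral_suminf, measurable) (subst nn_integral_cmult, measurable)
  also have "\<dots> \<le> (\<Sum>l. high_coeff \<alpha> p (4 * \<rho>) l * ennreal (3 * tail \<mu> (\<rho> * 2 powr (real l / \<alpha>))))"
    by (intro suminf_le mult_left_mono *) auto
  finally show ?thesis .
qed

text \<open>A counted increment exceeds \<open>4 * \<rho> * 2 powr (n / \<alpha>)\<close>, so one of
  its end points exceeds half of that. The high part may have infinite mean, yet the probability
  that it does not vanish is controlled by the maximal inequality.\<close>

lemma high_part_nonzero: "high_part \<omega> \<noteq> 0 \<Longrightarrow> \<exists>k\<le>2 ^ n. \<bar>psum (path \<omega>) k\<bar> > 2 * (\<rho> * real (2 ^ n) powr (1 / \<alpha>))"
proof (rule ccontr)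
  let ?d = "2 * (\<rho> * real (2 ^ n) powr (1 / \<alpha>))"
  assume nz: "high_part \<omega> \<noteq> 0" and "\<not> (\<exists>k\<le>2 ^ n. \<bar>psum (path \<omega>) k\<bar> > ?d)"
  then have small: "\<bar>psum (path \<omega>) k\<bar> \<le> ?d" if "k \<le> 2 ^ n" for k using that by force
  have d: "?d = 2 * \<rho> * 2 powr (real n / \<alpha>)"
    by (simp add: powr_realpow[symmetric] powr_powr)
  have "chain_sum (exceed (4 * \<rho> * 2 powr ((real n + real l) / \<alpha>))) (psum (path \<omega>)) xs \<le> 0"
    if "xs \<in> chain_lists {..2 ^ n}" for xs l
    using that
  proof (induction xs rule: induct_list012)
    case (3 x y zs)
    have "4 * \<rho> * 2 powr ((real n + real l) / \<alpha>) \<ge> 4 * \<rho> * 2 powr (real n / \<alpha>)"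
      using \<rho> \<alpha>_pos by (intro mult_left_mono powr_mono) (auto intro!: divide_right_mono)
    moreover have "\<bar>psum (path \<omega>) x\<bar> \<le> ?d" "\<bar>psum (path \<omega>) y\<bar> \<le> ?d"
      using 3(3) by (intro small; simp add: chain_lists_def)+
    ultimately have "\<bar>psum (path \<omega>) y - psum (path \<omega>) x\<bar> \<le> 4 * \<rho> * 2 powr ((real n + real l) / \<alpha>)"
      unfolding d by linarith
    then show ?case using 3 by (auto simp: chain_lists_def exceed_def)
  qed auto
  then have "chain_sup (exceed (4 * \<rho> * 2 powr ((real n + real l) / \<alpha>))) (psum (path \<omega>)) {..2 ^ n} \<le> 0" for l
    by (rule chain_sup_least)
  then show False using nz by (simp add: high_part_def)
qed

text \<open>For tails that decay fast enough to make the series converge, as they do for \<alpha> =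
  2.\<close>

lemma nn_integral_grid_var_le:
  assumes le: "\<And>l. tail \<mu> (\<rho> * 2 powr (real l / \<alpha>)) \<le> 1 / 3"
  shows "(\<integral>\<^sup>+\<omega>. grid_var \<alpha> p n (path \<omega>) \<partial>M)
    \<le> low_bound \<alpha> p (4 * \<rho>) + (\<Sum>l. high_coeff \<alpha> p (4 * \<rho>) l * ennreal (3 * tail \<mu> (\<rho> * 2 powr (real l / \<alpha>))))"
proof -
  have "(\<integral>\<^sup>+\<omega>. grid_var \<alpha> p n (path \<omega>) \<partial>M) \<le> (\<integral>\<^sup>+\<omega>. low_part \<omega> + high_part \<omega> \<partial>M)"
    by (intro nn_integral_mono grid_var_le_parts)
  also have "\<dots> = (\<integral>\<^sup>+\<omega>. low_part \<omega> \<partial>M) + (\<integral>\<^sup>+\<omega>. high_part \<omega> \<partial>M)"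
    by (rule nn_integral_add) measurable
  also have "\<dots> \<le> low_bound \<alpha> p (4 * \<rho>) + (\<Sum>l. high_coeff \<alpha> p (4 * \<rho>) l * ennreal (3 * tail \<mu> (\<rho> * 2 powr (real l / \<alpha>))))"
    by (intro add_mono nn_integral_low_part nn_integral_high_part le)
  finally show ?thesis .
qed

text \<open>Outside the event of a large maximum the high part vanishes, so the low part alone
  exceeds \<open>K\<close>, and Markov's inequality applies to it. The bound is free of
  \<open>n\<close>.\<close>

lemma emeasure_grid_var_gt:
  assumes "0 < K"
  shows "emeasure M {\<omega>\<in>space M. grid_var \<alpha> p n (path \<omega>) > ennreal K}
    \<le> ennreal (3 / 2 * tail \<mu> \<rho>) + low_bound \<alpha> p (4 * \<rho>) / ennreal K"
proof -
  let ?B = "{\<omega>\<in>space M. \<exists>k\<le>2 ^ n. \<bar>psum (path \<omega>) k\<bar> > 2 * (\<rho> * real (2 ^ n) powr (1 / \<alpha>))}"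
  let ?A = "{\<omega>\<in>space M. ennreal K \<le> low_part \<omega>}"
  have "emeasure M {\<omega>\<in>space M. grid_var \<alpha> p n (path \<omega>) > ennreal K} \<le> emeasure M (?B \<union> ?A)"
  proof (rule emeasure_mono)
    show "{\<omega>\<in>space M. grid_var \<alpha> p n (path \<omega>) > ennreal K} \<subseteq> ?B \<union> ?A"
    proof
      fix \<omega> assume \<omega>: "\<omega> \<in> {\<omega>\<in>space M. grid_var \<alpha> p n (path \<omega>) > ennreal K}"
      show "\<omega> \<in> ?B \<union> ?A"
      proof (cases "high_part \<omega> = 0")
        case True
        then show ?thesis using \<omega> grid_var_le_parts[of \<omega>] by auto
      next
        case False
        then show ?thesis using \<omega> high_part_nonzero by auto
      qed
    qed
  qed measurable
  also have "\<dots> \<le> emeasure M ?B + emeasure M ?A"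
    by (rule emeasure_subadditive) measurable
  also have "emeasure M ?B \<le> ennreal (3 / 2 * tail \<mu> \<rho>)"
    unfolding emeasure_eq_measure using prob_max_psum_le_tail[of \<rho> "2 ^ n"] \<rho> by (intro ennreal_leI) auto
  also have "emeasure M ?A \<le> low_bound \<alpha> p (4 * \<rho>) / ennreal K"
  proof -
    have "emeasure M ?A = emeasure M {\<omega>\<in>space M. 1 \<le> (1 / ennreal K) * low_part \<omega>}"
    proof -
      have k: "1 / ennreal K = ennreal (1 / K)" using assms divide_ennreal[of 1 K] by simp
      have "ennreal K \<le> y \<longleftrightarrow> 1 \<le> (1 / ennreal K) * y" for y
        using assms unfolding k
        by (cases y) (simp_all add: ennreal_mult_top ennreal_mult[symmetric] ennreal_ge_1 field_simps)
      then show ?thesis by simp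
    qed
    also have "\<dots> \<le> (1 / ennreal K) * (\<integral>\<^sup>+\<omega>. low_part \<omega> * indicator (space M) \<omega> \<partial>M)"
      by (rule nn_integral_Markov_inequality) measurable
    also have "(\<integral>\<^sup>+\<omega>. low_part \<omega> * indicator (space M) \<omega> \<partial>M) = (\<integral>\<^sup>+\<omega>. low_part \<omega> \<partial>M)"
      by (intro nn_integral_cong) simp
    also have "(1 / ennreal K) * (\<integral>\<^sup>+\<omega>. low_part \<omega> \<partial>M) \<le> (1 / ennreal K) * low_bound \<alpha> p (4 * \<rho>)"
      by (intro mult_left_mono nn_integral_low_part) auto
    finally show ?thesis by (simp add: ennreal_divide_times)
  qed
  finally show ?thesis by (simp add: add_mono)
qed

end

end

section \<open>The variation along dyadic grids\<close>

text \<open>Independence concerns finite subfamilies, and each of these lies in an initial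
  segment.\<close>

lemma (in prob_space) indep_vars_UNIV_nat:
  fixes X :: "nat \<Rightarrow> 'a \<Rightarrow> 'b"
  assumes "\<And>n. indep_vars M' X {..<n}"
  shows "indep_vars M' X UNIV"
  unfolding indep_vars_def
proof (intro conjI ballI)
  fix i show "random_variable (M' i) (X i)"
    using assms[of "Suc i"] by (auto simp: indep_vars_def)
next
  let ?F = "\<lambda>i. sigma_sets (space M) {X i -` A \<inter> space M |A. A \<in> sets (M' i)}"
  show "indep_sets ?F UNIV"
    unfolding indep_sets_finite_index_sets[of _ UNIV]
  proof (intro allI impI)
    fix J :: "nat set" assume "finite J"
    then obtain n where "J \<subseteq> {..<n}" using finite_nat_iff_bounded by blast
    moreover have "indep_sets ?F {..<n}" using assms[of n] unfolding indep_vars_def by blast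
    ultimately show "indep_sets ?F J" by (rule indep_sets_mono_index)
  qed
qed

lemma tail_antimono:
  assumes "prob_space \<mu>" "sets \<mu> = sets borel" "r \<le> s"
  shows "tail \<mu> s \<le> tail \<mu> r"
proof -
  interpret prob_space \<mu> by fact
  show ?thesis unfolding tail_def using assms(2,3) by (intro finite_measure_mono) (auto simp: sets_eq_imp_space_eq)
qed

lemma tail_tendsto_0:
  assumes "prob_space \<mu>" "sets \<mu> = sets borel"
  shows "(\<lambda>n. tail \<mu> (real n)) \<longlonglongrightarrow> 0"
proof -
  interpret prob_space \<mu> by fact
  have "(\<lambda>n. measure \<mu> {x::real. \<bar>x\<bar> > real n}) \<longlonglongrightarrow> measure \<mu> (\<Inter>n. {x. \<bar>x\<bar> > real n})"
    by (rule finite_Lim_measure_decseq) (auto simp: assms(2) decseq_def)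
  also have "(\<Inter>n. {x::real. \<bar>x\<bar> > real n}) = {}"
  proof -
    have "\<exists>n. \<not> \<bar>x\<bar> > real n" for x
      using real_arch_simple[of "\<bar>x\<bar>"] by (auto simp: not_less)
    then show ?thesis by auto
  qed
  finally show ?thesis by (simp add: tail_def)
qed

lemma ex_tail_less:
  assumes "prob_space \<mu>" "sets \<mu> = sets borel" "\<epsilon> > 0"
  shows "\<exists>\<rho>>0. tail \<mu> \<rho> < \<epsilon>"
proof -
  have "eventually (\<lambda>n. tail \<mu> (real n) < \<epsilon>) sequentially"
    using order_tendstoD(2)[OF tail_tendsto_0[OF assms(1,2)] assms(3)] .
  then obtain n where "tail \<mu> (real n) < \<epsilon>" by (auto simp: eventually_sequentially)
  \<comment> \<open>The successor makes the radius positive.\<close>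
  then have "tail \<mu> (real (Suc n)) < \<epsilon>" using tail_antimono[OF assms(1,2), of "real n" "real (Suc n)"] by simp
  then show ?thesis by (intro exI[of _ "real (Suc n)"]) simp
qed

lemma distr_scale:
  fixes X :: "'a \<Rightarrow> real" and c :: real
  assumes [measurable]: "X \<in> borel_measurable M"
  shows "distr M borel (\<lambda>\<omega>. c * X \<omega>) = distr (distr M borel X) borel (\<lambda>x. c * x)"
  by (subst distr_distr) (auto simp: comp_def)

context strictly_stable_process
begin

declare random_variable_Z [measurable]

definition \<mu> :: "real measure" where
  "\<mu> = distr M borel (Z 1)"

lemma prob_space_\<mu>: "prob_space \<mu>" and sets_\<mu>: "sets \<mu> = sets borel"
  unfolding \<mu>_def by (auto intro!: prob_space_distr)

lemma law_Z:
  assumes k: "0 < k"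
  shows "distr M borel (Z k) = distr M borel (\<lambda>\<omega>. k powr (1 / \<alpha>) * Z 1 \<omega>)"
proof -
  let ?P = "Pi\<^sub>M {0..} (\<lambda>_. borel) :: (real \<Rightarrow> real) measure"
  have m1: "(\<lambda>\<omega>. \<lambda>t\<in>{0..}. Z (k * t) \<omega>) \<in> measurable M ?P"
    using k by (intro measurable_restrict) auto
  have m2: "(\<lambda>\<omega>. \<lambda>t\<in>{0..}. k powr (1 / \<alpha>) * Z t \<omega>) \<in> measurable M ?P"
    by (intro measurable_restrict) auto
  have m: "(\<lambda>f. f 1) \<in> measurable ?P (borel :: real measure)"
    by (rule measurable_component_singleton) simp
  show ?thesis
    using arg_cong[where f="\<lambda>N. distr N borel (\<lambda>f. f 1)", OF self_similar[OF k]]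
    by (simp add: distr_distr[OF m m1] distr_distr[OF m m2] comp_def)
qed

text \<open>Rescaling by \<open>2 powr (n / \<alpha>)\<close> gives each increment over a mesh
  interval the law of \<open>Z 1\<close>, whatever \<open>n\<close>; every bound for
  \<open>stable_walk\<close> is thus uniform in the mesh.\<close>

definition step :: "nat \<Rightarrow> nat \<Rightarrow> 'a \<Rightarrow> real" where
  "step n i \<omega> = 2 powr (real n / \<alpha>) * (Z (real (Suc i) / 2 ^ n) \<omega> - Z (real i / 2 ^ n) \<omega>)"

lemma psum_step: "psum (\<lambda>i. step n i \<omega>) k = 2 powr (real n / \<alpha>) * (Z (real k / 2 ^ n) \<omega> - Z 0 \<omega>)"
proof (induction k)
  case (Suc k)
  have "psum (\<lambda>i. step n i \<omega>) (Suc k) = psum (\<lambda>i. step n i \<omega>) k + step n k \<omega>"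
    by (simp add: psum_def)
  also have "\<dots> = 2 powr (real n / \<alpha>) * (Z (real (Suc k) / 2 ^ n) \<omega> - Z 0 \<omega>)"
    unfolding Suc by (simp only: step_def distrib_left[symmetric]) simp
  finally show ?case .
qed simp

lemma law_increment:
  assumes "0 \<le> s" "s < t"
  shows "distr M borel (\<lambda>\<omega>. Z t \<omega> - Z s \<omega>) = distr \<mu> borel (\<lambda>x. (t - s) powr (1 / \<alpha>) * x)"
proof -
  have "distr M borel (\<lambda>\<omega>. Z t \<omega> - Z s \<omega>) = distr M borel (\<lambda>\<omega>. (t - s) powr (1 / \<alpha>) * Z 1 \<omega>)"
    using stationary_increments[OF assms] law_Z[of "t - s"] assms by simp
  also have "\<dots> = distr \<mu> borel (\<lambda>x. (t - s) powr (1 / \<alpha>) * x)"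
    unfolding \<mu>_def by (rule distr_scale) measurable
  finally show ?thesis .
qed

lemma dyadic_scale: "2 powr (real n / \<alpha>) * (real k / 2 ^ n) powr (1 / \<alpha>) = real k powr (1 / \<alpha>)"
  by (simp add: powr_divide powr_realpow[symmetric] powr_powr)

lemma stable_walk_step: "stable_walk M (step n) \<mu> \<alpha>"
proof -
  have law: "distr M borel (step n i) = \<mu>" for i
  proof -
    have "distr M borel (step n i) = distr (distr M borel (\<lambda>\<omega>. Z (real (Suc i) / 2 ^ n) \<omega> - Z (real i / 2 ^ n) \<omega>)) borel (\<lambda>x. 2 powr (real n / \<alpha>) * x)"
      unfolding step_def by (rule distr_scale) measurable
    also have "\<dots> = distr \<mu> borel (\<lambda>x. 2 powr (real n / \<alpha>) * ((real 1 / 2 ^ n) powr (1 / \<alpha>) * x))"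
      by (subst law_increment) (auto simp: sets_\<mu> distr_distr comp_def divide_strict_right_mono diff_divide_distrib[symmetric] cong: measurable_cong_sets)
    also have "\<dots> = distr \<mu> borel (\<lambda>x. x)"
      using dyadic_scale[of n 1] by (simp add: mult.assoc[symmetric])
    also have "\<dots> = \<mu>" by (rule distr_id2) (simp add: sets_\<mu>)
    finally show ?thesis .
  qed
  interpret iid_seq M "step n" \<mu>
  proof
    show "indep_vars (\<lambda>_. borel) (step n) UNIV"
    proof (rule indep_vars_UNIV_nat)
      fix N
      have "indep_vars (\<lambda>_. borel) (\<lambda>j \<omega>. Z (real (Suc j) / 2 ^ n) \<omega> - Z (real j / 2 ^ n) \<omega>) {..<N}"
        by (rule indep_increments) (auto simp: strict_mono_on_def divide_strict_right_mono)
      then show "indep_vars (\<lambda>_. borel) (step n) {..<N}"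
        unfolding step_def by (rule indep_vars_compose2) measurable
    qed
  qed (rule law)
  show ?thesis
  proof
    show "0 < \<alpha>" by (rule index_pos)
    fix k :: nat assume k: "1 \<le> k"
    have "distr M borel (\<lambda>\<omega>. psum (path \<omega>) k) = distr M borel (\<lambda>\<omega>. 2 powr (real n / \<alpha>) * (Z (real k / 2 ^ n) \<omega> - Z 0 \<omega>))"
      by (simp add: path_def psum_step)
    also have "\<dots> = distr (distr M borel (\<lambda>\<omega>. Z (real k / 2 ^ n) \<omega> - Z 0 \<omega>)) borel (\<lambda>x. 2 powr (real n / \<alpha>) * x)"
      by (rule distr_scale) measurable
    also have "\<dots> = distr \<mu> borel (\<lambda>x. 2 powr (real n / \<alpha>) * ((real k / 2 ^ n) powr (1 / \<alpha>) * x))"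
      using k by (subst law_increment) (auto simp: sets_\<mu> distr_distr comp_def cong: measurable_cong_sets)
    also have "\<dots> = distr \<mu> borel (\<lambda>x. real k powr (1 / \<alpha>) * x)"
      by (simp only: mult.assoc[symmetric] dyadic_scale)
    also have "\<dots> = distr M borel (\<lambda>\<omega>. real k powr (1 / \<alpha>) * step n 0 \<omega>)"
      by (subst distr_scale) (auto simp: law)
    finally show "distr M borel (\<lambda>\<omega>. psum (path \<omega>) k) = distr M borel (\<lambda>\<omega>. real k powr (1 / \<alpha>) * step n 0 \<omega>)" .
  qed
qed

sublocale walk: stable_walk M "step n" \<mu> \<alpha> for n
  by (rule stable_walk_step)

lemma psum_walk: "psum (walk.path n \<omega>) k = 2 powr (real n / \<alpha>) * (Z (real k / 2 ^ n) \<omega> - Z 0 \<omega>)"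
  by (simp add: walk.path_def psum_step)

definition dvar :: "real \<Rightarrow> nat \<Rightarrow> 'a \<Rightarrow> ennreal" where
  "dvar p n \<omega> = grid_var \<alpha> p n (walk.path n \<omega>)"

lemma measurable_dvar [measurable]: "dvar p n \<in> borel_measurable M"
  unfolding dvar_def by measurable

lemma dvar_eq: "dvar p n \<omega> = chain_sup (pow_weight p) (\<lambda>t. Z t \<omega>) (dyadic_grid n)"
  unfolding dvar_def grid_var_def chain_sup_dyadic_grid
  by (rule chain_sup_cong_diff) (simp add: psum_walk powr_minus mult.assoc[symmetric])

lemma incseq_dvar: "incseq (\<lambda>n. dvar p n \<omega>)"
  unfolding dvar_eq using incseq_dyadic_grid by (auto simp: incseq_def intro!: chain_sup_mono)

text \<open>By \<open>variation_sup_eq_dyadic\<close> this is the p-th power of the strong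
  variation. Keeping it in \<open>ennreal\<close> allows measurability and limits before finiteness
  is known.\<close>

definition pvar :: "real \<Rightarrow> 'a \<Rightarrow> ennreal" where
  "pvar p \<omega> = (SUP n. dvar p n \<omega>)"

lemma measurable_pvar [measurable]: "pvar p \<in> borel_measurable M"
  unfolding pvar_def by measurable

lemma dvar_le_pvar: "dvar p n \<omega> \<le> pvar p \<omega>"
  unfolding pvar_def by (rule SUP_upper) simp

lemma variation_power_eq:
  assumes "\<omega> \<in> space M" "p > 0"
  shows "variation_power p Z \<omega> = enn2real (pvar p \<omega>)"
proof -
  have "variation_sup p (\<lambda>t. Z t \<omega>) = pvar p \<omega>"
    unfolding pvar_def dvar_eq
    using right_continuous_paths[OF assms(1)] assms(2) by (rule variation_sup_eq_dyadic)
  \<comment> \<open>Where the variation is infinite both sides are 0, by the value of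
    \<open>enn2real\<close> at infinity.\<close>
  then show ?thesis using assms(2)
    by (auto simp: variation_power_def strong_variation_def powr_powr enn2real_nonneg)
qed

lemma pvar_ge_increment: "ennreal (\<bar>Z 1 \<omega> - Z 0 \<omega>\<bar> powr p) \<le> pvar p \<omega>"
proof -
  have "pow_weight p (Z 1 \<omega> - Z 0 \<omega>) \<le> dvar p 0 \<omega>"
    unfolding dvar_eq by (rule chain_sup_pair) (auto simp: dyadic_grid_def atMost_Suc)
  then show ?thesis using dvar_le_pvar[of p 0 \<omega>] by (simp add: pow_weight_def)
qed

lemma emeasure_pvar_gt_le:
  assumes p: "\<alpha> < p" and \<rho>: "0 < \<rho>" "tail \<mu> \<rho> \<le> 1 / 3" and K: "0 < K"
  shows "emeasure M {\<omega>\<in>space M. pvar p \<omega> > ennreal K}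
    \<le> ennreal (3 / 2 * tail \<mu> \<rho>) + low_bound \<alpha> p (4 * \<rho>) / ennreal K"
proof -
  have "{\<omega>\<in>space M. pvar p \<omega> > ennreal K} = (\<Union>n. {\<omega>\<in>space M. dvar p n \<omega> > ennreal K})"
    unfolding pvar_def by (auto simp: less_SUP_iff)
  also have "emeasure M \<dots> = (SUP n. emeasure M {\<omega>\<in>space M. dvar p n \<omega> > ennreal K})"
    using incseq_dvar[of p] by (intro SUP_emeasure_incseq[symmetric])
      (auto simp: incseq_def intro: less_le_trans)
  also have "\<dots> \<le> ennreal (3 / 2 * tail \<mu> \<rho>) + low_bound \<alpha> p (4 * \<rho>) / ennreal K"
    unfolding dvar_def
    using p index_pos by (intro SUP_least walk.emeasure_grid_var_gt \<rho> K) auto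
  finally show ?thesis .
qed

text \<open>First \<rho> makes the probability of large increments small, then \<open>K\<close> is
  taken large against the finite \<open>low_bound\<close>; each accounts for half of
  \<open>e\<close>.\<close>

lemma AE_pvar_finite:
  assumes p: "\<alpha> < p"
  shows "AE \<omega> in M. pvar p \<omega> < top"
proof -
  have small: "emeasure M {\<omega>\<in>space M. pvar p \<omega> = top} \<le> ennreal e" if "e > 0" for e
  proof -
    have "0 < min (1 / 3) (e / 3)" using that by simp
    then obtain \<rho> where \<rho>: "0 < \<rho>" "tail \<mu> \<rho> < min (1 / 3) (e / 3)"
      using ex_tail_less[OF prob_space_\<mu> sets_\<mu>] by blast
    have "low_bound \<alpha> p (4 * \<rho>) < top"
      using \<rho> p index_pos by (intro low_bound_finite) auto
    then obtain c where c: "low_bound \<alpha> p (4 * \<rho>) = ennreal c" "0 \<le> c"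
      by (cases "low_bound \<alpha> p (4 * \<rho>)") auto
    \<comment> \<open>The added 1 keeps \<open>K\<close> positive when \<open>c\<close> is
      0.\<close>
    define K where "K = (c + 1) / (e / 2)"
    have K: "0 < K" using c that by (simp add: K_def)
    have "emeasure M {\<omega>\<in>space M. pvar p \<omega> = top} \<le> emeasure M {\<omega>\<in>space M. pvar p \<omega> > ennreal K}"
      by (rule emeasure_mono) auto
    also have "\<dots> \<le> ennreal (3 / 2 * tail \<mu> \<rho>) + ennreal c / ennreal K"
      using emeasure_pvar_gt_le[OF p \<rho>(1) _ K] \<rho> c by simp
    also have "\<dots> = ennreal (3 / 2 * tail \<mu> \<rho> + c / K)"
      using K c walk.tail_nonneg by (simp add: divide_ennreal)
    also have "\<dots> \<le> ennreal e"
    proof (rule ennreal_leI)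
      have "c / K \<le> e / 2" using c that by (simp add: K_def field_simps)
      moreover have "tail \<mu> \<rho> < e / 3" using \<rho>(2) by (simp only: min_less_iff_conj)
      ultimately show "3 / 2 * tail \<mu> \<rho> + c / K \<le> e" by linarith
    qed
    finally show ?thesis .
  qed
  have "emeasure M {\<omega>\<in>space M. pvar p \<omega> = top} \<le> 0"
    by (rule ennreal_le_epsilon) (use small in simp)
  then have "AE \<omega> in M. \<not> pvar p \<omega> = top"
    by (subst AE_iff_measurable[OF _ refl]) (auto simp: not_less)
  then show ?thesis by (auto simp: top.not_eq_extremum)
qed

text \<open>If \<open>Z 1\<close> is almost surely \<open>b\<close>, scaling gives
  \<open>Z t = t powr (1 / \<alpha>) * b\<close> and stationarity gives
  \<open>Z 2 - Z 1 = b\<close>. Hence \<open>2 powr (1 / \<alpha>) * b = 2 * b\<close>, so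
  \<open>b = 0\<close> or \<alpha> = 1, and in both cases the process is a pure drift.\<close>

lemma Z_1_not_constant: "\<not> (AE \<omega> in M. Z 1 \<omega> = b)"
proof
  assume b: "AE \<omega> in M. Z 1 \<omega> = b"
  have AE_law: "AE \<omega> in M. X \<omega> = c * b" if [measurable]: "X \<in> borel_measurable M"
    and "distr M borel X = distr M borel (\<lambda>\<omega>. c * Z 1 \<omega>)" for X :: "'a \<Rightarrow> real" and c
  proof -
    have "AE x in distr M borel (\<lambda>\<omega>. c * Z 1 \<omega>). x = c * b"
      using b by (subst AE_distr_iff) auto
    then have "AE x in distr M borel X. x = c * b" unfolding that(2) .
    then show ?thesis by (subst (asm) AE_distr_iff) auto
  qed
  have Zt: "AE \<omega> in M. Z t \<omega> = t powr (1 / \<alpha>) * b" if "0 < t" for t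
    using that by (intro AE_law law_Z) auto
  have "distr M borel (\<lambda>\<omega>. Z 2 \<omega> - Z 1 \<omega>) = distr M borel (\<lambda>\<omega>. 1 * Z 1 \<omega>)"
    using stationary_increments[of 1 2] by simp
  then have "AE \<omega> in M. Z 2 \<omega> - Z 1 \<omega> = 1 * b"
    by (intro AE_law) auto
  moreover have "AE \<omega> in M. Z 2 \<omega> = 2 powr (1 / \<alpha>) * b" using Zt[of 2] by simp
  ultimately have "AE \<omega> in M. 2 powr (1 / \<alpha>) * b = 2 * b"
    using b by eventually_elim simp
  then have "2 powr (1 / \<alpha>) * b = 2 * b" by simp
  then have "b = 0 \<or> \<alpha> = 1" using index_pos powr_inj[of 2 "1 / \<alpha>" 1] by auto
  then have lin: "AE \<omega> in M. Z t \<omega> = b * t" if "0 \<le> t" for t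
    using Zt[of t] that Z_zero by (cases "t = 0") (auto simp: mult.commute)
  \<comment> \<open>Countably many dyadic times share one null set; right continuity covers the
    other times.\<close>
  have "AE \<omega> in M. \<forall>n k. Z (real k / 2 ^ n) \<omega> = b * (real k / 2 ^ n)"
    unfolding AE_all_countable by (intro allI lin) simp
  then have "AE \<omega> in M. \<forall>t\<ge>0. Z t \<omega> = b * t"
  proof (rule AE_mp[OF _ AE_I2], intro impI allI)
    fix \<omega> and t :: real assume \<omega>: "\<omega> \<in> space M" and *: "\<forall>n k. Z (real k / 2 ^ n) \<omega> = b * (real k / 2 ^ n)" and t: "0 \<le> t"
    have "continuous (at t within {t..}) (\<lambda>s. Z s \<omega>)"
      using right_continuous_paths[OF \<omega> t] by (simp add: continuous_within at_within_Ici_at_right)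
    then have "(\<lambda>n. Z (dyadic_ceiling n t) \<omega>) \<longlonglongrightarrow> Z t \<omega>"
      using tendsto_dyadic_ceiling[OF t] dyadic_ceiling_ge
      unfolding continuous_within_sequentially by (auto simp: o_def)
    moreover have "Z (dyadic_ceiling n t) \<omega> = b * dyadic_ceiling n t" for n
      unfolding dyadic_ceiling_def using * by blast
    ultimately have "(\<lambda>n. b * dyadic_ceiling n t) \<longlonglongrightarrow> Z t \<omega>" by simp
    moreover have "(\<lambda>n. b * dyadic_ceiling n t) \<longlonglongrightarrow> b * t"
      by (intro tendsto_intros tendsto_dyadic_ceiling t)
    ultimately show "Z t \<omega> = b * t" by (rule LIMSEQ_unique)
  qed
  then show False using not_pure_drift by blast
qed

end

section \<open>Laplace transforms\<close>

text \<open>The value 0 at infinity keeps monotonicity and multiplicativity valid on all of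
  \<open>ennreal\<close>.\<close>

definition expneg :: "ennreal \<Rightarrow> ennreal" where
  "expneg x = (if x = top then 0 else ennreal (exp (- enn2real x)))"

lemma measurable_expneg [measurable]: "expneg \<in> borel_measurable borel"
  unfolding expneg_def by measurable

lemma expneg_ennreal: "0 \<le> r \<Longrightarrow> expneg (ennreal r) = ennreal (exp (- r))"
  by (simp add: expneg_def)

lemma expneg_le_1: "expneg x \<le> 1"
  by (auto simp: expneg_def ennreal_le_1 enn2real_nonneg)

lemma expneg_antimono: "x \<le> y \<Longrightarrow> expneg y \<le> expneg x"
  by (auto simp: expneg_def top_unique intro!: ennreal_leI enn2real_mono simp: top.not_eq_extremum)

lemma expneg_add: "expneg (x + y) = expneg x * expneg y"
  by (cases x; cases y) (auto simp: expneg_def ennreal_mult[symmetric] exp_add[symmetric] ennreal_plus[symmetric] simp del: ennreal_plus)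

lemma expneg_0 [simp]: "expneg 0 = 1"
  by (simp add: expneg_def)

lemma expneg_sum: "expneg (\<Sum>i\<in>I. f i) = (\<Prod>i\<in>I. expneg (f i))"
  by (induction I rule: infinite_finite_induct) (auto simp: expneg_add)

lemma tendsto_expneg:
  assumes "X \<longlonglongrightarrow> x" "x < top" "\<And>n. X n \<le> x"
  shows "(\<lambda>n. expneg (X n)) \<longlonglongrightarrow> expneg x"
proof -
  have fin: "X n \<noteq> top" "x \<noteq> top" for n using assms(2) assms(3)[of n] by (auto simp: top_unique)
  have "(\<lambda>n. enn2real (X n)) \<longlonglongrightarrow> enn2real x"
    using assms(1) fin(2) by (intro tendsto_enn2real) (auto simp: top.not_eq_extremum)
  then have "(\<lambda>n. ennreal (exp (- enn2real (X n)))) \<longlonglongrightarrow> ennreal (exp (- enn2real x))"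
    by (intro tendsto_ennrealI tendsto_exp tendsto_minus)
  then show ?thesis using fin by (simp add: expneg_def)
qed

lemma (in prob_space) stable_rv_laplace:
  assumes [measurable]: "X \<in> borel_measurable M"
    and st: "\<And>n::nat. n \<ge> 1 \<Longrightarrow> distr (Pi\<^sub>M {..<n} (\<lambda>_. distr M borel X)) borel (\<lambda>x. \<Sum>i<n. x i) =
           distr M borel (\<lambda>\<omega>. real n powr (1 / \<beta>) * X \<omega>)"
    and n: "n \<ge> 1"
  shows "(\<integral>\<^sup>+\<omega>. ennreal (exp (- (c * X \<omega>))) \<partial>M) ^ n = (\<integral>\<^sup>+\<omega>. ennreal (exp (- (c * (real n powr (1 / \<beta>) * X \<omega>)))) \<partial>M)"
proof -
  let ?D = "distr M borel X"
  interpret D: prob_space ?D by (rule prob_space_distr) measurable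
  interpret P: product_sigma_finite "\<lambda>_::nat. ?D" by standard
  have "(\<integral>\<^sup>+\<omega>. ennreal (exp (- (c * X \<omega>))) \<partial>M) ^ n = (\<Prod>i<n. \<integral>\<^sup>+x. ennreal (exp (- (c * x))) \<partial>?D)"
    by (simp add: nn_integral_distr)
  also have "\<dots> = (\<integral>\<^sup>+x. (\<Prod>i<n. ennreal (exp (- (c * x i)))) \<partial>Pi\<^sub>M {..<n} (\<lambda>_. ?D))"
    by (rule P.product_nn_integral_prod[symmetric]) auto
  also have "\<dots> = (\<integral>\<^sup>+x. ennreal (exp (- (c * (\<Sum>i<n. x i)))) \<partial>Pi\<^sub>M {..<n} (\<lambda>_. ?D))"
    by (simp add: prod_ennreal exp_sum[symmetric] sum_distrib_left sum_negf)
  also have "\<dots> = (\<integral>\<^sup>+y. ennreal (exp (- (c * y))) \<partial>distr (Pi\<^sub>M {..<n} (\<lambda>_. ?D)) borel (\<lambda>x. \<Sum>i<n. x i))"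
    by (subst nn_integral_distr) auto
  also have "\<dots> = (\<integral>\<^sup>+\<omega>. ennreal (exp (- (c * (real n powr (1 / \<beta>) * X \<omega>)))) \<partial>M)"
    unfolding st[OF n] by (subst nn_integral_distr) auto
  finally show ?thesis .
qed

text \<open>Means of copies add up. If the mean is finite and positive, \<open>n = 2\<close> forces
  \<beta> = 1.\<close>

lemma (in prob_space) stable_rv_mean:
  assumes [measurable]: "X \<in> borel_measurable M" and nonneg: "AE \<omega> in M. 0 \<le> X \<omega>"
    and st: "\<And>n::nat. n \<ge> 1 \<Longrightarrow> distr (Pi\<^sub>M {..<n} (\<lambda>_. distr M borel X)) borel (\<lambda>x. \<Sum>i<n. x i) =
           distr M borel (\<lambda>\<omega>. real n powr (1 / \<beta>) * X \<omega>)"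
    and n: "n \<ge> 1"
  shows "of_nat n * (\<integral>\<^sup>+\<omega>. ennreal (X \<omega>) \<partial>M) = ennreal (real n powr (1 / \<beta>)) * (\<integral>\<^sup>+\<omega>. ennreal (X \<omega>) \<partial>M)"
proof -
  let ?D = "distr M borel X" and ?P = "Pi\<^sub>M {..<n} (\<lambda>_. distr M borel X)"
  interpret D: prob_space ?D by (rule prob_space_distr) measurable
  have nn: "AE x in ?D. 0 \<le> x" using nonneg by (subst AE_distr_iff) auto
  have c: "(\<integral>\<^sup>+x. ennreal (x i) \<partial>?P) = (\<integral>\<^sup>+\<omega>. ennreal (X \<omega>) \<partial>M)" if "i < n" for i
  proof -
    have "distr ?P ?D (\<lambda>x. x i) = ?D"
      using that by (intro distr_PiM_component) (auto intro: D.prob_space_axioms)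
    then have "(\<integral>\<^sup>+y. ennreal y \<partial>distr ?P ?D (\<lambda>x. x i)) = (\<integral>\<^sup>+y. ennreal y \<partial>?D)" by simp
    then show ?thesis using that by (simp add: nn_integral_distr)
  qed
  have "AE x in ?P. \<forall>i\<in>{..<n}. 0 \<le> x i"
    by (intro AE_finite_allI AE_PiM_component nn) (auto intro: D.prob_space_axioms)
  then have "(\<integral>\<^sup>+x. ennreal (\<Sum>i<n. x i) \<partial>?P) = (\<integral>\<^sup>+x. (\<Sum>i<n. ennreal (x i)) \<partial>?P)"
    by (intro nn_integral_cong_AE) (auto elim!: eventually_mono intro!: sum_ennreal[symmetric])
  also have "\<dots> = (\<Sum>i<n. \<integral>\<^sup>+x. ennreal (x i) \<partial>?P)" by (rule nn_integral_sum) measurable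
  also have "\<dots> = of_nat n * (\<integral>\<^sup>+\<omega>. ennreal (X \<omega>) \<partial>M)" by (simp add: c)
  finally have "of_nat n * (\<integral>\<^sup>+\<omega>. ennreal (X \<omega>) \<partial>M) = (\<integral>\<^sup>+y. ennreal y \<partial>distr ?P borel (\<lambda>x. \<Sum>i<n. x i))"
    by (subst nn_integral_distr) auto
  also have "\<dots> = (\<integral>\<^sup>+\<omega>. ennreal (real n powr (1 / \<beta>) * X \<omega>) \<partial>M)"
    unfolding st[OF n] by (subst nn_integral_distr) auto
  also have "\<dots> = (\<integral>\<^sup>+\<omega>. ennreal (real n powr (1 / \<beta>)) * ennreal (X \<omega>) \<partial>M)"
    by (intro nn_integral_cong) (simp add: ennreal_mult')
  also have "\<dots> = ennreal (real n powr (1 / \<beta>)) * (\<integral>\<^sup>+\<omega>. ennreal (X \<omega>) \<partial>M)"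
    by (rule nn_integral_cmult) measurable
  finally show ?thesis .
qed

text \<open>The law of the path is the product of copies of \<open>\<mu>\<close>; this identifies a
  block of a fine walk with a whole coarse walk.\<close>

lemma (in iid_seq) nn_integral_path_cong:
  assumes "iid_seq M Y \<mu>" and [measurable]: "g \<in> borel_measurable seq_borel"
  shows "(\<integral>\<^sup>+\<omega>. g (path \<omega>) \<partial>M) = (\<integral>\<^sup>+\<omega>. g (iid_seq.path Y \<omega>) \<partial>M)"
proof -
  interpret Y: iid_seq M Y \<mu> by fact
  have "(\<integral>\<^sup>+x. g x \<partial>distr M seq_borel path) = (\<integral>\<^sup>+x. g x \<partial>distr M seq_borel Y.path)"
    by (simp add: distr_path Y.distr_path)
  then show ?thesis by (simp add: nn_integral_distr)
qed

lemma grid_var_trunc: "grid_var \<alpha> p n (trunc (2 ^ n) x) = grid_var \<alpha> p n x"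
  unfolding grid_var_def by (rule chain_sup_cong_diff) (simp add: psum_trunc)

text \<open>A walk of level \<open>n + k\<close> consists of \<open>2 ^ k\<close> blocks of
  \<open>2 ^ n\<close> steps, each a walk of level \<open>n\<close> up to the change of
  normalisation \<open>2 powr (- k / \<alpha>)\<close>, which the power weight raises to the power
  p.\<close>

lemma grid_var_superadd:
  "(\<Sum>j<2 ^ k. ennreal (2 powr (- real k * p / \<alpha>)) * grid_var \<alpha> p n (trunc (2 ^ n) (shift (j * 2 ^ n) x)))
     \<le> grid_var \<alpha> p (n + k) x"
proof -
  let ?f = "\<lambda>i. 2 powr (- real (n + k) / \<alpha>) * psum x i"
  have "ennreal (2 powr (- real k * p / \<alpha>)) * grid_var \<alpha> p n (trunc (2 ^ n) (shift j x))
    = chain_sup (pow_weight p) ?f {j..j + 2 ^ n}" for j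
  proof -
    have "chain_sup (pow_weight p) ?f {j..j + 2 ^ n}
      = chain_sup (\<lambda>y. pow_weight p (2 powr (- real (n + k) / \<alpha>) * y)) (psum (trunc (2 ^ n) (shift j x))) {..2 ^ n}"
      by (simp only: chain_sup_rescale chain_sup_psum_block)
    also have "\<dots> = chain_sup (pow_weight p) (\<lambda>i. 2 powr (- real k / \<alpha>) * (2 powr (- real n / \<alpha>) * psum (trunc (2 ^ n) (shift j x)) i)) {..2 ^ n}"
    proof -
      have "2 powr (- real (n + k) / \<alpha>) = 2 powr (- real k / \<alpha>) * 2 powr (- real n / \<alpha>)"
        unfolding powr_add[symmetric] add_divide_distrib[symmetric] by (simp add: algebra_simps)
      then show ?thesis by (subst chain_sup_rescale[symmetric]) (simp only: mult.assoc)
    qed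
    also have "\<dots> = ennreal (\<bar>2 powr (- real k / \<alpha>)\<bar> powr p) * grid_var \<alpha> p n (trunc (2 ^ n) (shift j x))"
      unfolding grid_var_def by (rule chain_sup_scale) (rule pow_weight_mult)
    also have "\<bar>2 powr (- real k / \<alpha>)\<bar> powr p = 2 powr (- real k * p / \<alpha>)"
      by (simp add: powr_powr)
    finally show ?thesis by simp
  qed
  then have "(\<Sum>j<2 ^ k. ennreal (2 powr (- real k * p / \<alpha>)) * grid_var \<alpha> p n (trunc (2 ^ n) (shift (j * 2 ^ n) x)))
    = (\<Sum>j<2 ^ k. chain_sup (pow_weight p) ?f {j * 2 ^ n..Suc j * 2 ^ n})"
    by (simp only: mult_Suc add.commute)
  also have "\<dots> \<le> chain_sup (pow_weight p) ?f {..2 ^ k * 2 ^ n}"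
    by (rule chain_sup_superadd_blocks)
  also have "\<dots> = grid_var \<alpha> p (n + k) x"
    unfolding grid_var_def by (simp only: power_add mult.commute)
  finally show ?thesis .
qed

lemma grid_var_ge_end: "pow_weight p (2 powr (- real n / \<alpha>) * psum x (2 ^ n)) \<le> grid_var \<alpha> p n x"
  using chain_sup_pair[of 0 "{..2 ^ n}" "2 ^ n" "pow_weight p" "\<lambda>i. 2 powr (- real n / \<alpha>) * psum x i"]
  by (simp add: grid_var_def)

lemma psum_blocks: "psum x (N * m) = (\<Sum>j<N. psum (trunc m (shift (j * m) x)) m)"
proof (induction N)
  case (Suc N)
  then show ?case by (simp add: psum_trunc psum_shift add.commute)
qed simp

context strictly_stable_process
begin

section \<open>Laplace transform of the variation and block comparison\<close>

definition lap :: "real \<Rightarrow> real \<Rightarrow> ennreal" where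
  "lap p c = (\<integral>\<^sup>+\<omega>. expneg (ennreal c * pvar p \<omega>) \<partial>M)"

lemma lap_le_1: "lap p c \<le> 1"
proof -
  have "lap p c \<le> (\<integral>\<^sup>+\<omega>. 1 \<partial>M)" unfolding lap_def by (intro nn_integral_mono expneg_le_1)
  then show ?thesis by (simp add: emeasure_space_1)
qed

lemma lap_antimono: "c \<le> d \<Longrightarrow> lap p d \<le> lap p c"
  unfolding lap_def by (intro nn_integral_mono expneg_antimono mult_right_mono ennreal_leI) auto

lemma tendsto_lap:
  assumes p: "\<alpha> < p"
  shows "(\<lambda>n. \<integral>\<^sup>+\<omega>. expneg (ennreal c * dvar p n \<omega>) \<partial>M) \<longlonglongrightarrow> lap p c"
  unfolding lap_def
proof (rule nn_integral_dominated_convergence[where w="\<lambda>_. 1"])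
  show "AE \<omega> in M. (\<lambda>n. expneg (ennreal c * dvar p n \<omega>)) \<longlonglongrightarrow> expneg (ennreal c * pvar p \<omega>)"
    using AE_pvar_finite[OF p]
  proof eventually_elim
    case (elim \<omega>)
    have "(\<lambda>n. dvar p n \<omega>) \<longlonglongrightarrow> pvar p \<omega>"
      unfolding pvar_def using incseq_dvar by (rule LIMSEQ_SUP)
    then show ?case
      using elim by (intro tendsto_expneg ennreal_tendsto_cmult) (auto simp: ennreal_mult_less_top intro!: mult_left_mono dvar_le_pvar)
  qed
qed (auto simp: expneg_le_1 emeasure_space_1)

lemma lap_variation_power:
  assumes p: "\<alpha> < p" "0 \<le> c"
  shows "(\<integral>\<^sup>+\<omega>. ennreal (exp (- (c * variation_power p Z \<omega>))) \<partial>M) = lap p c"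
  unfolding lap_def
proof (rule nn_integral_cong_AE)
  show "AE \<omega> in M. ennreal (exp (- (c * variation_power p Z \<omega>))) = expneg (ennreal c * pvar p \<omega>)"
    using AE_pvar_finite[OF p(1)] AE_space
  proof eventually_elim
    case (elim \<omega>)
    then obtain v where v: "pvar p \<omega> = ennreal v" "0 \<le> v" by (cases "pvar p \<omega>") auto
    then show ?case using elim p index_pos
      by (simp add: variation_power_eq ennreal_mult[symmetric] expneg_ennreal)
  qed
qed

text \<open>A quantitative gain over superadditivity. If each block moves by more than \<epsilon> in
  direction \<sigma> and has variation at most \<open>K\<close>, the scaled block variations sum to
  at most \<open>a\<close>, while the end points alone give the whole walk at least
  \<open>b\<close>. On this event the two exponentials differ by at least
  \<open>exp (- a) - exp (- b)\<close>; elsewhere superadditivity suffices.\<close>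

lemma lap_block_inequality:
  fixes n k :: nat and \<epsilon> K \<sigma> p :: real
  defines "N \<equiv> 2 ^ k :: nat" and "c \<equiv> 2 powr (- real k * p / \<alpha>)"
  defines "a \<equiv> c * real N * K" and "b \<equiv> c * (real N * \<epsilon>) powr p"
  assumes p: "0 < p" and \<sigma>: "\<sigma> = 1 \<or> \<sigma> = -1" and \<epsilon>: "0 < \<epsilon>" and K: "0 \<le> K" and ab: "a \<le> b"
  shows "(\<integral>\<^sup>+\<omega>. expneg (dvar p (n + k) \<omega>) \<partial>M)
      + ennreal (exp (- a) - exp (- b)) * emeasure M {\<omega>\<in>space M. \<sigma> * (Z 1 \<omega> - Z 0 \<omega>) > \<epsilon> \<and> dvar p n \<omega> \<le> ennreal K} ^ N
    \<le> (\<integral>\<^sup>+\<omega>. expneg (ennreal c * dvar p n \<omega>) \<partial>M) ^ N"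
proof -
  let ?m = "2 ^ n :: nat"
  let ?blk = "\<lambda>j \<omega>. trunc ?m (shift (j * ?m) (walk.path (n + k) \<omega>))"
  define g where "g x = expneg (ennreal c * grid_var \<alpha> p n x)" for x
  define h :: "(nat \<Rightarrow> real) \<Rightarrow> ennreal" where
    "h = indicator {x. \<sigma> * (2 powr (- real n / \<alpha>) * psum x ?m) > \<epsilon> \<and> grid_var \<alpha> p n x \<le> ennreal K}"
  have g_m [measurable]: "g \<in> borel_measurable seq_borel" unfolding g_def by measurable
  have h_m [measurable]: "h \<in> borel_measurable seq_borel"
    unfolding h_def by (rule borel_measurable_indicator') measurable
  have c0: "0 < c" by (simp add: c_def)
  have pw: "expneg (dvar p (n + k) \<omega>) + ennreal (exp (- a) - exp (- b)) * (\<Prod>j<N. h (?blk j \<omega>)) \<le> (\<Prod>j<N. g (?blk j \<omega>))" for \<omega>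
  proof (cases "\<forall>j<N. h (?blk j \<omega>) = 1")
    case False
    then obtain j where "j < N" "h (?blk j \<omega>) = 0" by (auto simp: h_def indicator_def split: if_splits)
    then have h0: "(\<Prod>j<N. h (?blk j \<omega>)) = 0" by auto
    have "expneg (dvar p (n + k) \<omega>) \<le> (\<Prod>j<N. g (?blk j \<omega>))"
      unfolding g_def expneg_sum[symmetric] dvar_def N_def c_def
      by (intro expneg_antimono grid_var_superadd)
    then show ?thesis by (simp only: h0 mult_zero_right add_0_right)
  next
    case True
    then have hb: "\<sigma> * (2 powr (- real n / \<alpha>) * psum (?blk j \<omega>) ?m) > \<epsilon>" "grid_var \<alpha> p n (?blk j \<omega>) \<le> ennreal K" if "j < N" for j
      using that by (auto simp: h_def indicator_def split: if_splits)
    have "ennreal (exp (- a)) = (\<Prod>j<N. ennreal (exp (- (c * K))))"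
      by (simp add: a_def ennreal_power exp_of_nat_mult[symmetric] mult_ac)
    also have "\<dots> \<le> (\<Prod>j<N. g (?blk j \<omega>))"
    proof (rule prod_mono_ennreal)
      fix j assume "j \<in> {..<N}"
      then have "ennreal c * grid_var \<alpha> p n (?blk j \<omega>) \<le> ennreal (c * K)"
        using hb(2)[of j] c0 K by (auto simp: ennreal_mult intro: mult_left_mono)
      then have "expneg (ennreal (c * K)) \<le> g (?blk j \<omega>)" unfolding g_def by (rule expneg_antimono)
      then show "ennreal (exp (- (c * K))) \<le> g (?blk j \<omega>)" using c0 K by (simp add: expneg_ennreal)
    qed
    finally have ga: "ennreal (exp (- a)) \<le> (\<Prod>j<N. g (?blk j \<omega>))" .
    have "expneg (dvar p (n + k) \<omega>) \<le> ennreal (exp (- b))"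
    proof -
      let ?s = "2 powr (- real k / \<alpha>)"
      let ?S = "2 powr (- real (n + k) / \<alpha>) * psum (walk.path (n + k) \<omega>) (2 ^ (n + k))"
      have *: "psum (walk.path (n + k) \<omega>) (2 ^ (n + k)) = (\<Sum>j<N. psum (?blk j \<omega>) ?m)"
        using psum_blocks[of "walk.path (n + k) \<omega>" N ?m] by (simp add: N_def power_add mult.commute)
      \<comment> \<open>The block increments point in the same direction, so they add up without
        cancellation.\<close>
      have "\<sigma> * ?S = ?s * (\<Sum>j<N. \<sigma> * (2 powr (- real n / \<alpha>) * psum (?blk j \<omega>) ?m))"
      proof -
        have "2 powr (- real (n + k) / \<alpha>) = ?s * 2 powr (- real n / \<alpha>)"
          unfolding powr_add[symmetric] add_divide_distrib[symmetric] by (simp add: algebra_simps)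
        then show ?thesis using * by (simp only: sum_distrib_left mult_ac)
      qed
      also have "\<dots> \<ge> ?s * (\<Sum>j<N. \<epsilon>)"
        using hb(1) by (intro mult_left_mono sum_mono) (auto intro: less_imp_le)
      finally have "?s * (real N * \<epsilon>) \<le> \<bar>?S\<bar>" using \<sigma> by auto
      then have "(?s * (real N * \<epsilon>)) powr p \<le> \<bar>?S\<bar> powr p"
        using p \<epsilon> by (intro powr_mono2) auto
      also have "(?s * (real N * \<epsilon>)) powr p = b"
        using \<epsilon> by (simp add: b_def c_def powr_mult powr_powr)
      finally have "ennreal b \<le> pow_weight p ?S" by (simp add: pow_weight_def ennreal_leI)
      also have "\<dots> \<le> dvar p (n + k) \<omega>" unfolding dvar_def by (rule grid_var_ge_end)
      finally have "expneg (dvar p (n + k) \<omega>) \<le> expneg (ennreal b)" by (rule expneg_antimono)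
      then show ?thesis using c0 by (simp add: expneg_ennreal b_def)
    qed
    then have "expneg (dvar p (n + k) \<omega>) + ennreal (exp (- a) - exp (- b)) * (\<Prod>j<N. h (?blk j \<omega>))
      \<le> ennreal (exp (- b)) + ennreal (exp (- a) - exp (- b))"
      using True by (simp add: add_right_mono)
    also have "\<dots> = ennreal (exp (- a))" using ab by (simp add: ennreal_plus[symmetric] del: ennreal_plus)
    also note ga
    finally show ?thesis .
  qed
  \<comment> \<open>Blocks are independent, and each has the law of the path of level
    \<open>n\<close> because all levels share \<open>\<mu>\<close>.\<close>
  have int_prod: "(\<integral>\<^sup>+\<omega>. (\<Prod>j<N. f (?blk j \<omega>)) \<partial>M) = (\<integral>\<^sup>+\<omega>. f (trunc ?m (walk.path n \<omega>)) \<partial>M) ^ N"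
    if [measurable]: "f \<in> borel_measurable seq_borel" for f
    using walk.nn_integral_prod_blocks[OF that, of ?m "n + k" N]
      walk.nn_integral_path_cong[OF walk.iid_seq_axioms[of n], of "\<lambda>x. f (trunc ?m x)" "n + k"] by simp
  have ig: "(\<integral>\<^sup>+\<omega>. g (trunc ?m (walk.path n \<omega>)) \<partial>M) = (\<integral>\<^sup>+\<omega>. expneg (ennreal c * dvar p n \<omega>) \<partial>M)"
    by (simp add: g_def grid_var_trunc dvar_def)
  have ih: "(\<integral>\<^sup>+\<omega>. h (trunc ?m (walk.path n \<omega>)) \<partial>M)
     = emeasure M {\<omega>\<in>space M. \<sigma> * (Z 1 \<omega> - Z 0 \<omega>) > \<epsilon> \<and> dvar p n \<omega> \<le> ennreal K}"
  proof -
    have inc: "2 powr (- real n / \<alpha>) * psum (trunc ?m (walk.path n \<omega>)) ?m = Z 1 \<omega> - Z 0 \<omega>" for \<omega>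
      by (simp add: psum_trunc psum_walk powr_minus mult.assoc[symmetric])
    have "(\<integral>\<^sup>+\<omega>. h (trunc ?m (walk.path n \<omega>)) \<partial>M)
      = (\<integral>\<^sup>+\<omega>. indicator {\<omega>\<in>space M. \<sigma> * (Z 1 \<omega> - Z 0 \<omega>) > \<epsilon> \<and> dvar p n \<omega> \<le> ennreal K} \<omega> \<partial>M)"
      by (intro nn_integral_cong)
        (simp add: h_def indicator_def grid_var_trunc dvar_def inc del: divide_minus_left)
    then show ?thesis by simp
  qed
  have "(\<integral>\<^sup>+\<omega>. expneg (dvar p (n + k) \<omega>) \<partial>M)
      + ennreal (exp (- a) - exp (- b)) * (\<integral>\<^sup>+\<omega>. (\<Prod>j<N. h (?blk j \<omega>)) \<partial>M)
    = (\<integral>\<^sup>+\<omega>. expneg (dvar p (n + k) \<omega>) + ennreal (exp (- a) - exp (- b)) * (\<Prod>j<N. h (?blk j \<omega>)) \<partial>M)"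
    by (simp add: nn_integral_add nn_integral_cmult)
  also have "\<dots> \<le> (\<integral>\<^sup>+\<omega>. (\<Prod>j<N. g (?blk j \<omega>)) \<partial>M)"
    by (intro nn_integral_mono pw)
  finally show ?thesis unfolding int_prod[OF g_m] int_prod[OF h_m] ig ih .
qed

text \<open>\<open>Z 1\<close> is not almost surely 0 and the variation is almost surely finite. One
  index \<open>i\<close> can govern both bounds because the events \<open>A \<sigma> i\<close> grow
  with \<open>i\<close>.\<close>

lemma ex_sign_and_level:
  assumes "\<alpha> < p"
  obtains \<sigma> \<epsilon> K :: real where "\<sigma> = 1 \<or> \<sigma> = -1" "0 < \<epsilon>" "0 \<le> K"
    "emeasure M {\<omega>\<in>space M. \<sigma> * (Z 1 \<omega> - Z 0 \<omega>) > \<epsilon> \<and> pvar p \<omega> \<le> ennreal K} > 0"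
proof -
  define A where "A \<sigma> i = {\<omega>\<in>space M. \<sigma> * (Z 1 \<omega> - Z 0 \<omega>) > 1 / real (Suc i) \<and> pvar p \<omega> \<le> ennreal (real i)}" for \<sigma> i
  have [measurable]: "A \<sigma> i \<in> sets M" for \<sigma> i unfolding A_def by measurable
  have "\<exists>\<sigma>\<in>{1, -1}. \<exists>i. emeasure M (A \<sigma> i) > 0"
  proof (rule ccontr)
    assume "\<not> ?thesis"
    then have null: "AE \<omega> in M. \<omega> \<notin> A \<sigma> i" if "\<sigma> = 1 \<or> \<sigma> = -1" for \<sigma> i
      using that by (intro AE_not_in) (auto simp: null_sets_def)
    have "AE \<omega> in M. \<forall>i. \<omega> \<notin> A 1 i \<and> \<omega> \<notin> A (-1) i"
      unfolding AE_all_countable using null by simp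
    then have "AE \<omega> in M. Z 1 \<omega> = 0"
      using AE_pvar_finite[OF assms] Z_zero AE_space
    proof eventually_elim
      case (elim \<omega>)
      show ?case
      proof (rule ccontr)
        assume nz: "Z 1 \<omega> \<noteq> 0"
        obtain v where v: "pvar p \<omega> = ennreal v" "0 \<le> v" using elim(2) by (cases "pvar p \<omega>") auto
        obtain i1 where i1: "1 / real (Suc i1) < \<bar>Z 1 \<omega>\<bar>" using nz nat_approx_posE[of "\<bar>Z 1 \<omega>\<bar>"] by auto
        obtain i2 where i2: "v \<le> real i2" using real_arch_simple by blast
        define i where "i = max i1 i2"
        have "1 / real (Suc i) \<le> 1 / real (Suc i1)" by (intro divide_left_mono) (auto simp: i_def)
        then have "1 / real (Suc i) < \<bar>Z 1 \<omega>\<bar>" using i1 by simp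
        moreover have "pvar p \<omega> \<le> ennreal (real i)" using v i2 by (auto simp: i_def intro!: ennreal_leI)
        ultimately have "\<omega> \<in> A 1 i \<or> \<omega> \<in> A (-1) i"
          using elim(3,4) by (auto simp: A_def abs_if split: if_splits)
        then show False using elim(1) by blast
      qed
    qed
    then show False using Z_1_not_constant by blast
  qed
  then obtain \<sigma> i where "\<sigma> = 1 \<or> \<sigma> = -1" "emeasure M (A \<sigma> i) > 0" by blast
  then show ?thesis by (intro that[of \<sigma> "1 / real (Suc i)" "real i"]) (auto simp: A_def)
qed

text \<open>The gain of \<open>lap_block_inequality\<close> survives the limit over \<open>n\<close>
  and makes \<open>lap p 1\<close> strictly smaller than \<open>lap p c ^ N\<close>. Stability turns
  the latter into \<open>lap p (c * N powr (1 / \<beta>))\<close>, and \<beta> \<le> \<alpha> / p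
  would make this argument at least 1, so the value at most \<open>lap p 1\<close>.\<close>

lemma index_gt_of_stable:
  assumes p: "\<alpha> < p" "1 < p" and \<beta>: "0 < \<beta>"
    and st: "\<And>n c. 1 \<le> n \<Longrightarrow> 0 \<le> c \<Longrightarrow> lap p c ^ n = lap p (c * real n powr (1 / \<beta>))"
  shows "\<alpha> / p < \<beta>"
proof (rule ccontr)
  assume "\<not> \<alpha> / p < \<beta>"
  then have \<beta>le: "p / \<alpha> \<le> 1 / \<beta>" using p index_pos \<beta> by (simp add: field_simps)
  obtain \<sigma> \<epsilon> K :: real where \<sigma>: "\<sigma> = 1 \<or> \<sigma> = -1" and \<epsilon>: "0 < \<epsilon>" and K: "0 \<le> K"
    and pos: "emeasure M {\<omega>\<in>space M. \<sigma> * (Z 1 \<omega> - Z 0 \<omega>) > \<epsilon> \<and> pvar p \<omega> \<le> ennreal K} > 0"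
    using ex_sign_and_level[OF p(1)] .
  let ?\<delta> = "emeasure M {\<omega>\<in>space M. \<sigma> * (Z 1 \<omega> - Z 0 \<omega>) > \<epsilon> \<and> pvar p \<omega> \<le> ennreal K}"
  have "1 < (2::real) powr (p - 1)" using p by simp
  \<comment> \<open>For \<open>N = 2 ^ k\<close> the condition says
    \<open>N * K < (N * \<epsilon>) powr p\<close>, that is \<open>a < b\<close>. It can be met
    because p > 1 makes \<open>N powr (p - 1)\<close> unbounded.\<close>
  then obtain k where k: "K / \<epsilon> powr p < (2 powr (p - 1)) ^ k" using real_arch_pow by blast
  define N :: nat where "N = 2 ^ k"
  define c where "c = 2 powr (- real k * p / \<alpha>)"
  define a where "a = c * real N * K"
  define b where "b = c * (real N * \<epsilon>) powr p"
  have N: "real N = 2 powr real k" "1 \<le> N" by (simp_all add: N_def powr_realpow)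
  have "K < (2 powr (p - 1)) ^ k * \<epsilon> powr p" using k \<epsilon> by (simp add: field_simps)
  also have "(2 powr (p - 1)) ^ k = 2 powr (real k * p) / 2 powr real k"
    by (simp add: powr_realpow[symmetric] powr_powr powr_diff[symmetric] algebra_simps)
  finally have "real N * K < (real N) powr p * \<epsilon> powr p"
    by (simp add: N powr_powr field_simps)
  then have ab: "a < b" using \<epsilon> by (simp add: a_def b_def c_def powr_mult)
  have "(\<integral>\<^sup>+\<omega>. expneg (ennreal 1 * dvar p (n + k) \<omega>) \<partial>M) + ennreal (exp (- a) - exp (- b)) * ?\<delta> ^ N
    \<le> (\<integral>\<^sup>+\<omega>. expneg (ennreal c * dvar p n \<omega>) \<partial>M) ^ N" for n
  proof -
    \<comment> \<open>With \<open>pvar\<close> in place of \<open>dvar\<close> the probability no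
      longer depends on \<open>n\<close>.\<close>
    have "?\<delta> \<le> emeasure M {\<omega>\<in>space M. \<sigma> * (Z 1 \<omega> - Z 0 \<omega>) > \<epsilon> \<and> dvar p n \<omega> \<le> ennreal K}"
      by (intro emeasure_mono) (auto intro: order_trans[OF dvar_le_pvar])
    then have "(\<integral>\<^sup>+\<omega>. expneg (ennreal 1 * dvar p (n + k) \<omega>) \<partial>M) + ennreal (exp (- a) - exp (- b)) * ?\<delta> ^ N
      \<le> (\<integral>\<^sup>+\<omega>. expneg (dvar p (n + k) \<omega>) \<partial>M)
      + ennreal (exp (- a) - exp (- b)) * emeasure M {\<omega>\<in>space M. \<sigma> * (Z 1 \<omega> - Z 0 \<omega>) > \<epsilon> \<and> dvar p n \<omega> \<le> ennreal K} ^ N"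
      by (intro add_mono mult_left_mono power_mono) auto
    also have "\<dots> \<le> (\<integral>\<^sup>+\<omega>. expneg (ennreal c * dvar p n \<omega>) \<partial>M) ^ N"
      using lap_block_inequality[OF _ \<sigma> \<epsilon> K, of p k n] ab p by (simp add: a_def b_def c_def N_def)
    finally show ?thesis .
  qed
  moreover have "(\<lambda>n. (\<integral>\<^sup>+\<omega>. expneg (ennreal 1 * dvar p (n + k) \<omega>) \<partial>M) + ennreal (exp (- a) - exp (- b)) * ?\<delta> ^ N)
    \<longlonglongrightarrow> lap p 1 + ennreal (exp (- a) - exp (- b)) * ?\<delta> ^ N"
    using LIMSEQ_ignore_initial_segment[OF tendsto_lap[OF p(1), of 1], of k] by (intro tendsto_add tendsto_const)
  moreover have "(\<lambda>n. (\<integral>\<^sup>+\<omega>. expneg (ennreal c * dvar p n \<omega>) \<partial>M) ^ N) \<longlonglongrightarrow> lap p c ^ N"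
    using tendsto_lap[OF p(1), of c]
  proof (induction N)
    case (Suc N)
    \<comment> \<open>Multiplication in \<open>ennreal\<close> is not continuous at 0 times
      infinity; the bound by 1 excludes this.\<close>
    have "(\<lambda>n. (\<integral>\<^sup>+\<omega>. expneg (ennreal c * dvar p n \<omega>) \<partial>M) * (\<integral>\<^sup>+\<omega>. expneg (ennreal c * dvar p n \<omega>) \<partial>M) ^ N) \<longlonglongrightarrow> lap p c * lap p c ^ N"
      using Suc lap_le_1[of p c] by (intro tendsto_mult_ennreal) (auto simp: power_eq_top_ennreal)
    then show ?case by simp
  qed simp
  ultimately have "lap p 1 + ennreal (exp (- a) - exp (- b)) * ?\<delta> ^ N \<le> lap p c ^ N"
    by (intro LIMSEQ_le) auto
  also have "lap p c ^ N = lap p (c * real N powr (1 / \<beta>))"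
    using N by (intro st) (auto simp: c_def)
  also have "\<dots> \<le> lap p 1"
  proof (rule lap_antimono)
    have "0 \<le> real k * (1 / \<beta> - p / \<alpha>)" using \<beta>le by (intro mult_nonneg_nonneg) auto
    then have "2 powr 0 \<le> 2 powr (real k * (1 / \<beta> - p / \<alpha>))" by (intro powr_mono) auto
    also have "2 powr (real k * (1 / \<beta> - p / \<alpha>)) = c * real N powr (1 / \<beta>)"
      by (simp add: c_def N powr_powr powr_add[symmetric] algebra_simps)
    finally show "1 \<le> c * real N powr (1 / \<beta>)" by simp
  qed
  finally have "lap p 1 + ennreal (exp (- a) - exp (- b)) * ?\<delta> ^ N \<le> lap p 1 + 0" by simp
  then have "ennreal (exp (- a) - exp (- b)) * ?\<delta> ^ N \<le> 0"
    using lap_le_1[of p 1] by (subst (asm) ennreal_add_left_cancel_le) (auto simp: top_unique)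
  then show False using ab pos by (auto simp: ennreal_eq_0_iff)
qed

end

section \<open>Symmetrisation and moments\<close>

lemma (in prob_space) AE_const_of_second_moment:
  fixes W :: "'a \<Rightarrow> real"
  assumes [measurable]: "W \<in> borel_measurable M" and bd: "\<And>\<omega>. 0 \<le> W \<omega>" "\<And>\<omega>. W \<omega> \<le> B"
    and sq: "(\<integral>\<^sup>+\<omega>. ennreal (W \<omega> ^ 2) \<partial>M) = (\<integral>\<^sup>+\<omega>. ennreal (W \<omega>) \<partial>M) ^ 2"
  shows "AE \<omega> in M. W \<omega> = expectation W"
proof -
  have i1: "integrable M W" using bd by (intro integrable_const_bound[where B=B]) auto
  have i2: "integrable M (\<lambda>\<omega>. W \<omega> ^ 2)"
    using bd by (intro integrable_const_bound[where B="B ^ 2"]) (auto intro!: power_mono)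
  have "ennreal (expectation (\<lambda>\<omega>. W \<omega> ^ 2)) = ennreal (expectation W ^ 2)"
    using sq bd i1 i2 by (simp add: nn_integral_eq_integral ennreal_power)
  then have "expectation (\<lambda>\<omega>. W \<omega> ^ 2) = expectation W ^ 2"
    by (subst (asm) ennreal_inj) (auto intro: integral_nonneg_AE)
  then have "variance W = 0" using variance_eq[OF i1 i2] by simp
  moreover have "integrable M (\<lambda>\<omega>. (W \<omega> - expectation W)\<^sup>2)"
    using i1 i2 by (simp add: power2_diff)
  ultimately have "AE \<omega> in M. (W \<omega> - expectation W)\<^sup>2 = 0"
    by (subst (asm) integral_nonneg_eq_0_iff_AE) auto
  then show ?thesis by simp
qed

lemma (in prob_space) char_distr_scale:
  fixes X :: "'a \<Rightarrow> real"
  assumes [measurable]: "X \<in> borel_measurable M"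
  shows "char (distr M borel (\<lambda>\<omega>. c * X \<omega>)) t = char (distr M borel X) (c * t)"
  by (simp add: char_def integral_distr mult_ac)

text \<open>For |u| \<ge> 1 the left side is at most 2. For smaller \<open>u\<close> it is at most a
  multiple of the square of \<open>u\<close>, which \<gamma> \<le> 2 bounds by the power
  \<gamma>.\<close>

lemma one_minus_cos_le:
  fixes u \<gamma> :: real
  assumes "0 < \<gamma>" "\<gamma> \<le> 2"
  shows "1 - cos u \<le> 2 * \<bar>u\<bar> powr \<gamma>"
proof (cases "1 \<le> \<bar>u\<bar>")
  case True
  then have "1 \<le> \<bar>u\<bar> powr \<gamma>" using assms by (simp add: ge_one_powr_ge_zero)
  moreover have "- 1 \<le> cos u" by simp
  ultimately show ?thesis by linarith
next
  case False
  have "1 - cos u = 2 * (sin (u / 2))\<^sup>2" using cos_double_sin[of "u / 2"] by simp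
  also have "\<dots> \<le> 2 * (u / 2)\<^sup>2"
    using power_mono[OF abs_sin_x_le_abs_x[of "u / 2"], of 2] by (simp add: power_divide)
  also have "\<dots> \<le> 2 * u\<^sup>2" by (simp add: power_divide)
  also have "u\<^sup>2 \<le> \<bar>u\<bar> powr \<gamma>"
  proof (cases "u = 0")
    case False
    then have "u\<^sup>2 = \<bar>u\<bar> powr 2" by simp
    also have "\<dots> \<le> \<bar>u\<bar> powr \<gamma>" using assms \<open>\<not> 1 \<le> \<bar>u\<bar>\<close> by (intro powr_mono') auto
    finally show ?thesis .
  qed simp
  finally show ?thesis by simp
qed

lemma abs_diff_powr_le:
  fixes a b \<gamma> :: real
  assumes "0 < \<gamma>"
  shows "\<bar>a - b\<bar> powr \<gamma> \<le> 2 powr \<gamma> * (\<bar>a\<bar> powr \<gamma> + \<bar>b\<bar> powr \<gamma>)"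
proof -
  have "\<bar>a - b\<bar> powr \<gamma> \<le> (2 * max \<bar>a\<bar> \<bar>b\<bar>) powr \<gamma>"
    using assms by (intro powr_mono2) auto
  also have "\<dots> = 2 powr \<gamma> * max \<bar>a\<bar> \<bar>b\<bar> powr \<gamma>" by (simp add: powr_mult)
  also have "max \<bar>a\<bar> \<bar>b\<bar> powr \<gamma> \<le> \<bar>a\<bar> powr \<gamma> + \<bar>b\<bar> powr \<gamma>"
    by (simp add: max_def)
  finally show ?thesis by simp
qed

context stable_walk
begin

definition symm :: "'a \<Rightarrow> real" where
  "symm \<omega> = X 0 \<omega> - X 1 \<omega>"

text \<open>The characteristic function of the difference of two independent steps (see
  \<open>char_symm\<close>). It is real and nonnegative, so roots and logarithms are unambiguous,
  and any centring of the steps cancels.\<close>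

definition symm_char :: "real \<Rightarrow> real" where
  "symm_char t = (cmod (char \<mu> t))\<^sup>2"

lemma symm_measurable [measurable]: "symm \<in> borel_measurable M"
  unfolding symm_def by measurable

lemma real_distribution_\<mu>: "real_distribution \<mu>"
  unfolding law_X[of 0, symmetric] by simp

lemma char_\<mu>_minus: "char \<mu> (- t) = cnj (char \<mu> t)"
proof -
  have "char \<mu> (- t) = (CLINT x|\<mu>. cnj (iexp (t * x)))" by (simp add: char_def exp_cnj)
  also have "\<dots> = cnj (char \<mu> t)" unfolding char_def by (rule Bochner_Integration.integral_cnj)
  finally show ?thesis .
qed

lemma char_symm: "char (distr M borel symm) t = of_real (symm_char t)"
proof -
  define U where "U i = (if i = Suc 0 then (\<lambda>x::real. - x) else (\<lambda>x. x))" for i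
  have ind: "indep_vars (\<lambda>_. borel) (\<lambda>i \<omega>. U i (X i \<omega>)) {0, 1}"
    by (rule indep_vars_compose2[OF indep_vars_subset[OF indep_X]]) (auto simp: U_def)
  have "char (distr M borel symm) t = char (distr M borel (\<lambda>\<omega>. \<Sum>i\<in>{0, 1}. U i (X i \<omega>))) t"
    by (simp add: symm_def[abs_def] U_def)
  also have "\<dots> = char (distr M borel (X 0)) t * char (distr M borel (\<lambda>\<omega>. - X 1 \<omega>)) t"
    unfolding char_distr_sum[OF ind] by (simp add: U_def)
  also have "char (distr M borel (\<lambda>\<omega>. - X 1 \<omega>)) t = char (distr M borel (X 1)) (- t)"
    using char_distr_scale[of "X 1" "-1" t] by simp
  finally show ?thesis
    by (simp add: law_X law_X[unfolded One_nat_def] char_\<mu>_minus symm_char_def complex_norm_square del: of_real_power)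
qed

lemma symm_char_power:
  assumes "1 \<le> k"
  shows "symm_char (real k powr (1 / \<alpha>) * t) = symm_char t ^ k"
proof -
  have "char \<mu> (real k powr (1 / \<alpha>) * t) = char (distr M borel (\<lambda>\<omega>. psum (path \<omega>) k)) t"
    unfolding law_psum[OF assms] by (simp add: char_distr_scale law_X)
  also have "\<dots> = (\<Prod>i<k. char (distr M borel (X i)) t)"
    unfolding psum_def path_def by (rule char_distr_sum[OF indep_vars_subset[OF indep_X]]) auto
  finally show ?thesis by (simp add: symm_char_def law_X norm_power power_mult[symmetric] mult.commute)
qed

lemma symm_char_bounds: "0 \<le> symm_char t" "symm_char t \<le> 1" "symm_char 0 = 1" "symm_char (- t) = symm_char t"
proof -
  interpret \<mu>: real_distribution \<mu> by (rule real_distribution_\<mu>)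
  show "0 \<le> symm_char t" "symm_char t \<le> 1" "symm_char 0 = 1" "symm_char (- t) = symm_char t"
    using \<mu>.cmod_char_le_1[of t] by (auto simp: symm_char_def \<mu>.char_zero power_le_one char_\<mu>_minus)
qed

lemma isCont_symm_char: "isCont symm_char t"
proof -
  interpret \<mu>: real_distribution \<mu> by (rule real_distribution_\<mu>)
  show ?thesis unfolding symm_char_def[abs_def] by (intro continuous_intros \<mu>.isCont_char)
qed

lemma symm_char_eq_cos: "symm_char t = expectation (\<lambda>\<omega>. cos (t * symm \<omega>))"
proof -
  have int: "integrable M (\<lambda>\<omega>. iexp (t * symm \<omega>))"
    by (intro integrable_const_bound[where B=1]) auto
  have "symm_char t = Re (char (distr M borel symm) t)" by (simp add: char_symm)
  also have "\<dots> = Re (CLINT \<omega>|M. iexp (t * symm \<omega>))"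
    by (simp add: char_def integral_distr)
  also have "\<dots> = expectation (\<lambda>\<omega>. Re (iexp (t * symm \<omega>)))"
    using int by (rule integral_Re[symmetric])
  finally show ?thesis by (simp add: Re_exp)
qed

text \<open>By uniqueness of characteristic functions the symmetrised step is 0, so two independent
  steps agree almost surely. A bounded function of a step then has second moment equal to the square
  of its mean, hence is constant.\<close>

lemma AE_const_of_symm_char:
  assumes "\<And>t. symm_char t = 1"
  shows "\<exists>b. AE \<omega> in M. X 0 \<omega> = b"
proof -
  have "char (distr M borel symm) = char (distr M borel (\<lambda>_. 0))"
  proof
    fix t
    have "char (distr M borel (\<lambda>_. 0)) t = 1"
      using char_distr_scale[of "X 0" 0 t] real_distribution.char_zero[OF real_distribution_\<mu>] by (simp add: law_X)
    then show "char (distr M borel symm) t = char (distr M borel (\<lambda>_. 0)) t" by (simp add: char_symm assms)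
  qed
  then have eq: "distr M borel symm = distr M borel (\<lambda>_. 0)"
    by (intro Levy_uniqueness real_distribution_distr) auto
  have "AE x in distr M borel (\<lambda>_. 0::real). x = 0" by (subst AE_distr_iff) auto
  then have "AE x in distr M borel symm. x = 0" unfolding eq .
  then have X01: "AE \<omega> in M. X 0 \<omega> = X 1 \<omega>" by (subst (asm) AE_distr_iff) (auto simp: symm_def)
  \<comment> \<open>\<open>arctan\<close> is bounded and can be inverted; adding 2, which exceeds pi
    / 2, makes the values positive.\<close>
  define W where "W \<omega> = arctan (X 0 \<omega>) + 2" for \<omega>
  define g :: "(nat \<Rightarrow> real) \<Rightarrow> ennreal" where "g x = ennreal (arctan (x 0) + 2)" for x
  have arctan_pos: "0 < arctan x + 2" "arctan x + 2 < 4" for x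
    using arctan_bounded[of x] pi_less_4 by linarith+
  have [measurable]: "g \<in> borel_measurable seq_borel" unfolding g_def by measurable
  have "(\<integral>\<^sup>+\<omega>. ennreal (W \<omega>) \<partial>M) ^ 2 = (\<integral>\<^sup>+\<omega>. (\<Prod>j<2. g (trunc 1 (shift (j * 1) (path \<omega>)))) \<partial>M)"
    by (subst nn_integral_prod_blocks) (auto simp: g_def W_def trunc_def path_def)
  also have "\<dots> = (\<integral>\<^sup>+\<omega>. ennreal (W \<omega> ^ 2) \<partial>M)"
  proof (intro nn_integral_cong_AE)
    show "AE \<omega> in M. (\<Prod>j<2. g (trunc 1 (shift (j * 1) (path \<omega>)))) = ennreal (W \<omega> ^ 2)"
      using X01
    proof eventually_elim
      case (elim \<omega>)
      then show ?case using arctan_pos(1)[of "X 1 \<omega>"]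
        by (simp add: numeral_2_eq_2 g_def W_def trunc_def shift_def path_def ennreal_mult less_imp_le)
    qed
  qed
  finally have "AE \<omega> in M. W \<omega> = expectation W"
    using arctan_pos by (intro AE_const_of_second_moment[where B=4]) (auto simp: W_def intro: less_imp_le)
  then have "AE \<omega> in M. X 0 \<omega> = tan (expectation W - 2)"
  proof eventually_elim
    case (elim \<omega>)
    then have "arctan (X 0 \<omega>) = expectation W - 2" by (simp add: W_def)
    then show ?case by (metis tan_arctan)
  qed
  then show ?thesis by blast
qed

lemma nn_integral_symm_powr:
  assumes "0 < \<gamma>" "(\<integral>\<^sup>+\<omega>. ennreal (\<bar>X 0 \<omega>\<bar> powr \<gamma>) \<partial>M) < top"
  shows "(\<integral>\<^sup>+\<omega>. ennreal (\<bar>symm \<omega>\<bar> powr \<gamma>) \<partial>M) < top"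
proof -
  have X1: "(\<integral>\<^sup>+\<omega>. ennreal (\<bar>X 1 \<omega>\<bar> powr \<gamma>) \<partial>M) = (\<integral>\<^sup>+\<omega>. ennreal (\<bar>X 0 \<omega>\<bar> powr \<gamma>) \<partial>M)"
    using nn_integral_shift[of "\<lambda>x. ennreal (\<bar>x 0\<bar> powr \<gamma>)" 1] by (simp add: shift_def path_def)
  have "(\<integral>\<^sup>+\<omega>. ennreal (\<bar>symm \<omega>\<bar> powr \<gamma>) \<partial>M)
    \<le> (\<integral>\<^sup>+\<omega>. ennreal (2 powr \<gamma>) * (ennreal (\<bar>X 0 \<omega>\<bar> powr \<gamma>) + ennreal (\<bar>X 1 \<omega>\<bar> powr \<gamma>)) \<partial>M)"
    using abs_diff_powr_le[OF assms(1)]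
    by (intro nn_integral_mono) (auto simp: symm_def ennreal_mult[symmetric] ennreal_plus[symmetric] simp del: ennreal_plus intro!: ennreal_leI)
  also have "\<dots> = ennreal (2 powr \<gamma>) * ((\<integral>\<^sup>+\<omega>. ennreal (\<bar>X 0 \<omega>\<bar> powr \<gamma>) \<partial>M) + (\<integral>\<^sup>+\<omega>. ennreal (\<bar>X 1 \<omega>\<bar> powr \<gamma>) \<partial>M))"
    by (simp add: nn_integral_cmult nn_integral_add)
  also have "\<dots> < top" using assms(2) X1 by (simp add: ennreal_mult_less_top)
  finally show ?thesis .
qed

text \<open>A finite moment of order \<gamma> bounds \<open>1 - symm_char t\<close> by a multiple of
  |t| to the power \<gamma>. By stability \<open>symm_char t\<close> is the k-th power of the value
  at \<open>k powr (- 1 / \<alpha>) * t\<close>, hence at least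
  \<open>1 - C * k powr (1 - \<gamma> / \<alpha>)\<close>, which tends to 1 since \<gamma> >
  \<alpha>. So \<open>symm_char\<close> is 1 everywhere and the step is constant.\<close>

lemma moment_infinite:
  assumes \<gamma>: "\<alpha> < \<gamma>" "\<gamma> \<le> 2" and nc: "\<And>b. \<not> (AE \<omega> in M. X 0 \<omega> = b)"
  shows "(\<integral>\<^sup>+\<omega>. ennreal (\<bar>X 0 \<omega>\<bar> powr \<gamma>) \<partial>M) = top"
proof (rule ccontr)
  assume "\<not> ?thesis"
  then have "(\<integral>\<^sup>+\<omega>. ennreal (\<bar>symm \<omega>\<bar> powr \<gamma>) \<partial>M) < top"
    using \<gamma> \<alpha>_pos by (intro nn_integral_symm_powr) (auto simp: top.not_eq_extremum)
  then obtain d where d: "(\<integral>\<^sup>+\<omega>. ennreal (\<bar>symm \<omega>\<bar> powr \<gamma>) \<partial>M) = ennreal d" "0 \<le> d"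
    by (cases "\<integral>\<^sup>+\<omega>. ennreal (\<bar>symm \<omega>\<bar> powr \<gamma>) \<partial>M") auto
  have lower: "1 - symm_char t \<le> 2 * \<bar>t\<bar> powr \<gamma> * d" for t
  proof -
    have i: "integrable M (\<lambda>\<omega>. cos (t * symm \<omega>))"
      by (intro integrable_const_bound[where B=1]) auto
    have "ennreal (1 - symm_char t) = ennreal (expectation (\<lambda>\<omega>. 1 - cos (t * symm \<omega>)))"
      using i by (simp add: symm_char_eq_cos prob_space)
    also have "\<dots> = (\<integral>\<^sup>+\<omega>. ennreal (1 - cos (t * symm \<omega>)) \<partial>M)"
      using i by (intro nn_integral_eq_integral[symmetric]) auto
    also have "\<dots> \<le> (\<integral>\<^sup>+\<omega>. ennreal (2 * \<bar>t\<bar> powr \<gamma>) * ennreal (\<bar>symm \<omega>\<bar> powr \<gamma>) \<partial>M)"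
      using one_minus_cos_le[of \<gamma> "t * symm _"] \<gamma> \<alpha>_pos
      by (intro nn_integral_mono) (auto simp: ennreal_mult[symmetric] abs_mult powr_mult mult.assoc intro!: ennreal_leI)
    also have "\<dots> = ennreal (2 * \<bar>t\<bar> powr \<gamma> * d)"
      using d by (simp add: nn_integral_cmult ennreal_mult)
    finally show ?thesis using d by simp
  qed
  have "symm_char t = 1" for t
  proof -
    define C where "C = 2 * \<bar>t\<bar> powr \<gamma> * d"
    have C: "0 \<le> C" using d by (simp add: C_def)
    \<comment> \<open>The condition on \<open>k\<close> keeps the base of the power nonnegative, as
      Bernoulli's inequality and monotonicity of powers require.\<close>
    have bound: "1 - real k * (C * real k powr (- \<gamma> / \<alpha>)) \<le> symm_char t"
      if k: "1 \<le> k" "C * real k powr (- \<gamma> / \<alpha>) \<le> 1" for k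
    proof -
      let ?s = "real k powr (- 1 / \<alpha>) * t"
      have "2 * \<bar>?s\<bar> powr \<gamma> * d = C * real k powr (- \<gamma> / \<alpha>)"
        by (simp add: C_def abs_mult powr_mult powr_powr)
      then have l: "1 - C * real k powr (- \<gamma> / \<alpha>) \<le> symm_char ?s" using lower[of ?s] by simp
      have "1 - real k * (C * real k powr (- \<gamma> / \<alpha>)) \<le> (1 - C * real k powr (- \<gamma> / \<alpha>)) ^ k"
        using Bernoulli_inequality[of "- (C * real k powr (- \<gamma> / \<alpha>))" k] k by simp
      also have "\<dots> \<le> symm_char ?s ^ k" using l k by (intro power_mono) auto
      also have "\<dots> = symm_char (real k powr (1 / \<alpha>) * ?s)" using k by (simp add: symm_char_power)
      also have "real k powr (1 / \<alpha>) * ?s = t" using k by (simp add: mult.assoc[symmetric] powr_add[symmetric])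
      finally show ?thesis .
    qed
    have "(\<lambda>k. C * real k powr (- \<gamma> / \<alpha>)) \<longlonglongrightarrow> C * 0"
      using \<gamma> \<alpha>_pos by (intro tendsto_mult tendsto_const tendsto_neg_powr filterlim_real_sequentially) auto
    then have ev: "eventually (\<lambda>k. C * real k powr (- \<gamma> / \<alpha>) < 1) sequentially"
      by (intro order_tendstoD) auto
    have "(\<lambda>k. 1 - C * real k powr (1 - \<gamma> / \<alpha>)) \<longlonglongrightarrow> 1 - C * 0"
      using \<gamma> \<alpha>_pos by (intro tendsto_intros tendsto_neg_powr filterlim_real_sequentially) (auto simp: field_simps)
    moreover have "eventually (\<lambda>k. 1 - C * real k powr (1 - \<gamma> / \<alpha>) \<le> symm_char t) sequentially"
      using ev eventually_ge_at_top[of 1]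
    proof eventually_elim
      case (elim k)
      have "real k powr (1 - \<gamma> / \<alpha>) = real k powr 1 * real k powr (- \<gamma> / \<alpha>)"
        unfolding powr_add[symmetric] by simp
      also have "\<dots> = real k * real k powr (- \<gamma> / \<alpha>)" by simp
      finally have *: "real k * (C * real k powr (- \<gamma> / \<alpha>)) = C * real k powr (1 - \<gamma> / \<alpha>)"
        by (simp only: mult_ac)
      have "1 - real k * (C * real k powr (- \<gamma> / \<alpha>)) \<le> symm_char t"
        by (rule bound) (use elim in auto)
      then show ?case by (simp only: *)
    qed
    ultimately have "1 - C * 0 \<le> symm_char t" by (intro tendsto_upperbound) auto
    then show ?thesis using symm_char_bounds(2)[of t] by simp
  qed
  then show False using AE_const_of_symm_char nc by blast
qed

text \<open>In the variable \<open>s\<close>, the square of \<open>t\<close>, stability reads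
  \<open>symm_char (sqrt (k * s)) = symm_char (sqrt s) ^ k\<close>. The value at 1 thus determines
  all dyadic \<open>s\<close>, and continuity gives the rest.\<close>

lemma symm_char_gaussian:
  assumes \<alpha>: "\<alpha> = 2"
  obtains c where "0 \<le> c" "\<And>t. symm_char t = exp (- (c * t\<^sup>2))"
proof -
  have pw: "symm_char (sqrt (real k) * t) = symm_char t ^ k" if "1 \<le> k" for k t
    using symm_char_power[OF that, of t] by (simp add: \<alpha> powr_half_sqrt)
  let ?u = "\<lambda>n. sqrt (1 / 2 ^ n)"
  have u: "symm_char 1 = symm_char (?u n) ^ (2 ^ n)" for n
    using pw[of "2 ^ n" "?u n"] by (simp add: real_sqrt_mult[symmetric])
  \<comment> \<open>The value 0 has to be excluded at 1: near 0 the function is positive by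
    continuity, and its value at 1 is a power of such a value.\<close>
  have "(\<lambda>n. (1 / 2) ^ n) \<longlonglongrightarrow> (0::real)" by (rule LIMSEQ_realpow_zero) auto
  then have "?u \<longlonglongrightarrow> sqrt 0" by (intro tendsto_real_sqrt) (simp add: power_one_over)
  then have "(\<lambda>n. symm_char (?u n)) \<longlonglongrightarrow> symm_char 0"
    using isCont_tendsto_compose[OF isCont_symm_char, of ?u "sqrt 0"] by simp
  then have "eventually (\<lambda>n. symm_char (?u n) > 0) sequentially"
    using symm_char_bounds(3) by (intro order_tendstoD) auto
  then obtain n where "symm_char (?u n) > 0" by (auto simp: eventually_sequentially)
  then have pos: "symm_char 1 > 0" by (subst u[of n]) simp
  define c where "c = - ln (symm_char 1)"
  have c: "0 \<le> c" "symm_char 1 = exp (- c)" using pos symm_char_bounds(2)[of 1] by (auto simp: c_def)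
  have un: "symm_char (?u n) = exp (- (c / 2 ^ n))" for n
  proof -
    have "symm_char (?u n) ^ (2 ^ n) = exp (- (c / 2 ^ n)) ^ (2 ^ n)"
      unfolding u[symmetric] c(2) exp_of_nat_mult[symmetric] by simp
    then show ?thesis using symm_char_bounds(1) by (subst (asm) power_eq_iff_eq_base) auto
  qed
  have dy: "symm_char (sqrt (real k / 2 ^ n)) = exp (- (c * (real k / 2 ^ n)))" for k n
  proof (cases "k = 0")
    case False
    then have "symm_char (sqrt (real k / 2 ^ n)) = symm_char (?u n) ^ k"
      using pw[of k "?u n"] by (simp add: real_sqrt_mult[symmetric])
    then show ?thesis by (simp add: un exp_of_nat_mult[symmetric])
  qed (simp add: symm_char_bounds)
  have "symm_char (sqrt s) = exp (- (c * s))" if s: "0 \<le> s" for s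
  proof (rule LIMSEQ_unique)
    show "(\<lambda>n. symm_char (sqrt (dyadic_ceiling n s))) \<longlonglongrightarrow> symm_char (sqrt s)"
      by (intro isCont_tendsto_compose[OF isCont_symm_char] tendsto_real_sqrt tendsto_dyadic_ceiling s)
    have "(\<lambda>n. exp (- (c * dyadic_ceiling n s))) \<longlonglongrightarrow> exp (- (c * s))"
      by (intro tendsto_intros tendsto_dyadic_ceiling s)
    then show "(\<lambda>n. symm_char (sqrt (dyadic_ceiling n s))) \<longlonglongrightarrow> exp (- (c * s))"
      unfolding dyadic_ceiling_def dy .
  qed
  then have "symm_char \<bar>t\<bar> = exp (- (c * t\<^sup>2))" for t
    using real_sqrt_abs[of t] by (metis zero_le_power2)
  moreover have "symm_char t = symm_char \<bar>t\<bar>" for t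
    using symm_char_bounds(4)[of t] by (simp add: abs_if)
  ultimately show ?thesis using that[OF c(1)] by simp
qed

text \<open>By uniqueness the symmetrised step has the law of \<open>sqrt (2 * c)\<close> times a
  standard normal variable; the 2 compensates the 1/2 in the exponent of the normal characteristic
  function.\<close>

lemma symm_moment_finite:
  assumes \<alpha>: "\<alpha> = 2"
  shows "(\<integral>\<^sup>+\<omega>. ennreal (symm \<omega> ^ (2 * k)) \<partial>M) < top"
proof -
  obtain c where c: "0 \<le> c" "\<And>t. symm_char t = exp (- (c * t\<^sup>2))" using symm_char_gaussian[OF \<alpha>] by blast
  let ?N = "std_normal_distribution"
  interpret N: real_distribution ?N by (rule real_dist_normal_dist)
  have "char (distr M borel symm) = char (distr ?N borel (\<lambda>x. sqrt (2 * c) * x))"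
  proof
    fix t
    have "char (distr ?N borel (\<lambda>x. sqrt (2 * c) * x)) t = char (distr ?N borel (\<lambda>x. x)) (sqrt (2 * c) * t)"
      by (rule N.char_distr_scale) simp
    also have "distr ?N borel (\<lambda>x. x) = ?N" by (rule distr_id2) simp
    also have "char ?N (sqrt (2 * c) * t) = of_real (exp (- (c * t\<^sup>2)))"
      using c by (simp add: char_std_normal_distribution power_mult_distrib)
    finally show "char (distr M borel symm) t = char (distr ?N borel (\<lambda>x. sqrt (2 * c) * x)) t"
      by (simp add: char_symm c)
  qed
  then have eq: "distr M borel symm = distr ?N borel (\<lambda>x. sqrt (2 * c) * x)"
    by (intro Levy_uniqueness N.real_distribution_distr) auto
  have "(\<integral>\<^sup>+\<omega>. ennreal (symm \<omega> ^ (2 * k)) \<partial>M) = (\<integral>\<^sup>+x. ennreal (x ^ (2 * k)) \<partial>distr M borel symm)"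
    by (simp add: nn_integral_distr)
  also have "\<dots> = (\<integral>\<^sup>+x. ennreal ((sqrt (2 * c) * x) ^ (2 * k)) \<partial>?N)"
    unfolding eq by (subst nn_integral_distr) auto
  also have "\<dots> = ennreal (\<integral>x. (sqrt (2 * c) * x) ^ (2 * k) \<partial>?N)"
    using std_normal_distribution_even_moments(2)[of k]
    by (intro nn_integral_eq_integral) (auto simp: power_mult_distrib)
  finally show ?thesis by simp
qed

text \<open>Desymmetrisation: \<open>X 1\<close> is within \<open>b\<close> with probability at
  least 1/2, independently of \<open>X 0\<close>, and then |X 0| > x + b forces |symm| > x. Markov's
  inequality for an even moment does the rest.\<close>

lemma tail_power_bound:
  assumes \<alpha>: "\<alpha> = 2"
  obtains D a where "0 \<le> D" "0 < a" "\<And>x. a \<le> x \<Longrightarrow> tail \<mu> x \<le> D * x powr (- real (2 * k))"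
proof -
  have \<mu>: "prob_space \<mu>" "sets \<mu> = sets borel"
    using real_distribution_\<mu> unfolding real_distribution_def real_distribution_axioms_def by auto
  obtain b where b: "0 < b" "tail \<mu> b < 1 / 2" using ex_tail_less[OF \<mu>, of "1 / 2"] by auto
  obtain d where d: "(\<integral>\<^sup>+\<omega>. ennreal (symm \<omega> ^ (2 * k)) \<partial>M) = ennreal d" "0 \<le> d"
    using symm_moment_finite[OF \<alpha>, of k] by (cases "\<integral>\<^sup>+\<omega>. ennreal (symm \<omega> ^ (2 * k)) \<partial>M") auto
  have X1: "{\<omega>\<in>space M. \<bar>X 0 \<omega>\<bar> > x + b} \<inter> {\<omega>\<in>space M. \<not> \<bar>X 1 \<omega>\<bar> > b} \<subseteq> {\<omega>\<in>space M. \<bar>symm \<omega>\<bar> > x}" for x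
    by (auto simp: symm_def)
  have half: "tail \<mu> (x + b) \<le> 2 * prob {\<omega>\<in>space M. \<bar>symm \<omega>\<bar> > x}" for x
  proof -
    let ?f = "indicator {y :: nat \<Rightarrow> real. \<bar>y 0\<bar> > x + b} :: _ \<Rightarrow> ennreal"
    let ?g = "indicator {y :: nat \<Rightarrow> real. \<not> \<bar>y 0\<bar> > b} :: _ \<Rightarrow> ennreal"
    have [measurable]: "?f \<in> borel_measurable seq_borel" "?g \<in> borel_measurable seq_borel"
      by (rule borel_measurable_indicator', measurable)+
    have ind_emeasure: "(\<integral>\<^sup>+\<omega>. indicator {y. P (y 0)} (path \<omega>) \<partial>M) = emeasure M {\<omega>\<in>space M. P (X 0 \<omega>)}"
      if [measurable]: "Measurable.pred borel P" for P :: "real \<Rightarrow> bool"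
    proof -
      have "(\<integral>\<^sup>+\<omega>. indicator {y. P (y 0)} (path \<omega>) \<partial>M) = (\<integral>\<^sup>+\<omega>. indicator {\<omega>\<in>space M. P (X 0 \<omega>)} \<omega> \<partial>M)"
        by (intro nn_integral_cong) (simp add: indicator_def path_def)
      then show ?thesis by simp
    qed
    have "ennreal (1 / 2) * ennreal (tail \<mu> (x + b)) \<le> ennreal (prob {\<omega>\<in>space M. \<not> \<bar>X 0 \<omega>\<bar> > b}) * ennreal (prob {\<omega>\<in>space M. \<bar>X 0 \<omega>\<bar> > x + b})"
    proof (intro mult_mono ennreal_leI)
      have "prob {\<omega>\<in>space M. \<not> \<bar>X 0 \<omega>\<bar> > b} = 1 - prob {\<omega>\<in>space M. \<bar>X 0 \<omega>\<bar> > b}"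
        by (rule prob_neg) measurable
      then show "1 / 2 \<le> prob {\<omega>\<in>space M. \<not> \<bar>X 0 \<omega>\<bar> > b}" using b(2) by (simp add: tail_eq_prob)
    qed (auto simp: tail_eq_prob)
    also have "\<dots> = (\<integral>\<^sup>+\<omega>. ?f (path \<omega>) \<partial>M) * (\<integral>\<^sup>+\<omega>. ?g (path \<omega>) \<partial>M)"
      by (subst (1 2) ind_emeasure) (auto simp: emeasure_eq_measure mult.commute)
    also have "\<dots> = (\<integral>\<^sup>+\<omega>. ?f (trunc 1 (path \<omega>)) * ?g (shift 1 (path \<omega>)) \<partial>M)"
      using nn_integral_past_future[of ?f ?g 1] by (simp add: trunc_def indicator_def)
    also have "\<dots> \<le> (\<integral>\<^sup>+\<omega>. indicator {\<omega>\<in>space M. \<bar>symm \<omega>\<bar> > x} \<omega> \<partial>M)"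
      using X1[of x] by (intro nn_integral_mono) (auto simp: indicator_def trunc_def shift_def path_def)
    also have "\<dots> = ennreal (prob {\<omega>\<in>space M. \<bar>symm \<omega>\<bar> > x})" by (simp add: emeasure_eq_measure)
    finally have "ennreal (1 / 2 * tail \<mu> (x + b)) \<le> ennreal (prob {\<omega>\<in>space M. \<bar>symm \<omega>\<bar> > x})"
      using tail_nonneg by (subst ennreal_mult) auto
    then show ?thesis by simp
  qed
  have markov: "prob {\<omega>\<in>space M. \<bar>symm \<omega>\<bar> > x} \<le> d * x powr (- real (2 * k))" if x: "0 < x" for x
  proof -
    have "ennreal (x ^ (2 * k)) * emeasure M {\<omega>\<in>space M. \<bar>symm \<omega>\<bar> > x}
      = (\<integral>\<^sup>+\<omega>. ennreal (x ^ (2 * k)) * indicator {\<omega>\<in>space M. \<bar>symm \<omega>\<bar> > x} \<omega> \<partial>M)"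
      by (subst nn_integral_cmult_indicator) auto
    also have "\<dots> \<le> (\<integral>\<^sup>+\<omega>. ennreal (symm \<omega> ^ (2 * k)) \<partial>M)"
    proof (intro nn_integral_mono)
      fix \<omega>
      have "x ^ (2 * k) \<le> symm \<omega> ^ (2 * k)" if "\<bar>symm \<omega>\<bar> > x"
        using power_mono[of x "\<bar>symm \<omega>\<bar>" "2 * k"] that x by (simp add: power_even_abs)
      then show "ennreal (x ^ (2 * k)) * indicator {\<omega>\<in>space M. \<bar>symm \<omega>\<bar> > x} \<omega> \<le> ennreal (symm \<omega> ^ (2 * k))"
        by (auto simp: indicator_def intro!: ennreal_leI)
    qed
    finally have "x ^ (2 * k) * prob {\<omega>\<in>space M. \<bar>symm \<omega>\<bar> > x} \<le> d"
      using x d by (simp add: emeasure_eq_measure ennreal_mult[symmetric])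
    then show ?thesis using x by (simp add: powr_minus powr_realpow[symmetric] field_simps)
  qed
  show ?thesis
  proof (rule that[of "2 * d * 2 powr real (2 * k)" "2 * b"])
    fix x assume x: "2 * b \<le> x"
    \<comment> \<open>Starting at \<open>2 * b\<close> absorbs the shift by \<open>b\<close> into
      half of \<open>x\<close>.\<close>
    have "tail \<mu> x \<le> tail \<mu> (x / 2 + b)" using x by (intro tail_antimono \<mu>) auto
    also have "\<dots> \<le> 2 * (d * (x / 2) powr (- real (2 * k)))"
      using half[of "x / 2"] markov[of "x / 2"] x b by simp
    also have "\<dots> = 2 * d * 2 powr real (2 * k) * x powr (- real (2 * k))"
      using x b by (simp add: powr_divide powr_minus_divide)
    finally show "tail \<mu> x \<le> 2 * d * 2 powr real (2 * k) * x powr (- real (2 * k))" .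
  qed (use b d in auto)
qed

text \<open>If \<open>N\<close> independent steps all exceed \<epsilon> in direction \<sigma>, their
  sum exceeds \<open>N * \<epsilon>\<close>, and stability transfers this to one step. For \<alpha>
  = 2 it shows that the step is unbounded.\<close>

lemma prob_psum_positive:
  assumes \<sigma>: "\<sigma> = 1 \<or> \<sigma> = -1" and pos: "prob {\<omega>\<in>space M. \<sigma> * X 0 \<omega> > \<epsilon>} > 0" and "1 \<le> N"
  shows "prob {\<omega>\<in>space M. \<sigma> * (real N powr (1 / \<alpha>) * X 0 \<omega>) > real N * \<epsilon>} > 0"
proof -
  let ?h = "indicator {x :: nat \<Rightarrow> real. \<sigma> * x 0 > \<epsilon>} :: _ \<Rightarrow> ennreal"
  have [measurable]: "?h \<in> borel_measurable seq_borel"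
    by (rule borel_measurable_indicator') measurable
  have "(\<integral>\<^sup>+\<omega>. ?h (trunc 1 (path \<omega>)) \<partial>M) = (\<integral>\<^sup>+\<omega>. indicator {\<omega>\<in>space M. \<sigma> * X 0 \<omega> > \<epsilon>} \<omega> \<partial>M)"
    by (intro nn_integral_cong) (simp add: indicator_def trunc_def path_def)
  then have h: "(\<integral>\<^sup>+\<omega>. ?h (trunc 1 (path \<omega>)) \<partial>M) = ennreal (prob {\<omega>\<in>space M. \<sigma> * X 0 \<omega> > \<epsilon>})"
    by (simp add: emeasure_eq_measure)
  have "0 < (\<integral>\<^sup>+\<omega>. (\<Prod>j<N. ?h (trunc 1 (shift (j * 1) (path \<omega>)))) \<partial>M)"
    unfolding nn_integral_prod_blocks[OF \<open>?h \<in> borel_measurable seq_borel\<close>] h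
    using pos by (simp add: ennreal_power)
  also have "\<dots> \<le> (\<integral>\<^sup>+\<omega>. indicator {\<omega>\<in>space M. \<sigma> * psum (path \<omega>) N > real N * \<epsilon>} \<omega> \<partial>M)"
  proof (intro nn_integral_mono)
    fix \<omega> assume \<omega>: "\<omega> \<in> space M"
    show "(\<Prod>j<N. ?h (trunc 1 (shift (j * 1) (path \<omega>)))) \<le> indicator {\<omega>\<in>space M. \<sigma> * psum (path \<omega>) N > real N * \<epsilon>} \<omega>"
    proof (cases "\<forall>j<N. \<sigma> * X j \<omega> > \<epsilon>")
      case True
      then have "(\<Sum>j<N. \<epsilon>) < (\<Sum>j<N. \<sigma> * X j \<omega>)"
        using \<open>1 \<le> N\<close> by (intro sum_strict_mono) (auto simp: lessThan_empty_iff)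
      then have "\<sigma> * psum (path \<omega>) N > real N * \<epsilon>" by (simp add: psum_def path_def sum_distrib_left)
      then show ?thesis using \<omega> True by (auto simp: trunc_def shift_def path_def intro!: prod_le_1)
    next
      case False
      then obtain j where "j < N" "\<not> \<sigma> * X j \<omega> > \<epsilon>" by auto
      then have h0: "(\<Prod>j<N. ?h (trunc 1 (shift (j * 1) (path \<omega>)))) = 0"
        by (intro prod_zero) (auto simp: trunc_def shift_def path_def intro!: bexI[of _ j])
      show ?thesis unfolding h0 by simp
    qed
  qed
  also have "\<dots> = ennreal (prob {\<omega>\<in>space M. \<sigma> * psum (path \<omega>) N > real N * \<epsilon>})"
    by (subst nn_integral_indicator) (auto simp: emeasure_eq_measure)
  also have "prob {\<omega>\<in>space M. \<sigma> * psum (path \<omega>) N > real N * \<epsilon>} = prob {\<omega>\<in>space M. \<sigma> * (real N powr (1 / \<alpha>) * X 0 \<omega>) > real N * \<epsilon>}"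
    using \<open>1 \<le> N\<close> by (intro prob_psum) auto
  finally show ?thesis by simp
qed

end

section \<open>The index of a stable variation\<close>

text \<open>A tail of order \<open>x powr (- a)\<close>, tested along a geometric sequence, gives
  the moments of order below \<open>a\<close>. The layers are taken with \<open>a\<close> in place
  of \<alpha> and with \<open>R = 1\<close>: the low coefficients alone are summable, and the high
  ones meet the tail in a series of ratio \<open>2 powr (\<gamma> / a - 1)\<close>.\<close>

lemma (in stable_walk) moment_finite_of_tail:
  assumes \<gamma>: "0 < \<gamma>" "\<gamma> < a" and C: "0 \<le> C" "\<And>l. tail \<mu> (2 powr (real l / a)) \<le> C / 2 ^ l"
  shows "(\<integral>\<^sup>+\<omega>. ennreal (\<bar>X 0 \<omega>\<bar> powr \<gamma>) \<partial>M) < top"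
proof -
  have a: "0 < a" using \<gamma> by simp
  let ?L = "\<lambda>\<omega>. (\<Sum>l. low_coeff a \<gamma> 1 l * exceed (1 * 2 powr (- real (Suc l) / a)) (X 0 \<omega>))"
  let ?H = "\<lambda>\<omega>. (\<Sum>l. high_coeff a \<gamma> 1 l * exceed (1 * 2 powr (real l / a)) (X 0 \<omega>))"
  have r1: "2 powr (- \<gamma> / a) < (1::real)" using \<gamma> a powr_less_mono[of "- \<gamma> / a" 0 2] by simp
  have r2: "2 powr (\<gamma> / a - 1) < (1::real)" using \<gamma> a powr_less_mono[of "\<gamma> / a - 1" 0 2] by simp
  have "(\<integral>\<^sup>+\<omega>. ?L \<omega> \<partial>M) \<le> (\<integral>\<^sup>+\<omega>. (\<Sum>l. low_coeff a \<gamma> 1 l) \<partial>M)"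
    by (intro nn_integral_mono suminf_le mult_left_le exceed_le_1) auto
  also have "\<dots> = (\<Sum>l. ennreal ((2 powr (- \<gamma> / a)) ^ l))"
    by (simp add: emeasure_space_1 low_coeff_def powr_powr powr_realpow[symmetric] mult_ac)
  also have "\<dots> < top"
    using r1 by (subst less_top[symmetric], intro ennreal_suminf_neq_top summable_geometric) auto
  finally have L: "(\<integral>\<^sup>+\<omega>. ?L \<omega> \<partial>M) < top" .
  have ex: "(\<integral>\<^sup>+\<omega>. exceed (1 * 2 powr (real l / a)) (X 0 \<omega>) \<partial>M) \<le> ennreal (C / 2 ^ l)" for l
  proof -
    have "(\<integral>\<^sup>+\<omega>. exceed (1 * 2 powr (real l / a)) (X 0 \<omega>) \<partial>M)
      = (\<integral>\<^sup>+\<omega>. indicator {\<omega>\<in>space M. \<bar>X 0 \<omega>\<bar> > 2 powr (real l / a)} \<omega> \<partial>M)"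
      by (intro nn_integral_cong) (simp add: exceed_def indicator_def)
    also have "\<dots> = ennreal (tail \<mu> (2 powr (real l / a)))"
      by (simp add: tail_eq_prob emeasure_eq_measure)
    finally show ?thesis using C(2)[of l] by (simp add: ennreal_leI)
  qed
  have "(\<integral>\<^sup>+\<omega>. ?H \<omega> \<partial>M) = (\<Sum>l. high_coeff a \<gamma> 1 l * (\<integral>\<^sup>+\<omega>. exceed (1 * 2 powr (real l / a)) (X 0 \<omega>) \<partial>M))"
    by (subst nn_integral_suminf, measurable) (subst nn_integral_cmult, measurable)
  also have "\<dots> \<le> (\<Sum>l. high_coeff a \<gamma> 1 l * ennreal (C / 2 ^ l))"
    by (intro suminf_le mult_left_mono ex) auto
  also have "\<dots> = (\<Sum>l. ennreal (2 powr (\<gamma> / a) * C * (2 powr (\<gamma> / a - 1)) ^ l))"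
  proof (intro suminf_cong)
    fix l
    have "high_coeff a \<gamma> 1 l * ennreal (C / 2 ^ l) = ennreal (2 powr (real (Suc l) / a * \<gamma>) * (C / 2 powr real l))"
      using C(1) by (simp add: high_coeff_def ennreal_mult[symmetric] powr_powr powr_realpow)
    also have "2 powr (real (Suc l) / a * \<gamma>) = 2 powr (\<gamma> / a) * 2 powr (real l * (\<gamma> / a))"
    proof -
      have "real (Suc l) / a * \<gamma> = \<gamma> / a + real l * (\<gamma> / a)"
        by (simp add: add_divide_distrib distrib_right)
      then show ?thesis by (simp only: powr_add)
    qed
    also have "2 powr (\<gamma> / a) * 2 powr (real l * (\<gamma> / a)) * (C / 2 powr real l)
       = 2 powr (\<gamma> / a) * C * (2 powr (\<gamma> / a - 1)) ^ l"
    proof -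
      have "(2 powr (\<gamma> / a - 1)) ^ l = 2 powr (real l * (\<gamma> / a)) / 2 powr real l"
        unfolding powr_diff[symmetric] by (simp add: powr_realpow[symmetric] powr_powr algebra_simps)
      then show ?thesis by simp
    qed
    finally show "high_coeff a \<gamma> 1 l * ennreal (C / 2 ^ l) = ennreal (2 powr (\<gamma> / a) * C * (2 powr (\<gamma> / a - 1)) ^ l)" .
  qed
  also have "\<dots> < top"
    using r2 C(1) by (subst less_top[symmetric], intro ennreal_suminf_neq_top summable_mult summable_geometric) auto
  finally have H: "(\<integral>\<^sup>+\<omega>. ?H \<omega> \<partial>M) < top" .
  have "(\<integral>\<^sup>+\<omega>. ennreal (\<bar>X 0 \<omega>\<bar> powr \<gamma>) \<partial>M) \<le> (\<integral>\<^sup>+\<omega>. ?L \<omega> + ?H \<omega> \<partial>M)"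
    using pow_weight_le_layers[OF \<gamma>(1) a, of 1] by (intro nn_integral_mono) (simp add: pow_weight_def)
  also have "\<dots> = (\<integral>\<^sup>+\<omega>. ?L \<omega> \<partial>M) + (\<integral>\<^sup>+\<omega>. ?H \<omega> \<partial>M)"
    by (rule nn_integral_add) measurable
  also have "\<dots> < top" using L H by simp
  finally show ?thesis .
qed

context strictly_stable_process
begin

lemma step_0: "step 0 0 \<omega> = Z 1 \<omega> - Z 0 \<omega>"
  by (simp add: step_def)

lemma step_not_constant: "\<not> (AE \<omega> in M. step 0 0 \<omega> = b)"
proof
  assume "AE \<omega> in M. step 0 0 \<omega> = b"
  then have "AE \<omega> in M. Z 1 \<omega> = b" using Z_zero by eventually_elim (simp add: step_0)
  then show False using Z_1_not_constant by blast
qed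

lemma lap_positive:
  assumes "\<alpha> < p"
  shows "0 < lap p c"
proof (rule ccontr)
  assume "\<not> 0 < lap p c"
  then have "(\<integral>\<^sup>+\<omega>. expneg (ennreal c * pvar p \<omega>) \<partial>M) = 0" by (simp add: lap_def)
  then have "AE \<omega> in M. expneg (ennreal c * pvar p \<omega>) = 0"
    by (subst (asm) nn_integral_0_iff_AE) auto
  then have "AE \<omega> in M. False"
    using AE_pvar_finite[OF assms]
  proof eventually_elim
    case (elim \<omega>)
    then have "ennreal c * pvar p \<omega> < top" by (simp add: ennreal_mult_less_top)
    then show ?case using elim by (auto simp: expneg_def ennreal_eq_0_iff split: if_splits)
  qed
  then show False by simp
qed

text \<open>By stability \<open>lap p (n powr (- 1 / \<beta>))\<close> is the n-th root of
  \<open>lap p 1\<close>, so it differs from 1 by O(1/n), and so does the probability that the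
  variation exceeds \<open>n powr (1 / \<beta>)\<close> differ from 0. The unit increment then has a
  tail of order \<open>\<beta> * p\<close>, which exceeds \<alpha> if the claim fails.\<close>

lemma index_le_of_stable:
  assumes p: "\<alpha> < p" and \<alpha>: "\<alpha> < 2" and \<beta>: "0 < \<beta>"
    and st: "\<And>n c. 1 \<le> n \<Longrightarrow> 0 \<le> c \<Longrightarrow> lap p c ^ n = lap p (c * real n powr (1 / \<beta>))"
  shows "\<beta> \<le> \<alpha> / p"
proof (rule ccontr)
  assume "\<not> \<beta> \<le> \<alpha> / p"
  then have \<beta>p: "\<alpha> < \<beta> * p" using p index_pos by (simp add: field_simps)
  obtain l where l: "lap p 1 = ennreal l" "0 < l" "l \<le> 1"
  proof -
    obtain l where "lap p 1 = ennreal l" "0 \<le> l" using lap_le_1[of p 1] by (cases "lap p 1") (auto simp: top_unique)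
    then show ?thesis using that[of l] lap_positive[OF p, of 1] lap_le_1[of p 1] by auto
  qed
  \<comment> \<open>The numerator comes from the lower bound \<open>1 + ln l / n\<close> for the
    n-th root of \<open>l\<close>, the denominator from \<open>1 - exp (- x)\<close> being at least
    \<open>1 - exp (- 1)\<close> for x \<ge> 1.\<close>
  define C where "C = - ln l / (1 - exp (- 1))"
  have e1: "0 < 1 - exp (- 1 :: real)" by simp
  have "0 \<le> - ln l" using l by simp
  then have C: "0 \<le> C" unfolding C_def using e1 by (intro divide_nonneg_pos)
  have pv: "prob {\<omega>\<in>space M. pvar p \<omega> > ennreal (real n powr (1 / \<beta>))} \<le> C / real n" if n: "1 \<le> n" for n
  proof -
    let ?c = "real n powr (- 1 / \<beta>)"
    let ?A = "{\<omega>\<in>space M. pvar p \<omega> > ennreal (real n powr (1 / \<beta>))}"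
    have cn: "?c * real n powr (1 / \<beta>) = 1" using n by (simp add: powr_add[symmetric])
    obtain y where y: "lap p ?c = ennreal y" "0 \<le> y"
      using lap_le_1[of p ?c] by (cases "lap p ?c") (auto simp: top_unique)
    have "ennreal (y ^ n) = ennreal l"
      using st[OF n, of ?c] unfolding cn y(1) l(1) ennreal_power[OF y(2)] by simp
    then have "y ^ n = l" using y l by simp
    also have "l = exp (ln l / real n) ^ n" using l n by (simp add: exp_of_nat_mult[symmetric])
    finally have "y = exp (ln l / real n)"
      using y n by (subst (asm) power_eq_iff_eq_base) auto
    then have y_ge: "1 + ln l / real n \<le> y" using exp_ge_add_one_self[of "ln l / real n"] by simp
    have "ennreal y + ennreal (1 - exp (- 1)) * emeasure M ?A
      = (\<integral>\<^sup>+\<omega>. expneg (ennreal ?c * pvar p \<omega>) + ennreal (1 - exp (- 1)) * indicator ?A \<omega> \<partial>M)"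
      by (subst nn_integral_add) (auto simp: y(1)[symmetric] lap_def nn_integral_cmult_indicator)
    also have "\<dots> \<le> (\<integral>\<^sup>+\<omega>. 1 \<partial>M)"
    proof (intro nn_integral_mono)
      fix \<omega>
      show "expneg (ennreal ?c * pvar p \<omega>) + ennreal (1 - exp (- 1)) * indicator ?A \<omega> \<le> 1"
      proof (cases "\<omega> \<in> ?A")
        case True
        then have "ennreal ?c * ennreal (real n powr (1 / \<beta>)) \<le> ennreal ?c * pvar p \<omega>"
          by (intro mult_left_mono) auto
        then have "ennreal 1 \<le> ennreal ?c * pvar p \<omega>" by (simp only: ennreal_mult[symmetric] powr_ge_zero cn)
        then have "expneg (ennreal ?c * pvar p \<omega>) \<le> ennreal (exp (- 1))"
          using expneg_antimono expneg_ennreal[of 1] by fastforce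
        then have "expneg (ennreal ?c * pvar p \<omega>) + ennreal (1 - exp (- 1)) \<le> ennreal (exp (- 1)) + ennreal (1 - exp (- 1))"
          by (rule add_right_mono)
        also have "\<dots> = 1" by (simp add: ennreal_plus[symmetric] del: ennreal_plus)
        finally show ?thesis using True by simp
      qed (simp add: expneg_le_1)
    qed
    also have "\<dots> = ennreal 1" by (simp add: emeasure_space_1)
    finally have "y + (1 - exp (- 1)) * prob ?A \<le> 1"
      using y by (simp add: emeasure_eq_measure ennreal_mult[symmetric] ennreal_plus[symmetric] del: ennreal_plus ennreal_1)
    then have "(1 - exp (- 1)) * prob ?A \<le> - ln l / real n" using y_ge by simp
    then have "prob ?A \<le> (- ln l / real n) / (1 - exp (- 1))"
      using e1 by (simp only: pos_le_divide_eq mult.commute)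
    also have "\<dots> = C / real n" by (simp add: C_def)
    finally show ?thesis .
  qed
  have tl: "tail \<mu> (2 powr (real i / (\<beta> * p))) \<le> C / 2 ^ i" for i
  proof -
    have "tail \<mu> (2 powr (real i / (\<beta> * p))) = prob {\<omega>\<in>space M. \<bar>step 0 0 \<omega>\<bar> > 2 powr (real i / (\<beta> * p))}"
      by (rule walk.tail_eq_prob)
    also have "\<dots> \<le> prob {\<omega>\<in>space M. pvar p \<omega> > ennreal (real (2 ^ i) powr (1 / \<beta>))}"
    proof (rule finite_measure_mono)
      show "{\<omega>\<in>space M. \<bar>step 0 0 \<omega>\<bar> > 2 powr (real i / (\<beta> * p))} \<subseteq> {\<omega>\<in>space M. pvar p \<omega> > ennreal (real (2 ^ i) powr (1 / \<beta>))}"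
      proof safe
        fix \<omega> assume "2 powr (real i / (\<beta> * p)) < \<bar>step 0 0 \<omega>\<bar>"
        then have "(2 powr (real i / (\<beta> * p))) powr p < \<bar>step 0 0 \<omega>\<bar> powr p"
          using p index_pos by (intro powr_less_mono2) auto
        also have "(2 powr (real i / (\<beta> * p))) powr p = real (2 ^ i) powr (1 / \<beta>)"
          using p index_pos by (simp add: powr_powr powr_realpow[symmetric])
        finally have "ennreal (real (2 ^ i) powr (1 / \<beta>)) < ennreal (\<bar>step 0 0 \<omega>\<bar> powr p)"
          by (intro ennreal_lessI) auto
        then show "ennreal (real (2 ^ i) powr (1 / \<beta>)) < pvar p \<omega>"
          using pvar_ge_increment[of \<omega> p] by (simp add: step_0)
      qed
    qed measurable
    also have "\<dots> \<le> C / 2 ^ i" using pv[of "2 ^ i"] by simp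
    finally show ?thesis .
  qed
  \<comment> \<open>Above \<alpha> for the moment to be infinite, below \<open>\<beta> * p\<close>
    for it to be finite, and below 2 for the bound on the cosine; \<alpha> < 2 leaves room.\<close>
  obtain \<gamma> where \<gamma>: "\<alpha> < \<gamma>" "\<gamma> < min 2 (\<beta> * p)" using dense[of \<alpha> "min 2 (\<beta> * p)"] \<alpha> \<beta>p by auto
  have "(\<integral>\<^sup>+\<omega>. ennreal (\<bar>step 0 0 \<omega>\<bar> powr \<gamma>) \<partial>M) < top"
    using \<gamma> index_pos by (intro walk.moment_finite_of_tail[OF _ _ C tl]) auto
  moreover have "(\<integral>\<^sup>+\<omega>. ennreal (\<bar>step 0 0 \<omega>\<bar> powr \<gamma>) \<partial>M) = top"
    using \<gamma> step_not_constant by (intro walk.moment_infinite) auto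
  ultimately show False by simp
qed

text \<open>High layers have coefficients of order \<open>2 powr (l * p / 2)\<close>, while the tail
  bound of order \<open>2 * k\<close> contributes \<open>2 powr (- l * k)\<close>; with p < k the
  series converges.\<close>

lemma nn_integral_pvar_finite:
  assumes \<alpha>: "\<alpha> = 2" and p: "2 < p"
  shows "(\<integral>\<^sup>+\<omega>. pvar p \<omega> \<partial>M) < top"
proof -
  obtain k :: nat where k: "p < real k" using reals_Archimedean2 by blast
  obtain D a where D: "0 \<le> D" "0 < a" "\<And>x. a \<le> x \<Longrightarrow> tail \<mu> x \<le> D * x powr (- real (2 * k))"
    using walk.tail_power_bound[OF \<alpha>, of k] by blast
  obtain \<rho>0 where \<rho>0: "0 < \<rho>0" "tail \<mu> \<rho>0 < 1 / 3"
    using ex_tail_less[OF prob_space_\<mu> sets_\<mu>, of "1 / 3"] by auto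
  \<comment> \<open>\<open>\<rho>0\<close> provides the smallness that the counting bounds require,
    \<open>a\<close> the range of the tail bound.\<close>
  define \<rho> where "\<rho> = max \<rho>0 a"
  have \<rho>: "0 < \<rho>" "a \<le> \<rho>" using D by (auto simp: \<rho>_def)
  have ge: "\<rho> \<le> \<rho> * 2 powr (real l / \<alpha>)" for l
    using \<rho> index_pos ge_one_powr_ge_zero[of 2 "real l / \<alpha>"] by simp
  have small: "tail \<mu> (\<rho> * 2 powr (real l / \<alpha>)) \<le> 1 / 3" for l
    using tail_antimono[OF prob_space_\<mu> sets_\<mu>, of \<rho>0 "\<rho> * 2 powr (real l / \<alpha>)"] ge[of l] \<rho>0 by (simp add: \<rho>_def)
  have small0: "tail \<mu> \<rho> \<le> 1 / 3"
    using tail_antimono[OF prob_space_\<mu> sets_\<mu>, of \<rho>0 \<rho>] \<rho>0 by (simp add: \<rho>_def)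
  define r where "r = 2 powr ((p - real (2 * k)) / 2)"
  define B where "B = (4 * \<rho>) powr p * 2 powr (p / 2) * (3 * D) * \<rho> powr (- real (2 * k))"
  let ?S = "\<Sum>l. high_coeff \<alpha> p (4 * \<rho>) l * ennreal (3 * tail \<mu> (\<rho> * 2 powr (real l / \<alpha>)))"
  have "?S \<le> (\<Sum>l. ennreal (B * r ^ l))"
  proof (intro suminf_le)
    fix l
    have "3 * tail \<mu> (\<rho> * 2 powr (real l / \<alpha>)) \<le> 3 * (D * (\<rho> * 2 powr (real l / \<alpha>)) powr (- real (2 * k)))"
      using D(3)[of "\<rho> * 2 powr (real l / \<alpha>)"] ge[of l] \<rho> by simp
    then have "high_coeff \<alpha> p (4 * \<rho>) l * ennreal (3 * tail \<mu> (\<rho> * 2 powr (real l / \<alpha>)))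
      \<le> ennreal ((4 * \<rho> * 2 powr (real (Suc l) / \<alpha>)) powr p) * ennreal (3 * (D * (\<rho> * 2 powr (real l / \<alpha>)) powr (- real (2 * k))))"
      unfolding high_coeff_def by (intro mult_left_mono ennreal_leI) auto
    also have "\<dots> = ennreal ((4 * \<rho> * 2 powr (real (Suc l) / \<alpha>)) powr p * (3 * (D * (\<rho> * 2 powr (real l / \<alpha>)) powr (- real (2 * k)))))"
      using D by (simp add: ennreal_mult)
    also have "(4 * \<rho> * 2 powr (real (Suc l) / \<alpha>)) powr p = (4 * \<rho>) powr p * 2 powr (p / 2) * 2 powr (real l / 2 * p)"
    proof -
      have "real (Suc l) / 2 * p = p / 2 + real l / 2 * p"
        by (simp add: add_divide_distrib distrib_right)
      then show ?thesis by (simp only: \<alpha> powr_mult powr_powr powr_add mult.assoc)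
    qed
    also have "(\<rho> * 2 powr (real l / \<alpha>)) powr (- real (2 * k)) = \<rho> powr (- real (2 * k)) * 2 powr (real l / 2 * (- real (2 * k)))"
      using \<rho> by (simp only: \<alpha> powr_mult powr_powr)
    also have "(4 * \<rho>) powr p * 2 powr (p / 2) * 2 powr (real l / 2 * p) * (3 * (D * (\<rho> powr (- real (2 * k)) * 2 powr (real l / 2 * (- real (2 * k))))))
      = B * (2 powr (real l / 2 * p) * 2 powr (real l / 2 * (- real (2 * k))))"
      by (simp only: B_def mult_ac)
    also have "2 powr (real l / 2 * p) * 2 powr (real l / 2 * (- real (2 * k))) = r ^ l"
    proof -
      have "r ^ l = 2 powr ((p - real (2 * k)) / 2 * real l)"
        unfolding r_def by (simp only: powr_powr powr_realpow[symmetric] powr_gt_zero zero_less_numeral simp_thms)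
      also have "(p - real (2 * k)) / 2 * real l = real l / 2 * p + real l / 2 * (- real (2 * k))"
        by (simp add: algebra_simps diff_divide_distrib)
      finally show ?thesis by (simp only: powr_add)
    qed
    finally show "high_coeff \<alpha> p (4 * \<rho>) l * ennreal (3 * tail \<mu> (\<rho> * 2 powr (real l / \<alpha>))) \<le> ennreal (B * r ^ l)" .
  qed auto
  also have "\<dots> < top"
  proof -
    have "r < 2 powr 0" unfolding r_def using k p by (intro powr_less_mono) auto
    moreover have "0 \<le> r" "0 \<le> B" using D by (auto simp: r_def B_def)
    ultimately show ?thesis
      by (subst less_top[symmetric], intro ennreal_suminf_neq_top summable_mult summable_geometric) auto
  qed
  finally have S: "?S < top" .
  have "(\<integral>\<^sup>+\<omega>. pvar p \<omega> \<partial>M) = (SUP n. \<integral>\<^sup>+\<omega>. dvar p n \<omega> \<partial>M)"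
    unfolding pvar_def
    by (rule nn_integral_monotone_convergence_SUP) (use incseq_dvar[of p] in \<open>auto simp: incseq_def le_fun_def\<close>)
  also have "\<dots> \<le> low_bound \<alpha> p (4 * \<rho>) + ?S"
    unfolding dvar_def using p \<rho> small small0
    by (intro SUP_least walk.nn_integral_grid_var_le) auto
  also have "\<dots> < top"
    using S low_bound_finite[OF index_pos, of p "4 * \<rho>"] p \<rho> \<alpha> by simp
  finally show ?thesis .
qed

lemma variation_power_not_stable_gaussian:
  assumes \<alpha>: "\<alpha> = 2" and p: "2 < p" and X [measurable]: "variation_power p Z \<in> borel_measurable M" and "0 < \<beta>"
    and st: "\<And>n::nat. n \<ge> 1 \<Longrightarrow> distr (Pi\<^sub>M {..<n} (\<lambda>_. distr M borel (variation_power p Z))) borel (\<lambda>x. \<Sum>i<n. x i) =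
           distr M borel (\<lambda>\<omega>. real n powr (1 / \<beta>) * variation_power p Z \<omega>)"
  shows False
proof -
  let ?V = "variation_power p Z"
  have V0: "0 \<le> ?V \<omega>" for \<omega> by (simp add: variation_power_def)
  have ap: "\<alpha> < p" using \<alpha> p by simp
  have VZ: "AE \<omega> in M. \<bar>Z 1 \<omega> - Z 0 \<omega>\<bar> powr p \<le> ?V \<omega> \<and> ennreal (?V \<omega>) = pvar p \<omega>"
    using AE_pvar_finite[OF ap] AE_space
  proof eventually_elim
    case (elim \<omega>)
    then obtain v where v: "pvar p \<omega> = ennreal v" "0 \<le> v" by (cases "pvar p \<omega>") auto
    then show ?case using elim(2) p pvar_ge_increment[of \<omega> p] by (simp add: variation_power_eq)
  qed
  obtain \<sigma> \<epsilon> K :: real where \<sigma>: "\<sigma> = 1 \<or> \<sigma> = -1" and \<epsilon>: "0 < \<epsilon>" and "0 \<le> K"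
    and pos: "emeasure M {\<omega>\<in>space M. \<sigma> * (Z 1 \<omega> - Z 0 \<omega>) > \<epsilon> \<and> pvar p \<omega> \<le> ennreal K} > 0"
    using ex_sign_and_level[OF ap] .
  have step_pos: "prob {\<omega>\<in>space M. \<sigma> * step 0 0 \<omega> > \<epsilon>} > 0"
  proof -
    have "0 < emeasure M {\<omega>\<in>space M. \<sigma> * step 0 0 \<omega> > \<epsilon>}"
      using pos by (rule less_le_trans) (auto simp: step_0 intro!: emeasure_mono)
    then show ?thesis by (simp add: emeasure_eq_measure)
  qed
  \<comment> \<open>Unboundedness comes from the increment over [0, 1], which exceeds
    \<open>sqrt N * \<epsilon>\<close> in size with positive probability for every
    \<open>N\<close>.\<close>
  have large: "prob {\<omega>\<in>space M. ?V \<omega> > v} > 0" for v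
  proof -
    \<comment> \<open>Chosen so that \<open>u powr p\<close> is \<open>\<bar>v\<bar> + 1\<close>,
      beyond \<open>v\<close> whatever its sign.\<close>
    define u where "u = (\<bar>v\<bar> + 1) powr (1 / p)"
    obtain N :: nat where N: "(u / \<epsilon>)\<^sup>2 < real N" using reals_Archimedean2 by blast
    have N1: "1 \<le> N" using N by (cases N) (auto simp: not_less)
    have "u / \<epsilon> \<le> sqrt (real N)" using N \<epsilon> by (intro real_le_rsqrt) auto
    then have u: "u * sqrt (real N) \<le> real N * \<epsilon>"
      using \<epsilon> N1 mult_right_mono[of "u / \<epsilon>" "sqrt (real N)" "sqrt (real N) * \<epsilon>"] by (simp add: field_simps)
    have "0 < prob {\<omega>\<in>space M. \<sigma> * (real N powr (1 / \<alpha>) * step 0 0 \<omega>) > real N * \<epsilon>}"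
      by (rule walk.prob_psum_positive[OF \<sigma> step_pos N1])
    also have "\<dots> \<le> prob {\<omega>\<in>space M. ?V \<omega> > v}"
    proof (rule finite_measure_mono_AE)
      show "AE \<omega> in M. \<omega> \<in> {\<omega>\<in>space M. \<sigma> * (real N powr (1 / \<alpha>) * step 0 0 \<omega>) > real N * \<epsilon>} \<longrightarrow> \<omega> \<in> {\<omega>\<in>space M. ?V \<omega> > v}"
        using VZ
      proof eventually_elim
        case (elim \<omega>)
        show ?case
        proof safe
          assume "real N * \<epsilon> < \<sigma> * (real N powr (1 / \<alpha>) * step 0 0 \<omega>)"
          also have "\<dots> \<le> \<bar>step 0 0 \<omega>\<bar> * sqrt (real N)"
            using \<sigma> by (auto simp: \<alpha> powr_half_sqrt mult.commute abs_if mult_nonneg_nonpos)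
          finally have "u * sqrt (real N) < \<bar>step 0 0 \<omega>\<bar> * sqrt (real N)" using u by simp
          then have "u < \<bar>step 0 0 \<omega>\<bar>" using N1 by simp
          then have "u powr p \<le> \<bar>step 0 0 \<omega>\<bar> powr p" using p by (intro powr_mono2) (auto simp: u_def)
          moreover have "u powr p = \<bar>v\<bar> + 1" using p by (simp add: u_def powr_powr)
          moreover have "\<bar>step 0 0 \<omega>\<bar> powr p \<le> ?V \<omega>" using elim by (simp add: step_0)
          ultimately show "v < ?V \<omega>" by linarith
        qed
      qed
    qed measurable
    finally show ?thesis .
  qed
  have mean: "(\<integral>\<^sup>+\<omega>. ennreal (?V \<omega>) \<partial>M) = (\<integral>\<^sup>+\<omega>. pvar p \<omega> \<partial>M)"
    using VZ by (intro nn_integral_cong_AE) auto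
  obtain m where m: "(\<integral>\<^sup>+\<omega>. ennreal (?V \<omega>) \<partial>M) = ennreal m" "0 \<le> m"
    using nn_integral_pvar_finite[OF \<alpha> p] unfolding mean by (cases "\<integral>\<^sup>+\<omega>. pvar p \<omega> \<partial>M") auto
  have "m \<noteq> 0"
  proof
    assume "m = 0"
    then have "AE \<omega> in M. ennreal (?V \<omega>) = 0" using m by (simp add: nn_integral_0_iff_AE)
    then have "AE \<omega> in M. \<not> ?V \<omega> > 0" by eventually_elim (simp add: ennreal_eq_0_iff not_less)
    then have "prob {\<omega>\<in>space M. ?V \<omega> > 0} = 0" by (intro prob_eq_0[THEN iffD2]) auto
    then show False using large[of 0] by simp
  qed
  then have "m > 0" using m by simp
  have "ennreal (2 * m) = ennreal (2 powr (1 / \<beta>) * m)"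
    using stable_rv_mean[OF X _ st, of 2] V0 m by (simp add: ennreal_mult)
  then have "2 powr (1 / \<beta>) = (2 :: real)" using m \<open>m > 0\<close> by simp
  then have \<beta>: "1 / \<beta> = 1" using powr_inj[of 2 "1 / \<beta>" 1] by simp
  define W where "W \<omega> = exp (- ?V \<omega>)" for \<omega>
  \<comment> \<open>With \<beta> = 1 and two copies, the Laplace transform at 2 is the square of
    that at 1: the second moment of \<open>W\<close> equals the square of its mean.\<close>
  have "(\<integral>\<^sup>+\<omega>. ennreal (W \<omega>) \<partial>M) ^ 2 = (\<integral>\<^sup>+\<omega>. ennreal (W \<omega> ^ 2) \<partial>M)"
    using stable_rv_laplace[OF X st, of 2 1] by (simp add: \<beta> W_def exp_of_nat_mult[symmetric])
  then have "AE \<omega> in M. W \<omega> = expectation W"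
    using V0 by (intro AE_const_of_second_moment[where B=1]) (auto simp: W_def)
  then have "AE \<omega> in M. \<not> ?V \<omega> > - ln (expectation W)"
  proof eventually_elim
    case (elim \<omega>)
    then have "- ln (expectation W) = ?V \<omega>" by (simp add: W_def[of \<omega>] elim[symmetric])
    then show ?case by simp
  qed
  then have "prob {\<omega>\<in>space M. ?V \<omega> > - ln (expectation W)} = 0" by (intro prob_eq_0[THEN iffD2]) auto
  then show False using large[of "- ln (expectation W)"] by simp
qed

lemma variation_power_not_stable:
  assumes p: "max 1 \<alpha> < p"
  shows "\<not> strictly_stable_rv M (variation_power p Z)"
proof
  assume "strictly_stable_rv M (variation_power p Z)"
  then obtain \<beta> where X: "variation_power p Z \<in> borel_measurable M" and \<beta>: "0 < \<beta>"
    and st: "\<And>n::nat. n \<ge> 1 \<Longrightarrow> distr (Pi\<^sub>M {..<n} (\<lambda>_. distr M borel (variation_power p Z))) borel (\<lambda>x. \<Sum>i<n. x i) =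
           distr M borel (\<lambda>\<omega>. real n powr (1 / \<beta>) * variation_power p Z \<omega>)"
    unfolding strictly_stable_rv_def by blast
  have ap: "\<alpha> < p" using p by simp
  have lap: "lap p c ^ n = lap p (c * real n powr (1 / \<beta>))" if "1 \<le> n" "0 \<le> c" for n c
    using stable_rv_laplace[OF X st that(1), of c] that
    by (simp add: lap_variation_power[OF ap, symmetric] mult.assoc)
  have lower: "\<alpha> / p < \<beta>"
    using p by (intro index_gt_of_stable \<beta> lap) auto
  show False
  proof (cases "\<alpha> = 2")
    case True
    then show ?thesis using variation_power_not_stable_gaussian[OF True _ X \<beta> st] p by simp
  next
    case False
    then have "\<beta> \<le> \<alpha> / p" using index_le_2 by (intro index_le_of_stable ap \<beta> lap) auto
    then show ?thesis using lower by simp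
  qed
qed

end

theorem theorem2:
  fixes M :: "'a measure" and Z :: "real \<Rightarrow> 'a \<Rightarrow> real" and \<alpha> p :: real
  assumes "strictly_stable_process M Z \<alpha>"
    and "p > max 1 \<alpha>"
  shows "\<not> strictly_stable_rv M (variation_power p Z)"
  using strictly_stable_process.variation_power_not_stable[OF assms] .

end
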